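(* Let $\Delta=(\mathcal{C},\delta)$ be a thick locally finite Bruhat--Tits building of type $\tilde X_n$, let $F\le\mathrm{Aut}(\Delta)$ be a closed subgroup containing $G^\dagger$, let $\Sigma$ be an apartment of $\Delta$, let $c\in\Sigma$, let $H=\{g\in\mathrm{Stab}_F(\Sigma)\mid g|_\Sigma\text{ is a translation}\}$, $\mathcal{H}=\{\iota_g\mid g\in H\}\le\mathrm{Aut}(F)$ where $\iota_g(x)=gxg^{-1}$, and $U=F_c\cap\mathrm{Aut}_0(\Delta)$. Let $R$ be a gem of $\Sigma$ containing $c$, let $d$ be the chamber of $R$ opposite $c$ in $R$, let $(c_0=c,\dots,c_k=d)$ be a minimal gallery, and let $\gamma_i=\iota_{f_{R,c_i}}\in\mathcal{H}$ for $1\le i\le k$. Then for all $\epsilon_1,\dots,\epsilon_k\in\{\pm1\}$ the subgroup $U_{\{\gamma_1^{\epsilon_1},\dots,\gamma_k^{\epsilon_k}\}}$ is a $U$-eigenfactor of $\mathcal{H}$.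
   Context: Buildings are $W$-metric: a building of type $(W,S)$ is a set $\mathcal{C}$ of chambers with a Weyl distance $\delta:\mathcal{C}\times\mathcal{C}\to W$ satisfying the usual axioms; chambers $x,y$ are adjacent if $\delta(x,y)\in S$; a $J$-residue is $\{y\mid\delta(x,y)\in\langle J\rangle\}$, panels are residues with $|J|=1$; thick: all panels have at least 3 chambers; locally finite: all panels are finite. $\mathrm{Aut}(\Delta)$ is the group of all (not necessarily type-preserving) automorphisms with the permutation topology on chambers, $\mathrm{Aut}_0(\Delta)$ the subgroup of special (type-preserving) ones. A set of chambers is convex if it contains all minimal galleries between its members; $\mathrm{conv}$ is convex hull; an apartment is a non-empty convex set meeting each panel in 0 or 2 chambers. An apartment $\Sigma$ is identified via a special isomorphism with the Coxeter building $\Sigma(W,S)=(W,(x,y)\mapsto x^{-1}y)$; its roots are the sets $v\alpha_s$, $\alpha_s=\{w\mid\ell(sw)>\ell(w)\}$. Roots $\alpha,\beta$ are parallel if $\alpha\subseteq\beta$ or $\beta\subseteq\alpha$. A translation of $\Sigma$ is an automorphism of $\Sigma$ (possibly non-special) mapping each root to a parallel root. $(W,S)$ is of irreducible affine type $\tilde X_n$; a vertex $o\in S$ of the diagram is special if deleting it gives $X_n$. A gem of $\Sigma$ is a residue of $\Sigma$ of type $S\setminus\{o\}$ with $o$ special (a finite set of chambers; two chambers of $R$ are opposite if their distance is the longest element of $\langle S\setminus\{o\}\rangle$). For a gem $R$ and $e\in R$, $[R,e]$ is the set of roots of $\Sigma$ containing $e$ but not some chamber of $R$ adjacent to $e$.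 For $\alpha\in[R,e]$, $T_{R,e,\alpha}$ is the group of translations fixing every root in $[R,e]$ except $\alpha$ (it acts transitively and faithfully on the parallel class of $\alpha$), and $t_{R,e,\alpha}\in T_{R,e,\alpha}$ is the special translation with $t_{R,e,\alpha}(\alpha)\subsetneq\alpha$ such that $t(\alpha)\subseteq t_{R,e,\alpha}(\alpha)$ for every special translation $t\in T_{R,e,\alpha}$ with $t(\alpha)\subsetneq\alpha$. Put $t_{R,e}=\prod_{\alpha\in[R,e]}t_{R,e,\alpha}$ (translations commute). $\Delta_\infty$ is the spherical building at infinity of $\Delta$ (w.r.t. the complete apartment system), of type $X_n$. A Bruhat--Tits building is an affine building of type $\tilde X_n$, $n\ge2$, with $\Delta_\infty$ Moufang. For a root $a$ of $\Delta_\infty$ the root group $U_a$ is the group of automorphisms of $\Delta_\infty$ fixing $a$ pointwise and fixing pointwise every panel $P$ with $|P\cap a|=2$; Moufang (for thick, irreducible spherical buildings of rank $\ge2$) means each $U_a$ acts simply transitively on the apartments containing $a$. $G^\dagger=\langle U_a\mid a\text{ a root of }\Delta_\infty\rangle$, regarded as a subgroup of $\mathrm{Aut}_0(\Delta)$ (each element is induced by a special automorphism of $\Delta$). Let $N=\mathrm{Stab}_F(\Sigma)\cap\mathrm{Aut}_0(\Delta)$; every special automorphism of $\Sigma$ is the restriction of an element of $N$. For $e\in R$ and $\alpha\in[R,e]$ choose $f_{R,e,\alpha}\in N$ with $f_{R,e,\alpha}|_\Sigma=t_{R,e,\alpha}$, and set $f_{R,e}=\prod_{\alpha\in[R,e]}f_{R,e,\alpha}$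 (product in some fixed order), so $f_{R,e}|_\Sigma=t_{R,e}$ and $f_{R,e}\in H$. For an automorphism $\alpha$ of $F$, $U_{\alpha+}=\bigcap_{n\ge0}\alpha^n(U)$, and for a finite set $\mathbf{a}$ of automorphisms $U_{\mathbf a}=\bigcap_{\alpha\in\mathbf a}U_{\alpha+}$. $U$ is tidy for $\mathcal{H}$, i.e. for each $\alpha\in\mathcal{H}$: $U$ is compact open, $U=U_{\alpha+}U_{\alpha^{-1}+}$ and $\bigcup_{n\ge0}\alpha^{-n}(U_{\alpha^{-1}+})$ is closed. A subgroup $E\le U$ is a $U$-eigenfactor of $\mathcal{H}$ if for each $\alpha\in\mathcal{H}$ we have $\alpha(E)\le E$ or $\alpha(E)\ge E$, and $E=\bigcap_{\alpha\in\mathcal{H},\,\alpha(E)\ge E}\alpha(U)$. *)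

theory Defs
  imports
    "HOL-Algebra.Bij"
    "HOL-Algebra.Generated_Groups"
    "HOL-Algebra.Multiplicative_Group"
    "HOL-Analysis.Function_Topology"
begin

section \<open>Coxeter systems\<close>

definition word_prod :: "('w, 'm) monoid_scheme \<Rightarrow> 'w list \<Rightarrow> 'w" where
  "word_prod W xs = foldr (\<lambda>x y. x \<otimes>\<^bsub>W\<^esub> y) xs \<one>\<^bsub>W\<^esub>"

text \<open>
  The congruence on words over \<open>S\<close> generated by the Coxeter relations
  \<open>(s t)\<^sup>m = 1\<close>, where \<open>m\<close> is the order of \<open>s t\<close>. For \<open>s = t\<close> this is \<open>s s = 1\<close>, so no formal
  inverses are needed. An infinite order is recorded by \<open>group.ord\<close> as \<open>0\<close>, which gives the
  empty relation, as it should.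
\<close>

inductive coxeter_cong :: "('w, 'm) monoid_scheme \<Rightarrow> 'w set \<Rightarrow> 'w list \<Rightarrow> 'w list \<Rightarrow> bool"
  for W S where
  relator: "\<lbrakk>s \<in> S; t \<in> S; us \<in> lists S; vs \<in> lists S\<rbrakk> \<Longrightarrow>
    coxeter_cong W S (us @ concat (replicate (group.ord W (s \<otimes>\<^bsub>W\<^esub> t)) [s, t]) @ vs) (us @ vs)"
| refl: "us \<in> lists S \<Longrightarrow> coxeter_cong W S us us"
| sym: "coxeter_cong W S us vs \<Longrightarrow> coxeter_cong W S vs us"
| trans: "\<lbrakk>coxeter_cong W S us vs; coxeter_cong W S vs ws\<rbrakk> \<Longrightarrow> coxeter_cong W S us ws"

text \<open>\<open>W\<close> is presented by the involutions in \<open>S\<close> and the Coxeter relations.\<close>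

definition coxeter_system :: "('w, 'm) monoid_scheme \<Rightarrow> 'w set \<Rightarrow> bool" where
  "coxeter_system W S \<longleftrightarrow> group W \<and> S \<subseteq> carrier W \<and> (\<forall>s\<in>S. group.ord W s = 2) \<and>
     generate W S = carrier W \<and>
     (\<forall>xs\<in>lists S. word_prod W xs = \<one>\<^bsub>W\<^esub> \<longrightarrow> coxeter_cong W S xs [])"

definition word_length :: "('w, 'm) monoid_scheme \<Rightarrow> 'w set \<Rightarrow> 'w \<Rightarrow> nat" where
  "word_length W S w = (LEAST n. \<exists>xs\<in>lists S. length xs = n \<and> word_prod W xs = w)"


section \<open>Irreducible spherical and affine diagrams\<close>

datatype cartan_type = Type_A nat | Type_B nat | Type_C nat | Type_D nat | Type_E nat | Type_F4 | Type_G2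

fun cartan_rank :: "cartan_type \<Rightarrow> nat" where
  "cartan_rank (Type_A n) = n"
| "cartan_rank (Type_B n) = n"
| "cartan_rank (Type_C n) = n"
| "cartan_rank (Type_D n) = n"
| "cartan_rank (Type_E n) = n"
| "cartan_rank Type_F4 = 4"
| "cartan_rank Type_G2 = 2"

fun valid_cartan_type :: "cartan_type \<Rightarrow> bool" where
  "valid_cartan_type (Type_A n) \<longleftrightarrow> 1 \<le> n"
| "valid_cartan_type (Type_B n) \<longleftrightarrow> 3 \<le> n"
| "valid_cartan_type (Type_C n) \<longleftrightarrow> 2 \<le> n"
| "valid_cartan_type (Type_D n) \<longleftrightarrow> 4 \<le> n"
| "valid_cartan_type (Type_E n) \<longleftrightarrow> n \<in> {6, 7, 8}"
| "valid_cartan_type Type_F4 \<longleftrightarrow> True"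
| "valid_cartan_type Type_G2 \<longleftrightarrow> True"

text \<open>
  Edges \<open>(i, j, m)\<close> of the Coxeter diagram \<open>X\<^sub>n\<close> on the vertices \<open>{1..n}\<close> (Bourbaki numbering),
  with \<open>m\<close> the label.
\<close>

fun spherical_edges :: "cartan_type \<Rightarrow> (nat \<times> nat \<times> nat) set" where
  "spherical_edges (Type_A n) = {(i, i + 1, 3) | i. 1 \<le> i \<and> i < n}"
| "spherical_edges (Type_B n) = {(i, i + 1, 3) | i. 1 \<le> i \<and> i + 1 < n} \<union> {(n - 1, n, 4)}"
| "spherical_edges (Type_C n) = {(i, i + 1, 3) | i. 1 \<le> i \<and> i + 1 < n} \<union> {(n - 1, n, 4)}"
| "spherical_edges (Type_D n) = {(i, i + 1, 3) | i. 1 \<le> i \<and> i + 1 < n} \<union> {(n - 2, n, 3)}"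
| "spherical_edges (Type_E n) = {(i, i + 1, 3) | i. 3 \<le> i \<and> i < n} \<union> {(1, 3, 3), (2, 4, 3)}"
| "spherical_edges Type_F4 = {(1, 2, 3), (2, 3, 4), (3, 4, 3)}"
| "spherical_edges Type_G2 = {(1, 2, 6)}"

text \<open>
  The edges joining the additional vertex \<open>0\<close> of the affine diagram to the others. The label
  \<open>0\<close> stands for infinity, as for \<open>group.ord\<close>.
\<close>

fun extending_edges :: "cartan_type \<Rightarrow> (nat \<times> nat \<times> nat) set" where
  "extending_edges (Type_A n) = (if n = 1 then {(0, 1, 0)} else {(0, 1, 3), (0, n, 3)})"
| "extending_edges (Type_B n) = {(0, 2, 3)}"
| "extending_edges (Type_C n) = {(0, 1, 4)}"
| "extending_edges (Type_D n) = {(0, 2, 3)}"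
| "extending_edges (Type_E n) = (if n = 6 then {(0, 2, 3)} else if n = 7 then {(0, 1, 3)} else {(0, 8, 3)})"
| "extending_edges Type_F4 = {(0, 1, 3)}"
| "extending_edges Type_G2 = {(0, 2, 3)}"

definition affine_edges :: "cartan_type \<Rightarrow> (nat \<times> nat \<times> nat) set" where
  "affine_edges X = spherical_edges X \<union> extending_edges X"

text \<open>The Coxeter diagram on \<open>J\<close> is isomorphic to the one with vertex set \<open>V\<close> and edge set \<open>E\<close>.\<close>

definition has_diagram ::
    "('w, 'm) monoid_scheme \<Rightarrow> 'w set \<Rightarrow> nat set \<Rightarrow> (nat \<times> nat \<times> nat) set \<Rightarrow> bool" where
  "has_diagram W J V E \<longleftrightarrow> (\<exists>\<phi>. bij_betw \<phi> V J \<and>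
     (\<forall>(i, j, m)\<in>E. group.ord W (\<phi> i \<otimes>\<^bsub>W\<^esub> \<phi> j) = m) \<and>
     (\<forall>i\<in>V. \<forall>j\<in>V. i \<noteq> j \<and> (\<nexists>m. (i, j, m) \<in> E \<or> (j, i, m) \<in> E) \<longrightarrow>
        group.ord W (\<phi> i \<otimes>\<^bsub>W\<^esub> \<phi> j) = 2))"


section \<open>Buildings as W-metric spaces\<close>

record ('w, 'c) w_metric =
  weyl :: "'w monoid"
  gens :: "'w set"
  chambers :: "'c set"
  wdist :: "'c \<Rightarrow> 'c \<Rightarrow> 'w"

definition building :: "('w, 'c) w_metric \<Rightarrow> bool" where
  "building \<Delta> \<longleftrightarrow>
     coxeter_system (weyl \<Delta>) (gens \<Delta>) \<and> chambers \<Delta> \<noteq> {} \<and>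
     (\<forall>x\<in>chambers \<Delta>. \<forall>y\<in>chambers \<Delta>. wdist \<Delta> x y \<in> carrier (weyl \<Delta>)) \<and>
     (\<forall>x\<in>chambers \<Delta>. \<forall>y\<in>chambers \<Delta>. wdist \<Delta> x y = \<one>\<^bsub>weyl \<Delta>\<^esub> \<longleftrightarrow> x = y) \<and>
     (\<forall>x\<in>chambers \<Delta>. \<forall>y\<in>chambers \<Delta>. \<forall>z\<in>chambers \<Delta>. \<forall>s\<in>gens \<Delta>. wdist \<Delta> y z = s \<longrightarrow>
        wdist \<Delta> x z \<in> {wdist \<Delta> x y, wdist \<Delta> x y \<otimes>\<^bsub>weyl \<Delta>\<^esub> s} \<and>
        (word_length (weyl \<Delta>) (gens \<Delta>) (wdist \<Delta> x y \<otimes>\<^bsub>weyl \<Delta>\<^esub> s)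
           = word_length (weyl \<Delta>) (gens \<Delta>) (wdist \<Delta> x y) + 1 \<longrightarrow>
         wdist \<Delta> x z = wdist \<Delta> x y \<otimes>\<^bsub>weyl \<Delta>\<^esub> s)) \<and>
     (\<forall>x\<in>chambers \<Delta>. \<forall>y\<in>chambers \<Delta>. \<forall>s\<in>gens \<Delta>. \<exists>z\<in>chambers \<Delta>.
        wdist \<Delta> y z = s \<and> wdist \<Delta> x z = wdist \<Delta> x y \<otimes>\<^bsub>weyl \<Delta>\<^esub> s)"

definition residues :: "('w, 'c) w_metric \<Rightarrow> 'w set \<Rightarrow> 'c set set" where
  "residues \<Delta> J = {{y \<in> chambers \<Delta>. wdist \<Delta> x y \<in> generate (weyl \<Delta>) J} | x. x \<in> chambers \<Delta>}"

definition panels :: "('w, 'c) w_metric \<Rightarrow> 'c set set" where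
  "panels \<Delta> = (\<Union>s\<in>gens \<Delta>. residues \<Delta> {s})"

definition thick :: "('w, 'c) w_metric \<Rightarrow> bool" where
  "thick \<Delta> \<longleftrightarrow> (\<forall>P\<in>panels \<Delta>. infinite P \<or> 3 \<le> card P)"

definition locally_finite :: "('w, 'c) w_metric \<Rightarrow> bool" where
  "locally_finite \<Delta> \<longleftrightarrow> (\<forall>P\<in>panels \<Delta>. finite P)"

definition adjacent :: "('w, 'c) w_metric \<Rightarrow> 'c \<Rightarrow> 'c \<Rightarrow> bool" where
  "adjacent \<Delta> x y \<longleftrightarrow> wdist \<Delta> x y \<in> gens \<Delta>"

definition gallery :: "('w, 'c) w_metric \<Rightarrow> 'c list \<Rightarrow> bool" where
  "gallery \<Delta> xs \<longleftrightarrow> xs \<noteq> [] \<and> set xs \<subseteq> chambers \<Delta> \<and> successively (adjacent \<Delta>) xs"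

definition minimal_gallery :: "('w, 'c) w_metric \<Rightarrow> 'c list \<Rightarrow> bool" where
  "minimal_gallery \<Delta> xs \<longleftrightarrow> gallery \<Delta> xs \<and>
     (\<forall>ys. gallery \<Delta> ys \<and> hd ys = hd xs \<and> last ys = last xs \<longrightarrow> length xs \<le> length ys)"

definition convex_chambers :: "('w, 'c) w_metric \<Rightarrow> 'c set \<Rightarrow> bool" where
  "convex_chambers \<Delta> A \<longleftrightarrow> A \<subseteq> chambers \<Delta> \<and>
     (\<forall>xs. minimal_gallery \<Delta> xs \<and> hd xs \<in> A \<and> last xs \<in> A \<longrightarrow> set xs \<subseteq> A)"

definition apartments :: "('w, 'c) w_metric \<Rightarrow> 'c set set" where
  "apartments \<Delta> = {A. A \<noteq> {} \<and> convex_chambers \<Delta> A \<and>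
     (\<forall>P\<in>panels \<Delta>. P \<inter> A = {} \<or> card (P \<inter> A) = 2)}"

definition on_chambers :: "('w, 'c) w_metric \<Rightarrow> 'c set \<Rightarrow> ('w, 'c) w_metric" where
  "on_chambers \<Delta> A = \<Delta>\<lparr>chambers := A\<rparr>"


section \<open>Automorphisms\<close>

text \<open>
  Automorphisms are elements of \<open>BijGroup (chambers \<Delta>)\<close>, i.e. bijections of the chamber set
  that are \<open>undefined\<close> outside of it. They may permute the types by an automorphism of \<open>(W, S)\<close>.
\<close>

definition aut :: "('w, 'c) w_metric \<Rightarrow> ('c \<Rightarrow> 'c) set" where
  "aut \<Delta> = {g \<in> Bij (chambers \<Delta>). \<exists>\<sigma>. \<sigma> \<in> iso (weyl \<Delta>) (weyl \<Delta>) \<and> \<sigma> ` gens \<Delta> = gens \<Delta> \<and>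
     (\<forall>x\<in>chambers \<Delta>. \<forall>y\<in>chambers \<Delta>. wdist \<Delta> (g x) (g y) = \<sigma> (wdist \<Delta> x y))}"

definition special_aut :: "('w, 'c) w_metric \<Rightarrow> ('c \<Rightarrow> 'c) set" where
  "special_aut \<Delta> = {g \<in> Bij (chambers \<Delta>).
     \<forall>x\<in>chambers \<Delta>. \<forall>y\<in>chambers \<Delta>. wdist \<Delta> (g x) (g y) = wdist \<Delta> x y}"

definition aut_group :: "('w, 'c) w_metric \<Rightarrow> ('c \<Rightarrow> 'c) monoid" where
  "aut_group \<Delta> = BijGroup (chambers \<Delta>)\<lparr>carrier := aut \<Delta>\<rparr>"

text \<open>
  The permutation topology: pointwise convergence with respect to the discrete topology on
  the chambers.
\<close>

definition aut_topology :: "('w, 'c) w_metric \<Rightarrow> ('c \<Rightarrow> 'c) topology" where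
  "aut_topology \<Delta> =
     subtopology (product_topology (\<lambda>_. discrete_topology (chambers \<Delta>)) (chambers \<Delta>)) (aut \<Delta>)"

definition special_iso :: "('w, 'c) w_metric \<Rightarrow> ('w, 'd) w_metric \<Rightarrow> ('c \<Rightarrow> 'd) set" where
  "special_iso \<Delta> \<Delta>' = {\<psi>. bij_betw \<psi> (chambers \<Delta>) (chambers \<Delta>') \<and>
     (\<forall>x\<in>chambers \<Delta>. \<forall>y\<in>chambers \<Delta>. wdist \<Delta>' (\<psi> x) (\<psi> y) = wdist \<Delta> x y)}"


section \<open>Roots and translations of an apartment\<close>

definition coxeter_building :: "'w monoid \<Rightarrow> 'w set \<Rightarrow> ('w, 'w) w_metric" where
  "coxeter_building W S =
     \<lparr>weyl = W, gens = S, chambers = carrier W, wdist = (\<lambda>x y. inv\<^bsub>W\<^esub> x \<otimes>\<^bsub>W\<^esub> y)\<rparr>"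

definition simple_root :: "('w, 'm) monoid_scheme \<Rightarrow> 'w set \<Rightarrow> 'w \<Rightarrow> 'w set" where
  "simple_root W S s = {w \<in> carrier W. word_length W S w < word_length W S (s \<otimes>\<^bsub>W\<^esub> w)}"

definition roots :: "('w, 'c) w_metric \<Rightarrow> 'c set \<Rightarrow> 'c set set" where
  "roots \<Delta> \<Sigma> = {\<psi> ` (\<lambda>w. v \<otimes>\<^bsub>weyl \<Delta>\<^esub> w) ` simple_root (weyl \<Delta>) (gens \<Delta>) s | \<psi> v s.
     \<psi> \<in> special_iso (coxeter_building (weyl \<Delta>) (gens \<Delta>)) (on_chambers \<Delta> \<Sigma>) \<and>
     v \<in> carrier (weyl \<Delta>) \<and> s \<in> gens \<Delta>}"

definition apartment_translations :: "('w, 'c) w_metric \<Rightarrow> 'c set \<Rightarrow> ('c \<Rightarrow> 'c) set" where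
  "apartment_translations \<Delta> \<Sigma> = {t \<in> aut (on_chambers \<Delta> \<Sigma>). \<forall>\<alpha>\<in>roots \<Delta> \<Sigma>. t ` \<alpha> \<subseteq> \<alpha> \<or> \<alpha> \<subseteq> t ` \<alpha>}"

definition special_translations :: "('w, 'c) w_metric \<Rightarrow> 'c set \<Rightarrow> ('c \<Rightarrow> 'c) set" where
  "special_translations \<Delta> \<Sigma> = apartment_translations \<Delta> \<Sigma> \<inter> special_aut (on_chambers \<Delta> \<Sigma>)"

text \<open>The set \<open>[R, e]\<close>, for a residue \<open>R\<close> of the apartment \<open>\<Sigma>\<close>.\<close>

definition roots_at :: "('w, 'c) w_metric \<Rightarrow> 'c set \<Rightarrow> 'c set \<Rightarrow> 'c \<Rightarrow> 'c set set" where
  "roots_at \<Delta> \<Sigma> R e = {\<alpha> \<in> roots \<Delta> \<Sigma>. e \<in> \<alpha> \<and> (\<exists>e'\<in>R. adjacent \<Delta> e e' \<and> e' \<notin> \<alpha>)}"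

text \<open>The group \<open>T\<close> attached to \<open>R\<close>, \<open>e\<close> and \<open>\<alpha> \<in> [R, e]\<close>.\<close>

definition root_translations ::
    "('w, 'c) w_metric \<Rightarrow> 'c set \<Rightarrow> 'c set \<Rightarrow> 'c \<Rightarrow> 'c set \<Rightarrow> ('c \<Rightarrow> 'c) set" where
  "root_translations \<Delta> \<Sigma> R e \<alpha> =
     {t \<in> apartment_translations \<Delta> \<Sigma>. \<forall>\<beta>\<in>roots_at \<Delta> \<Sigma> R e - {\<alpha>}. t ` \<beta> = \<beta>}"

text \<open>\<open>t\<close> is the minimal special translation in \<open>T\<close> moving \<open>\<alpha>\<close> properly into itself.\<close>

definition is_basic_translation ::
    "('w, 'c) w_metric \<Rightarrow> 'c set \<Rightarrow> 'c set \<Rightarrow> 'c \<Rightarrow> 'c set \<Rightarrow> ('c \<Rightarrow> 'c) \<Rightarrow> bool" where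
  "is_basic_translation \<Delta> \<Sigma> R e \<alpha> t \<longleftrightarrow>
     t \<in> root_translations \<Delta> \<Sigma> R e \<alpha> \<inter> special_translations \<Delta> \<Sigma> \<and> t ` \<alpha> \<subset> \<alpha> \<and>
     (\<forall>t' \<in> root_translations \<Delta> \<Sigma> R e \<alpha> \<inter> special_translations \<Delta> \<Sigma>.
        t' ` \<alpha> \<subset> \<alpha> \<longrightarrow> t' ` \<alpha> \<subseteq> t ` \<alpha>)"

definition opposite_in :: "('w, 'c) w_metric \<Rightarrow> 'w set \<Rightarrow> 'c \<Rightarrow> 'c \<Rightarrow> bool" where
  "opposite_in \<Delta> J x y \<longleftrightarrow> wdist \<Delta> x y \<in> generate (weyl \<Delta>) J \<and>
     (\<forall>w\<in>generate (weyl \<Delta>) J.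
        word_length (weyl \<Delta>) (gens \<Delta>) w \<le> word_length (weyl \<Delta>) (gens \<Delta>) (wdist \<Delta> x y))"


section \<open>Root groups and the Moufang condition\<close>

definition root_group :: "('w, 'c) w_metric \<Rightarrow> 'c set \<Rightarrow> ('c \<Rightarrow> 'c) set" where
  "root_group \<Delta> a = {g \<in> aut \<Delta>. (\<forall>x\<in>a. g x = x) \<and>
     (\<forall>P\<in>panels \<Delta>. card (P \<inter> a) = 2 \<longrightarrow> (\<forall>x\<in>P. g x = x))}"

definition building_roots :: "('w, 'c) w_metric \<Rightarrow> 'c set set" where
  "building_roots \<Delta> = (\<Union>A\<in>apartments \<Delta>. roots \<Delta> A)"

text \<open>
  Only used for thick irreducible spherical buildings of rank at least 2.
\<close>

definition moufang :: "('w, 'c) w_metric \<Rightarrow> bool" where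
  "moufang \<Delta> \<longleftrightarrow> (\<forall>a\<in>building_roots \<Delta>. \<forall>A\<in>apartments \<Delta>. \<forall>B\<in>apartments \<Delta>.
     a \<subseteq> A \<and> a \<subseteq> B \<longrightarrow> (\<exists>!g. g \<in> root_group \<Delta> a \<and> g ` A = B))"


section \<open>Affine buildings and the building at infinity\<close>

definition affine_building :: "cartan_type \<Rightarrow> ('w, 'c) w_metric \<Rightarrow> bool" where
  "affine_building X \<Delta> \<longleftrightarrow> valid_cartan_type X \<and> building \<Delta> \<and>
     has_diagram (weyl \<Delta>) (gens \<Delta>) {0..cartan_rank X} (affine_edges X)"

definition special_vertex :: "cartan_type \<Rightarrow> ('w, 'c) w_metric \<Rightarrow> 'w \<Rightarrow> bool" where
  "special_vertex X \<Delta> p \<longleftrightarrow> p \<in> gens \<Delta> \<and>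
     has_diagram (weyl \<Delta>) (gens \<Delta> - {p}) {1..cartan_rank X} (spherical_edges X)"

definition gems :: "('w, 'c) w_metric \<Rightarrow> 'c set \<Rightarrow> 'w \<Rightarrow> 'c set set" where
  "gems \<Delta> \<Sigma> p = residues (on_chambers \<Delta> \<Sigma>) (gens \<Delta> - {p})"

text \<open>The sector with base gem \<open>R\<close> and base chamber \<open>e\<close>.\<close>

definition sector :: "('w, 'c) w_metric \<Rightarrow> 'c set \<Rightarrow> 'c set \<Rightarrow> 'c \<Rightarrow> 'c set" where
  "sector \<Delta> \<Sigma> R e = \<Inter>(roots_at \<Delta> \<Sigma> R e)"

definition sectors :: "cartan_type \<Rightarrow> ('w, 'c) w_metric \<Rightarrow> 'c set set" where
  "sectors X \<Delta> = {sector \<Delta> \<Sigma> R e | \<Sigma> p R e.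
     \<Sigma> \<in> apartments \<Delta> \<and> special_vertex X \<Delta> p \<and> R \<in> gems \<Delta> \<Sigma> p \<and> e \<in> R}"

text \<open>Two sectors are parallel if they have a common subsector.\<close>

definition sector_parallel :: "cartan_type \<Rightarrow> ('w, 'c) w_metric \<Rightarrow> ('c set \<times> 'c set) set" where
  "sector_parallel X \<Delta> = {(A, B). A \<in> sectors X \<Delta> \<and> B \<in> sectors X \<Delta> \<and>
     (\<exists>D\<in>sectors X \<Delta>. D \<subseteq> A \<inter> B)}"

text \<open>
  The building at infinity with respect to the complete system of apartments. Its chambers are
  the parallel classes of sectors. The special vertex \<open>p\<close> only serves to name the types: the
  Weyl group is realised as \<open>\<langle>S - {p}\<rangle>\<close>, and the Weyl distance of two classes is the Weyl distance
  of the base chambers of representatives with the same base gem of type \<open>S - {p}\<close>. Another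
  choice of \<open>p\<close> leads to the same chambers, panels, apartments, roots and automorphisms.
\<close>

definition building_at_infinity ::
    "cartan_type \<Rightarrow> 'w \<Rightarrow> ('w, 'c) w_metric \<Rightarrow> ('w, 'c set set) w_metric" where
  "building_at_infinity X p \<Delta> =
     \<lparr>weyl = (weyl \<Delta>)\<lparr>carrier := generate (weyl \<Delta>) (gens \<Delta> - {p})\<rparr>,
      gens = gens \<Delta> - {p},
      chambers = sectors X \<Delta> // sector_parallel X \<Delta>,
      wdist = (\<lambda>x y. THE w. \<exists>\<Sigma>\<in>apartments \<Delta>. \<exists>R\<in>gems \<Delta> \<Sigma> p. \<exists>e\<in>R. \<exists>e'\<in>R.
        sector \<Delta> \<Sigma> R e \<in> x \<and> sector \<Delta> \<Sigma> R e' \<in> y \<and> wdist \<Delta> e e' = w)\<rparr>"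

definition bruhat_tits :: "cartan_type \<Rightarrow> 'w \<Rightarrow> ('w, 'c) w_metric \<Rightarrow> bool" where
  "bruhat_tits X p \<Delta> \<longleftrightarrow> affine_building X \<Delta> \<and> 2 \<le> cartan_rank X \<and> special_vertex X \<Delta> p \<and>
     moufang (building_at_infinity X p \<Delta>)"

definition induced_at_infinity ::
    "cartan_type \<Rightarrow> ('w, 'c) w_metric \<Rightarrow> ('c \<Rightarrow> 'c) \<Rightarrow> 'c set set \<Rightarrow> 'c set set" where
  "induced_at_infinity X \<Delta> g =
     (\<lambda>x \<in> sectors X \<Delta> // sector_parallel X \<Delta>. (\<lambda>A. g ` A) ` x)"

text \<open>
  The group generated by all root groups of the building at infinity, transported to \<open>\<Delta>\<close> along
  the injective map sending a special automorphism to the automorphism it induces at infinity.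
\<close>

definition G_dagger :: "cartan_type \<Rightarrow> 'w \<Rightarrow> ('w, 'c) w_metric \<Rightarrow> ('c \<Rightarrow> 'c) set" where
  "G_dagger X p \<Delta> = {g \<in> special_aut \<Delta>. induced_at_infinity X \<Delta> g \<in>
     generate (aut_group (building_at_infinity X p \<Delta>))
       (\<Union>a\<in>building_roots (building_at_infinity X p \<Delta>).
          root_group (building_at_infinity X p \<Delta>) a)}"


section \<open>Eigenfactors\<close>

definition conj_aut :: "('g, 'm) monoid_scheme \<Rightarrow> 'g \<Rightarrow> 'g \<Rightarrow> 'g" where
  "conj_aut G g = (\<lambda>x\<in>carrier G. g \<otimes>\<^bsub>G\<^esub> x \<otimes>\<^bsub>G\<^esub> inv\<^bsub>G\<^esub> g)"

definition plus_part :: "('g, 'm) monoid_scheme \<Rightarrow> 'g set \<Rightarrow> ('g \<Rightarrow> 'g) \<Rightarrow> 'g set" where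
  "plus_part G U \<alpha> = (\<Inter>n::nat. (\<alpha> [^]\<^bsub>AutoGroup G\<^esub> n) ` U)"

definition plus_parts :: "('g, 'm) monoid_scheme \<Rightarrow> 'g set \<Rightarrow> ('g \<Rightarrow> 'g) set \<Rightarrow> 'g set" where
  "plus_parts G U as = (\<Inter>\<alpha>\<in>as. plus_part G U \<alpha>)"

definition eigenfactor ::
    "('g, 'm) monoid_scheme \<Rightarrow> 'g set \<Rightarrow> ('g \<Rightarrow> 'g) set \<Rightarrow> 'g set \<Rightarrow> bool" where
  "eigenfactor G U \<H> E \<longleftrightarrow> subgroup E G \<and> E \<subseteq> U \<and>
     (\<forall>\<alpha>\<in>\<H>. \<alpha> ` E \<subseteq> E \<or> E \<subseteq> \<alpha> ` E) \<and>
     E = (\<Inter>\<alpha>\<in>{\<alpha>\<in>\<H>. E \<subseteq> \<alpha> ` E}. \<alpha> ` U)"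

definition apartment_stabilizer :: "('c \<Rightarrow> 'c) set \<Rightarrow> 'c set \<Rightarrow> ('c \<Rightarrow> 'c) set" where
  "apartment_stabilizer F \<Sigma> = {g \<in> F. g ` \<Sigma> = \<Sigma>}"

definition translation_stabilizer ::
    "('w, 'c) w_metric \<Rightarrow> ('c \<Rightarrow> 'c) set \<Rightarrow> 'c set \<Rightarrow> ('c \<Rightarrow> 'c) set" where
  "translation_stabilizer \<Delta> F \<Sigma> =
     {g \<in> apartment_stabilizer F \<Sigma>. restrict g \<Sigma> \<in> apartment_translations \<Delta> \<Sigma>}"

end

theory Submission
  imports Defs
begin

text \<open>
  Special automorphisms are rigid: one that fixes a set of chambers of \<open>\<Sigma>\<close> fixes every chamber in
  its convex hull, which is the intersection of the roots containing the set
  (\<open>fixed_outside_root\<close>). Write \<open>Fix D\<close> for the group of special elements of \<open>F\<close> fixing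
  \<open>D \<subseteq> \<Sigma>\<close> pointwise. Conjugation by \<open>g\<close> carries \<open>Fix D\<close> to \<open>Fix (g D)\<close>, so the subgroup
  \<open>E\<close> in question is \<open>Fix A\<close> for the set \<open>A\<close> of all chambers \<open>g\<^sub>i\<^sup>n c\<close> with \<open>n \<ge> 0\<close>,
  where \<open>g\<^sub>i\<close> induces \<open>\<gamma>\<^sub>i\<close> to the power \<open>\<epsilon>\<^sub>i\<close>, and therefore \<open>E = Fix B\<close> for the hull \<open>B\<close> of \<open>A\<close>.

  The key point is that \<open>B\<close> is either all of \<open>\<Sigma>\<close> or a single root
  (\<open>roots_containing_translates\<close>), and that \<open>g\<^sub>i B \<subseteq> B\<close>. The rest is formal
  (\<open>eigenfactor_of_hull\<close>). A translation moves every root to a comparable one, so \<open>Fix B\<close> and its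
  conjugate by an element of \<open>H\<close> are comparable. The powers of the \<open>g\<^sub>i\<close> conjugate \<open>Fix B\<close> to
  groups containing it, and the corresponding conjugates of \<open>U\<close> already have intersection \<open>E\<close>.

  Why is the hull a root? A root containing \<open>c\<close> contains \<open>A\<close> if and only if no \<open>g\<^sub>i\<close> enlarges it.
  As the gem \<open>R\<close> is special, every root is parallel to one whose wall cuts \<open>R\<close>, and such a wall
  separates \<open>c\<close> from the opposite chamber \<open>d\<close>. So it is crossed at some step \<open>j\<close> of the gallery. The
  translation at \<open>c\<^sub>i\<close> shrinks all roots through \<open>R\<close> containing \<open>c\<^sub>i\<close> and enlarges the others
  (\<open>shift_sign\<close>). Hence the signs \<open>\<epsilon>\<^sub>i\<close> prescribe on which side of the wall each \<open>c\<^sub>i\<close> lies, and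
  this determines \<open>j\<close> and the root (\<open>gallery_sides_determine_root\<close>). The roots containing \<open>A\<close>
  therefore form a single chain, and the chain has a least member.

  These arguments take place in the affine Weyl group \<open>W\<close>, which is the apartment by
  \<open>apartment_coordinates\<close>. It acts on real vectors through an integral reflection representation
  whose form has a null vector \<open>a\<close>, the vector of marks. By a theorem of Tits
  (\<open>length_increases_imp_positive\<close>) the roots of \<open>W\<close> are the half-spaces
  \<open>{w. w\<inverse> x \<ge> 0}\<close> of the real root vectors \<open>x\<close>. Nested half-spaces have the same direction
  modulo \<open>a\<close> (\<open>nested_half_parallel\<close>), and the translations are the elements that
  shift every root vector by a multiple of \<open>a\<close>. For the node of mark 1 that extends the spherical diagram,
  every root vector is congruent to one of the finite parabolic subgroup, because the simple root
  there is the negative of a root of that subgroup modulo \<open>a\<close> (\<open>root_parallel_linear\<close>). Any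
  other special vertex has a parabolic subgroup with the same diagram, hence with the same finite number of
  directions (\<open>special_vertex_directions\<close>).
\<close>

section \<open>Words and lengths in Coxeter systems\<close>

(* Membership in lists S is used as an atomic fact throughout. *)
declare in_listsD [rule del] in_listsI [rule del]

lemma word_prod_Nil [simp]: "word_prod W [] = \<one>\<^bsub>W\<^esub>"
  and word_prod_Cons [simp]: "word_prod W (x # xs) = x \<otimes>\<^bsub>W\<^esub> word_prod W xs"
  by (simp_all add: word_prod_def)

locale coxeter = group W for W :: "('w, 'm) monoid_scheme" (structure) and S :: "'w set" +
  assumes cox: "coxeter_system W S"
begin

abbreviation wlen :: "'w \<Rightarrow> nat" where
  "wlen \<equiv> word_length W S"

abbreviation wp :: "'w list \<Rightarrow> 'w" where
  "wp \<equiv> word_prod W"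

definition reduced :: "'w list \<Rightarrow> bool" where
  "reduced xs \<longleftrightarrow> xs \<in> lists S \<and> length xs = wlen (wp xs)"

lemma gen_closed [simp]: "s \<in> S \<Longrightarrow> s \<in> carrier W"
  and gen_ord: "s \<in> S \<Longrightarrow> ord s = 2"
  and gen_generate: "generate W S = carrier W"
  and gen_presentation: "xs \<in> lists S \<Longrightarrow> wp xs = \<one> \<Longrightarrow> coxeter_cong W S xs []"
  using cox by (auto simp: coxeter_system_def)

lemma gen_sq [simp]:
  assumes "s \<in> S" shows "s \<otimes> s = \<one>"
  using pow_ord_eq_1[of s] assms gen_ord[OF assms] by (simp add: numeral_2_eq_2)

lemma gen_inv [simp]: "s \<in> S \<Longrightarrow> inv s = s"
  by (simp add: inv_equality)

lemma gen_neq_one [simp]: "s \<in> S \<Longrightarrow> s \<noteq> \<one>"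
  using gen_ord by fastforce

lemma gen_cancel_left [simp]: "s \<in> S \<Longrightarrow> w \<in> carrier W \<Longrightarrow> s \<otimes> (s \<otimes> w) = w"
  by (simp add: m_assoc[symmetric])

lemma gen_cancel_right [simp]: "s \<in> S \<Longrightarrow> w \<in> carrier W \<Longrightarrow> w \<otimes> s \<otimes> s = w"
  by (simp add: m_assoc)

lemma wp_closed [simp]: "xs \<in> lists S \<Longrightarrow> wp xs \<in> carrier W"
  by (induction xs) auto

lemma wp_append: "xs \<in> lists S \<Longrightarrow> ys \<in> lists S \<Longrightarrow> wp (xs @ ys) = wp xs \<otimes> wp ys"
  by (induction xs) (auto simp: m_assoc)

lemma rev_lists [simp]: "rev xs \<in> lists A \<longleftrightarrow> xs \<in> lists A"
  by (auto simp: in_lists_conv_set)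

lemma wp_rev: "xs \<in> lists S \<Longrightarrow> wp (rev xs) = inv (wp xs)"
proof (induction xs)
  case (Cons a xs)
  then have "wp (rev xs @ [a]) = wp (rev xs) \<otimes> a" by (subst wp_append) auto
  with Cons show ?case by (auto simp: inv_mult_group)
qed simp

lemma word_over:
  assumes "w \<in> generate W K" "K \<subseteq> S"
  shows "\<exists>xs\<in>lists K. wp xs = w"
  using assms(1)
proof (induction rule: generate.induct)
  case one
  show ?case by (rule bexI[of _ "[]"]) auto
next
  case (incl h)
  with assms show ?case by (intro bexI[of _ "[h]"]) auto
next
  case (inv h)
  with assms show ?case by (intro bexI[of _ "[h]"]) auto
next
  case (eng h1 h2)
  then obtain xs ys where "xs \<in> lists K" "ys \<in> lists K" "wp xs = h1" "wp ys = h2" by blast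
  moreover from this assms(2) have "xs \<in> lists S" "ys \<in> lists S"
    using lists_mono[of K S] by auto
  ultimately show ?case by (intro bexI[of _ "xs @ ys"]) (auto simp: wp_append)
qed

lemma word_in_generate: "xs \<in> lists K \<Longrightarrow> wp xs \<in> generate W K"
  by (induction xs) (auto intro: generate.intros)

lemma word_ex: "w \<in> carrier W \<Longrightarrow> \<exists>xs\<in>lists S. wp xs = w"
  using word_over[of w S] gen_generate by auto

lemma wlen_le: "xs \<in> lists S \<Longrightarrow> wlen (wp xs) \<le> length xs"
  unfolding word_length_def by (rule Least_le) blast

lemma reduced_word_ex:
  assumes "w \<in> carrier W"
  obtains xs where "reduced xs" "wp xs = w"
proof -
  have "\<exists>n. \<exists>xs\<in>lists S. length xs = n \<and> wp xs = w"
    using word_ex[OF assms] by blast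
  from LeastI_ex[OF this] obtain xs where "xs \<in> lists S" "wp xs = w" "length xs = wlen w"
    unfolding word_length_def by blast
  with that show ?thesis by (auto simp: reduced_def)
qed

lemma wlen_one [simp]: "wlen \<one> = 0"
  using wlen_le[of "[]"] by simp

lemma wlen_eq_0: "w \<in> carrier W \<Longrightarrow> wlen w = 0 \<longleftrightarrow> w = \<one>"
  by (metis length_0_conv reduced_def reduced_word_ex wlen_one word_prod_Nil)

lemma wlen_mult:
  assumes "u \<in> carrier W" "v \<in> carrier W"
  shows "wlen (u \<otimes> v) \<le> wlen u + wlen v"
  using assms by (metis append_in_lists_conv length_append reduced_def reduced_word_ex wlen_le wp_append)

lemma wlen_gen_le: "s \<in> S \<Longrightarrow> wlen s \<le> 1"
  using wlen_le[of "[s]"] by simp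

lemma wlen_gen [simp]: "s \<in> S \<Longrightarrow> wlen s = 1"
  using wlen_gen_le[of s] wlen_eq_0[of s] by (metis gen_closed gen_neq_one le_antisym less_one not_le)

lemma wlen_inv:
  assumes "w \<in> carrier W" shows "wlen (inv w) = wlen w"
proof -
  have "wlen (inv w) \<le> wlen w" if "w \<in> carrier W" for w
    using reduced_word_ex[OF that] wlen_le wp_rev
    by (metis in_listsI in_listsD length_rev reduced_def set_rev)
  from this[of w] this[of "inv w"] assms show ?thesis by simp
qed

text \<open>The relators have even length, so the length of a word modulo 2 only depends on its product.\<close>

lemma cong_parity: "coxeter_cong W S xs ys \<Longrightarrow> even (length xs) = even (length ys)"
  by (induction rule: coxeter_cong.induct) (auto simp: length_concat sum_list_replicate)

lemma cong_of_eq: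
  assumes "xs \<in> lists S" "ys \<in> lists S" "wp xs = wp ys"
  shows "coxeter_cong W S (xs @ rev ys) []"
proof (rule gen_presentation)
  show "wp (xs @ rev ys) = \<one>"
    using assms by (subst wp_append) (auto simp: wp_rev)
qed (use assms in auto)

lemma parity:
  assumes "xs \<in> lists S" "ys \<in> lists S" "wp xs = wp ys"
  shows "even (length xs) = even (length ys)"
  using cong_parity[OF cong_of_eq[OF assms]] by auto

lemma wlen_parity: "xs \<in> lists S \<Longrightarrow> even (wlen (wp xs)) = even (length xs)"
  by (metis parity reduced_def reduced_word_ex wp_closed)

lemma wlen_mult_gen:
  assumes "w \<in> carrier W" "s \<in> S"
  shows "wlen (w \<otimes> s) = wlen w + 1 \<or> wlen w = wlen (w \<otimes> s) + 1"
proof -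
  have "wlen (w \<otimes> s) \<le> wlen w + 1" "wlen w \<le> wlen (w \<otimes> s) + 1"
    using wlen_mult[of w s] wlen_mult[of "w \<otimes> s" s] assms by auto
  moreover obtain xs where "xs \<in> lists S" "wp xs = w" using assms word_ex by blast
  with assms have "even (wlen w) \<noteq> even (wlen (w \<otimes> s))"
    using wlen_parity[of xs] wlen_parity[of "xs @ [s]"] by (auto simp: wp_append)
  ultimately show ?thesis by presburger
qed

lemma wlen_gen_mult:
  assumes "w \<in> carrier W" "s \<in> S"
  shows "wlen (s \<otimes> w) = wlen w + 1 \<or> wlen w = wlen (s \<otimes> w) + 1"
  using wlen_mult_gen[of "inv w" s] assms wlen_inv[of w] wlen_inv[of "s \<otimes> w"]
  by (simp add: inv_mult_group)

lemma reduced_appendD: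
  assumes "reduced (xs @ ys)" shows "reduced xs" "reduced ys"
proof -
  have *: "xs \<in> lists S" "ys \<in> lists S" using assms by (auto simp: reduced_def)
  have "length xs + length ys \<le> wlen (wp xs) + wlen (wp ys)"
    using assms * wlen_mult[of "wp xs" "wp ys"] by (auto simp: reduced_def wp_append)
  with wlen_le[OF *(1)] wlen_le[OF *(2)] * show "reduced xs" "reduced ys"
    by (auto simp: reduced_def)
qed

lemma reduced_rev: "reduced xs \<Longrightarrow> reduced (rev xs)"
  by (auto simp: reduced_def wp_rev wlen_inv)

lemma reduced_snocD:
  assumes "reduced (xs @ [s])"
  shows "s \<in> S" "wlen (wp xs \<otimes> s) = wlen (wp xs) + 1"
  using assms reduced_appendD[OF assms] by (auto simp: reduced_def wp_append)

lemma descent_ex: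
  assumes "w \<in> carrier W" "w \<noteq> \<one>"
  obtains s where "s \<in> S" "wlen (s \<otimes> w) < wlen w"
proof -
  obtain xs where xs: "reduced xs" "wp xs = w" using reduced_word_ex assms by blast
  with assms obtain s ys where "xs = s # ys" by (cases xs) auto
  moreover from this xs have "ys \<in> lists S" "s \<in> S" by (auto simp: reduced_def)
  moreover from this \<open>xs = s # ys\<close> xs have "s \<otimes> w = wp ys" by auto
  ultimately show ?thesis using xs wlen_le[of ys] that[of s]
    by (simp add: reduced_def)
qed

lemma descent_right_ex:
  assumes "w \<in> carrier W" "w \<noteq> \<one>"
  obtains s where "s \<in> S" "wlen (w \<otimes> s) < wlen w"
proof -
  have "inv w \<noteq> \<one>" using assms by (metis inv_inv inv_one)
  then obtain s where "s \<in> S" "wlen (s \<otimes> inv w) < wlen (inv w)"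
    using descent_ex[of "inv w"] assms by auto
  then show ?thesis using that[of s] assms wlen_inv[of w] wlen_inv[of "w \<otimes> s"]
    by (simp add: inv_mult_group)
qed

end

section \<open>The integral reflection representation of an affine Coxeter group\<close>

text \<open>
  The data that turn a Coxeter system into an affine Weyl group: \<open>b\<close> is the Gram matrix of simple
  roots whose lengths are chosen such that the numbers \<open>2 b s t / b s s\<close> are integers, and \<open>a\<close>
  is a positive integral vector in its radical. The node \<open>z\<close> has mark 1 and a simple root of norm 2,
  the least possible. The pairs in \<open>b_ord\<close> consist of an order \<open>m\<close> and \<open>4 cos\<^sup>2 (\<pi> / m)\<close>.
  Connectedness of the diagram is stated as an induction principle starting at \<open>z\<close>.
\<close>

locale affine_coxeter = coxeter W S for W :: "('w, 'm) monoid_scheme" (structure) and S +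
  fixes b :: "'w \<Rightarrow> 'w \<Rightarrow> real" and a :: "'w \<Rightarrow> real" and z :: 'w
  assumes fin: "finite S"
    and b_sym: "s \<in> S \<Longrightarrow> t \<in> S \<Longrightarrow> b s t = b t s"
    and b_int: "s \<in> S \<Longrightarrow> t \<in> S \<Longrightarrow> b s t \<in> \<int>"
    and b_cartan: "s \<in> S \<Longrightarrow> t \<in> S \<Longrightarrow> 2 * b s t / b s s \<in> \<int>"
    and b_diag: "s \<in> S \<Longrightarrow> 2 \<le> b s s"
    and b_off: "s \<in> S \<Longrightarrow> t \<in> S \<Longrightarrow> s \<noteq> t \<Longrightarrow> b s t \<le> 0"
    and b_ord: "s \<in> S \<Longrightarrow> t \<in> S \<Longrightarrow> s \<noteq> t \<Longrightarrow>
      (ord (s \<otimes> t), 4 * (b s t)\<^sup>2 / (b s s * b t t)) \<in> {(2, 0), (3, 1), (4, 2), (6, 3)}"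
    and a_outside: "s \<notin> S \<Longrightarrow> a s = 0"
    and a_pos: "s \<in> S \<Longrightarrow> 0 < a s"
    and a_int: "s \<in> S \<Longrightarrow> a s \<in> \<int>"
    and a_null: "s \<in> S \<Longrightarrow> (\<Sum>t\<in>S. b s t * a t) = 0"
    and z_in: "z \<in> S" and b_z: "b z z = 2" and a_z: "a z = 1"
    and conn: "\<lbrakk>A \<subseteq> S; z \<in> A; \<And>s t. s \<in> A \<Longrightarrow> t \<in> S \<Longrightarrow> b s t \<noteq> 0 \<Longrightarrow> t \<in> A\<rbrakk> \<Longrightarrow> A = S"
begin

text \<open>
  Vectors are functions on the whole type. All root vectors vanish outside \<open>S\<close>, as \<open>a\<close> does.
\<close>

definition comb :: "real \<Rightarrow> ('w \<Rightarrow> real) \<Rightarrow> real \<Rightarrow> ('w \<Rightarrow> real) \<Rightarrow> 'w \<Rightarrow> real" where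
  "comb p v q w = (\<lambda>u. p * v u + q * w u)"

definition basis :: "'w \<Rightarrow> 'w \<Rightarrow> real" where
  "basis s = (\<lambda>u. if u = s then 1 else 0)"

definition coroot :: "'w \<Rightarrow> ('w \<Rightarrow> real) \<Rightarrow> real" where
  "coroot s v = (\<Sum>t\<in>S. 2 * b s t / b s s * v t)"

definition srefl :: "'w \<Rightarrow> ('w \<Rightarrow> real) \<Rightarrow> 'w \<Rightarrow> real" where
  "srefl s v = v(s := v s - coroot s v)"

definition frm :: "('w \<Rightarrow> real) \<Rightarrow> ('w \<Rightarrow> real) \<Rightarrow> real" where
  "frm v w = (\<Sum>s\<in>S. \<Sum>t\<in>S. b s t * v s * w t)"

definition act :: "'w list \<Rightarrow> ('w \<Rightarrow> real) \<Rightarrow> 'w \<Rightarrow> real" where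
  "act xs v = foldr srefl xs v"

definition rep :: "'w \<Rightarrow> ('w \<Rightarrow> real) \<Rightarrow> 'w \<Rightarrow> real" where
  "rep w = act (SOME xs. xs \<in> lists S \<and> wp xs = w)"

lemma comb_apply [simp]: "comb p v q w u = p * v u + q * w u"
  by (simp add: comb_def)

lemma basis_same [simp]: "basis s s = 1"
  and basis_other [simp]: "u \<noteq> s \<Longrightarrow> basis s u = 0"
  by (simp_all add: basis_def)

lemma b_pos: "s \<in> S \<Longrightarrow> 0 < b s s"
  using b_diag[of s] by simp

lemma coroot_comb: "coroot s (comb p v q w) = p * coroot s v + q * coroot s w"
  by (simp add: coroot_def sum_distrib_left sum.distrib[symmetric] algebra_simps add_divide_distrib)

lemma coroot_basis: "t \<in> S \<Longrightarrow> coroot s (basis t) = 2 * b s t / b s s"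
  using sum.delta[OF fin, of t "\<lambda>u. 2 * b s u / b s s"]
  by (simp add: coroot_def basis_def if_distrib cong: if_cong)

lemma coroot_self [simp]: "s \<in> S \<Longrightarrow> coroot s (basis s) = 2"
  using b_pos[of s] by (simp add: coroot_basis)

lemma coroot_null [simp]: "s \<in> S \<Longrightarrow> coroot s a = 0"
  using a_null[of s] by (simp add: coroot_def sum_divide_distrib[symmetric] sum_distrib_left[symmetric] mult.assoc)

lemma srefl_eq: "srefl s v = comb 1 v (- coroot s v) (basis s)"
  by (auto simp: srefl_def basis_def)

lemma srefl_comb: "srefl s (comb p v q w) = comb p (srefl s v) q (srefl s w)"
  by (auto simp: srefl_def coroot_comb algebra_simps)

lemma srefl_srefl [simp]: "s \<in> S \<Longrightarrow> srefl s (srefl s v) = v"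
  by (rule ext) (simp add: srefl_eq coroot_comb algebra_simps)

lemma srefl_null [simp]: "s \<in> S \<Longrightarrow> srefl s a = a"
  by (auto simp: srefl_eq)

lemma srefl_basis_self: "s \<in> S \<Longrightarrow> srefl s (basis s) = comb (- 1) (basis s) 0 (basis s)"
  by (auto simp: srefl_eq)

lemma frm_sym: "frm v w = frm w v"
  unfolding frm_def by (subst sum.swap) (auto intro!: sum.cong simp: b_sym)

lemma frm_comb_left: "frm (comb p v q w) x = p * frm v x + q * frm w x"
  by (simp add: frm_def sum_distrib_left sum.distrib algebra_simps)

lemma frm_comb_right: "frm x (comb p v q w) = p * frm x v + q * frm x w"
  using frm_comb_left[of p v q w x] by (simp add: frm_sym)

lemma frm_basis_left: "t \<in> S \<Longrightarrow> frm (basis t) v = b t t * coroot t v / 2"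
proof -
  assume t: "t \<in> S"
  have "frm (basis t) v = (\<Sum>s\<in>S. if s = t then (\<Sum>u\<in>S. b t u * v u) else 0)"
    unfolding frm_def by (auto intro!: sum.cong simp: basis_def)
  also have "\<dots> = (\<Sum>u\<in>S. b t u * v u)" using fin t by simp
  finally show ?thesis
    using b_pos[OF t] by (simp add: coroot_def sum_distrib_left sum_divide_distrib field_simps)
qed

lemma frm_basis: "s \<in> S \<Longrightarrow> t \<in> S \<Longrightarrow> frm (basis s) (basis t) = b s t"
  using b_pos[of s] by (simp add: frm_basis_left coroot_basis)

lemma frm_null [simp]: "frm a v = 0" "frm v a = 0"
proof -
  show "frm v a = 0" using a_null
    by (simp add: frm_def mult.assoc sum_distrib_left[symmetric] mult.left_commute[of "b _ _"])
  then show "frm a v = 0" by (simp add: frm_sym)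
qed

lemma frm_srefl: "s \<in> S \<Longrightarrow> frm (srefl s v) (srefl s w) = frm v w"
  by (simp add: srefl_eq frm_comb_left frm_comb_right frm_basis_left coroot_comb
      frm_sym[of v "basis s"] algebra_simps)

text \<open>
  By integrality there are finitely many possibilities in rank two, so that statements about two
  simple reflections can be verified by calculation with numerals.
\<close>

lemma cartan_cases:
  assumes "s \<in> S" "t \<in> S" "s \<noteq> t"
  shows "(ord (s \<otimes> t), - coroot s (basis t), - coroot t (basis s)) \<in>
    {(2, 0, 0), (3, 1, 1), (4, 1, 2), (4, 2, 1), (6, 1, 3), (6, 3, 1)}"
proof -
  define p where "p = - coroot s (basis t)"
  define r where "r = - coroot t (basis s)"
  obtain P R :: int where PR: "p = of_int P" "r = of_int R"
    using b_cartan[OF assms(1,2)] b_cartan[OF assms(2,1)] assms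
    by (auto simp: p_def r_def coroot_basis elim!: Ints_cases) (metis of_int_minus)
  have p: "p = - 2 * b s t / b s s" and r: "r = - 2 * b s t / b t t"
    using assms by (auto simp: p_def r_def coroot_basis b_sym[of t s])
  have pr: "p * r = 4 * (b s t)\<^sup>2 / (b s s * b t t)"
    by (simp add: p r power2_eq_square)
  have ge: "P \<ge> 0" "R \<ge> 0"
  proof -
    have "0 \<le> p" "0 \<le> r"
      using b_off[OF assms] b_pos[OF assms(1)] b_pos[OF assms(2)]
      unfolding p r by (auto intro!: divide_nonneg_pos divide_nonpos_pos)
    then show "P \<ge> 0" "R \<ge> 0" by (simp_all add: PR)
  qed
  have zero: "p = 0 \<longleftrightarrow> r = 0"
    using b_pos[OF assms(1)] b_pos[OF assms(2)] by (auto simp: p r)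
  have key: "(P, R) \<in> {(1, 1), (1, 2), (2, 1), (1, 3), (3, 1)} \<and> P * R = k"
    if k: "P * R = k" "k \<in> {1, 2, 3}" for k
  proof -
    have "P \<ge> 1" "R \<ge> 1" using k ge by (auto simp: order_le_less)
    moreover from this k have "P \<le> 3" "R \<le> 3"
      using mult_mono[of P P 1 R] mult_mono[of 1 P R R] by auto
    ultimately have "P \<in> {1, 2, 3}" "R \<in> {1, 2, 3}" by auto
    with k show ?thesis by auto
  qed
  have int: "P * R = k" if "p * r = of_int k" for k
    using that by (simp add: PR flip: of_int_mult)
  from b_ord[OF assms] consider
      "ord (s \<otimes> t) = 2" "p * r = of_int 0" | "ord (s \<otimes> t) = 3" "p * r = of_int 1"
    | "ord (s \<otimes> t) = 4" "p * r = of_int 2" | "ord (s \<otimes> t) = 6" "p * r = of_int 3"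
    by (auto simp: pr)
  then have "(ord (s \<otimes> t), p, r) \<in> {(2, 0, 0), (3, 1, 1), (4, 1, 2), (4, 2, 1), (6, 1, 3), (6, 3, 1)}"
  proof cases
    case 1 then show ?thesis using zero by auto
  next
    case 2 then show ?thesis using key[OF int[of 1]] PR by auto
  next
    case 3 then show ?thesis using key[OF int[of 2]] PR by auto
  next
    case 4 then show ?thesis using key[OF int[of 3]] PR by auto
  qed
  then show ?thesis by (simp add: p_def r_def)
qed

section \<open>The action on vectors\<close>

lemma act_Nil [simp]: "act [] v = v"
  and act_Cons [simp]: "act (x # xs) v = srefl x (act xs v)"
  and act_append: "act (xs @ ys) v = act xs (act ys v)"
  by (simp_all add: act_def)

text \<open>
  On the vectors \<open>v + \<alpha> basis s + \<beta> basis t\<close> both reflections act by affine maps of the pair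
  \<open>(\<alpha>, \<beta>)\<close>, so a relator need only be followed along the orbit of \<open>(0, 0)\<close>.
\<close>

lemma act_relator:
  assumes "s \<in> S" "t \<in> S"
  shows "act (concat (replicate (ord (s \<otimes> t)) [s, t])) v = v"
proof (cases "s = t")
  case True
  then show ?thesis using assms by simp
next
  case False
  define p r where "p = - coroot s (basis t)" and "r = - coroot t (basis s)"
  define f g where "f = coroot s v" and "g = coroot t v"
  define vec where "vec \<alpha> \<beta> = comb 1 v 1 (comb \<alpha> (basis s) \<beta> (basis t))" for \<alpha> \<beta>
  have s: "srefl s (vec \<alpha> \<beta>) = vec (p * \<beta> - \<alpha> - f) \<beta>" for \<alpha> \<beta>
    using assms by (auto simp: srefl_eq vec_def coroot_comb f_def p_def algebra_simps)
  have t: "srefl t (vec \<alpha> \<beta>) = vec \<alpha> (r * \<alpha> - \<beta> - g)" for \<alpha> \<beta>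
    using assms by (auto simp: srefl_eq vec_def coroot_comb g_def r_def algebra_simps)
  have v: "v = vec 0 0" by (auto simp: vec_def)
  have "act (concat (replicate (ord (s \<otimes> t)) [s, t])) (vec 0 0) = vec 0 0"
    using cartan_cases[OF assms False] unfolding p_def[symmetric] r_def[symmetric]
    by (auto simp: numeral_eq_Suc s t algebra_simps)
  with v show ?thesis by metis
qed

lemma cong_act: "coxeter_cong W S xs ys \<Longrightarrow> act xs = act ys"
  by (induction rule: coxeter_cong.induct) (auto simp: act_append act_relator fun_eq_iff)

lemma act_rev: "xs \<in> lists S \<Longrightarrow> act (rev xs) (act xs v) = v"
  by (induction xs arbitrary: v) (auto simp: act_append)

text \<open>
  The presentation of the group is used here, and it is what makes \<open>rep\<close> independent of the choice
  of a word.
\<close>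

lemma act_eq:
  assumes "xs \<in> lists S" "ys \<in> lists S" "wp xs = wp ys"
  shows "act xs = act ys"
proof
  fix v
  have "act (xs @ rev ys) (act ys v) = act ys v"
    using cong_act[OF cong_of_eq[OF assms]] by simp
  then show "act xs v = act ys v" by (simp add: act_append act_rev assms)
qed

lemma rep_wp: "xs \<in> lists S \<Longrightarrow> rep (wp xs) = act xs"
  unfolding rep_def by (rule someI2[of _ xs]) (auto intro: act_eq)

lemma rep_one [simp]: "rep \<one> v = v"
  using rep_wp[of "[]"] by simp

lemma rep_gen [simp]: "s \<in> S \<Longrightarrow> rep s v = srefl s v"
  using rep_wp[of "[s]"] by simp

lemma rep_mult: "u \<in> carrier W \<Longrightarrow> w \<in> carrier W \<Longrightarrow> rep (u \<otimes> w) v = rep u (rep w v)"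
proof -
  assume "u \<in> carrier W" "w \<in> carrier W"
  then obtain xs ys where "xs \<in> lists S" "wp xs = u" "ys \<in> lists S" "wp ys = w"
    using word_ex by metis
  moreover from this have "rep (wp (xs @ ys)) v = rep (wp xs) (rep (wp ys) v)"
    using rep_wp[of xs] rep_wp[of ys] rep_wp[of "xs @ ys"] by (simp add: act_append)
  ultimately show "rep (u \<otimes> w) v = rep u (rep w v)" by (simp add: wp_append del: rep_wp)
qed

lemma rep_inv_cancel [simp]:
  assumes "w \<in> carrier W"
  shows "rep (inv w) (rep w v) = v" "rep w (rep (inv w) v) = v"
  using assms by (simp_all flip: rep_mult)

lemma rep_induct:
  assumes "w \<in> generate W K" "K \<subseteq> S" "P v" "\<And>s v. s \<in> K \<Longrightarrow> P v \<Longrightarrow> P (srefl s v)"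
  shows "P (rep w v)"
proof -
  obtain xs where xs: "xs \<in> lists K" "wp xs = w" using word_over assms by blast
  then have "xs \<in> lists S" using lists_mono[OF assms(2)] by auto
  moreover have "P (act xs v)" using xs(1) assms by (induction xs) auto
  ultimately show ?thesis using rep_wp[of xs] xs(2) by metis
qed

lemma rep_induct':
  assumes "w \<in> carrier W" "P v" "\<And>s v. s \<in> S \<Longrightarrow> P v \<Longrightarrow> P (srefl s v)"
  shows "P (rep w v)"
  using rep_induct[of w S P v] assms gen_generate by auto

lemma rep_comb: "w \<in> carrier W \<Longrightarrow> rep w (comb p v q x) = comb p (rep w v) q (rep w x)"
proof -
  assume "w \<in> carrier W"
  then obtain xs where xs: "xs \<in> lists S" "wp xs = w" using word_ex by blast
  have "act xs (comb p v q x) = comb p (act xs v) q (act xs x)" by (induction xs) (simp_all add: srefl_comb del: comb_apply)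
  with rep_wp[OF xs(1)] xs(2) show "rep w (comb p v q x) = comb p (rep w v) q (rep w x)" by metis
qed

lemma rep_null [simp]: "w \<in> carrier W \<Longrightarrow> rep w a = a"
  by (rule rep_induct') auto

lemma frm_rep: "w \<in> carrier W \<Longrightarrow> frm (rep w v) (rep w x) = frm v x"
proof -
  assume "w \<in> carrier W"
  then obtain xs where xs: "xs \<in> lists S" "wp xs = w" using word_ex by blast
  from xs(1) have "frm (act xs v) (act xs x) = frm v x" by (induction xs) (auto simp: frm_srefl)
  with rep_wp[OF xs(1)] xs(2) show "frm (rep w v) (rep w x) = frm v x" by metis
qed

lemma frm_rep_left: "w \<in> carrier W \<Longrightarrow> frm (rep (inv w) v) x = frm v (rep w x)"
  using frm_rep[of "inv w" v "rep w x"] by simp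

lemma rep_support: "w \<in> generate W K \<Longrightarrow> K \<subseteq> S \<Longrightarrow> u \<notin> K \<Longrightarrow> rep w v u = v u"
  by (erule rep_induct) (auto simp: srefl_def)

lemma rep_int:
  assumes "w \<in> carrier W" "\<And>u. v u \<in> \<int>" shows "rep w v u \<in> \<int>"
proof -
  have "\<forall>u. rep w v u \<in> \<int>"
  proof (rule rep_induct'[OF assms(1)])
    fix s and v :: "'w \<Rightarrow> real" assume "s \<in> S" "\<forall>u. v u \<in> \<int>"
    then show "\<forall>u. srefl s v u \<in> \<int>"
      by (auto simp: srefl_def coroot_def b_cartan simp del: times_divide_eq_left intro!: Ints_diff Ints_sum Ints_mult)
  qed (use assms in auto)
  then show ?thesis by blast
qed

section \<open>Positivity of roots and the length function\<close>

definition nonneg :: "('w \<Rightarrow> real) \<Rightarrow> bool" where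
  "nonneg v \<longleftrightarrow> (\<forall>u. 0 \<le> v u)"

lemma nonneg_comb: "nonneg v \<Longrightarrow> nonneg w \<Longrightarrow> 0 \<le> p \<Longrightarrow> 0 \<le> q \<Longrightarrow> nonneg (comb p v q w)"
  by (auto simp: nonneg_def)

lemma nonneg_basis [simp]: "nonneg (basis s)"
  by (simp add: nonneg_def basis_def)

lemma nonneg_null [simp]: "nonneg a"
  unfolding nonneg_def using a_pos a_outside by (metis order_le_less)

text \<open>
  The alternating word in two letters that ends in the second one.
\<close>

fun alternating :: "'w \<Rightarrow> 'w \<Rightarrow> nat \<Rightarrow> 'w list" where
  "alternating s t 0 = []"
| "alternating s t (Suc k) = alternating t s k @ [t]"

lemma alternating_lists: "s \<in> A \<Longrightarrow> t \<in> A \<Longrightarrow> alternating s t k \<in> lists A"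
  by (induction k arbitrary: s t) auto

lemma length_alternating [simp]: "length (alternating s t k) = k"
  by (induction k arbitrary: s t) auto

lemma alternating_suffix: "m \<le> k \<Longrightarrow> \<exists>ys. alternating s t k = ys @ alternating s t m"
proof (induction k arbitrary: s t m)
  case (Suc k)
  show ?case
  proof (cases m)
    case (Suc m')
    then show ?thesis using Suc.IH[of m' t s] Suc.prems by auto
  qed auto
qed auto

text \<open>
  Two equal adjacent letters cancel, so they do not occur in a reduced word.
\<close>

lemma reduced_alternating:
  assumes "s \<in> S" "t \<in> S" "vs \<in> lists {s, t}" "reduced vs" "vs = [] \<or> last vs \<noteq> s"
  shows "vs = alternating s t (length vs)"
  using assms
proof (induction vs arbitrary: s t rule: rev_induct)
  case (snoc x xs)
  then have x: "x = t" by auto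
  have red: "reduced xs" using reduced_appendD(1) snoc.prems(4) by blast
  have "xs = [] \<or> last xs \<noteq> t"
  proof (rule ccontr)
    assume "\<not> ?thesis"
    then obtain ys where "xs = ys @ [t]" by (metis append_butlast_last_id)
    then have "reduced ([t, t])" using x snoc.prems(4) reduced_appendD(2)[of ys "[t, t]"] by simp
    then show False using snoc.prems(2) by (simp add: reduced_def)
  qed
  then have "xs = alternating t s (length xs)"
    using snoc.IH[of t s] snoc.prems red by (simp add: insert_commute)
  with x show ?case by simp
qed simp

lemma braid:
  assumes "s \<in> S" "t \<in> S" "s \<noteq> t"
  shows "wp (alternating s t (ord (s \<otimes> t))) = wp (alternating t s (ord (s \<otimes> t)))"
proof -
  have *: "wp (concat (replicate n [s, t])) = (s \<otimes> t) [^] n" for n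
  proof (induction n)
    case (Suc n)
    have "concat (replicate n [s, t]) \<in> lists S" using assms by (induction n) auto
    then have "wp (concat (replicate (Suc n) [s, t])) = (s \<otimes> t) \<otimes> (s \<otimes> t) [^] n"
      using assms Suc by (simp add: m_assoc)
    then show ?case using assms nat_pow_Suc2[of "s \<otimes> t" n] by simp
  qed simp
  have split: "wp xs = wp ys"
    if "concat (replicate (ord (s \<otimes> t)) [s, t]) = xs @ rev ys" "xs \<in> lists S" "ys \<in> lists S" for xs ys
  proof -
    have "wp xs \<otimes> inv (wp ys) = \<one>"
      using *[of "ord (s \<otimes> t)"] that assms by (simp add: wp_append wp_rev)
    then show ?thesis using that by (metis inv_equality inv_inv inv_closed wp_closed)
  qed
  consider "ord (s \<otimes> t) = 2" | "ord (s \<otimes> t) = 3" | "ord (s \<otimes> t) = 4" | "ord (s \<otimes> t) = 6"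
    using cartan_cases[OF assms] by auto
  then show ?thesis
  proof cases
    case 1 then show ?thesis using split[of "[s, t]" "[t, s]"] assms by (simp add: numeral_eq_Suc)
  next
    case 2 then show ?thesis using split[of "[s, t, s]" "[t, s, t]"] assms by (simp add: numeral_eq_Suc)
  next
    case 3 then show ?thesis using split[of "[s, t, s, t]" "[t, s, t, s]"] assms by (simp add: numeral_eq_Suc)
  next
    case 4 then show ?thesis
      using split[of "[s, t, s, t, s, t]" "[t, s, t, s, t, s]"] assms by (simp add: numeral_eq_Suc)
  qed
qed

lemma dihedral_positive:
  assumes "s \<in> S" "t \<in> S" "s \<noteq> t" "k < ord (s \<otimes> t)"
  shows "\<exists>\<alpha>\<ge>0. \<exists>\<beta>\<ge>0. act (alternating s t k) (basis s) = comb \<alpha> (basis s) \<beta> (basis t)"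
proof -
  define p r where "p = - coroot s (basis t)" and "r = - coroot t (basis s)"
  have s: "srefl s (comb \<alpha> (basis s) \<beta> (basis t)) = comb (p * \<beta> - \<alpha>) (basis s) \<beta> (basis t)" for \<alpha> \<beta>
    using assms by (auto simp: srefl_eq coroot_comb p_def algebra_simps)
  have t: "srefl t (comb \<alpha> (basis s) \<beta> (basis t)) = comb \<alpha> (basis s) (r * \<alpha> - \<beta>) (basis t)" for \<alpha> \<beta>
    using assms by (auto simp: srefl_eq coroot_comb r_def algebra_simps)
  have e: "basis s = comb 1 (basis s) 0 (basis t)" by auto
  have "\<exists>\<alpha>\<ge>0. \<exists>\<beta>\<ge>0. act (alternating s t k) (comb 1 (basis s) 0 (basis t)) = comb \<alpha> (basis s) \<beta> (basis t)"
  proof -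
    have "\<exists>\<alpha>\<ge>0. \<exists>\<beta>\<ge>0. comb x (basis s) y (basis t) = comb \<alpha> (basis s) \<beta> (basis t)"
      if "0 \<le> x" "0 \<le> y" for x y using that by blast
    note * = this
    have "k < 6" using assms cartan_cases[OF assms(1-3)] by auto
    then consider "k = 0" | "k = 1" | "k = 2" | "k = 3" | "k = 4" | "k = 5" by linarith
    then show ?thesis
      using cartan_cases[OF assms(1-3)] assms(4) unfolding p_def[symmetric] r_def[symmetric]
      by cases (auto simp: numeral_eq_Suc s t intro!: *)
  qed
  then show ?thesis using e by metis
qed

text \<open>
  This is due to Tits. Choose a letter \<open>t\<close> that shortens \<open>w\<close> from the right and write \<open>w\<close> as a reduced
  product of some \<open>v\<close> and a word in \<open>s\<close> and \<open>t\<close>, with \<open>v\<close> as short as possible. Then neither \<open>s\<close>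
  nor \<open>t\<close> shortens \<open>v\<close>, so by induction \<open>v\<close> maps \<open>basis s\<close> and \<open>basis t\<close> to nonnegative vectors.
  The word in \<open>s\<close> and \<open>t\<close> alternates and ends in \<open>t\<close>. It is shorter than the order of \<open>s t\<close>, since
  otherwise the braid relation would produce a reduced word for \<open>w\<close> that ends in \<open>s\<close>. Hence it maps
  \<open>basis s\<close> to a nonnegative combination of \<open>basis s\<close> and \<open>basis t\<close>.
\<close>

theorem length_increases_imp_positive:
  assumes "w \<in> carrier W" "s \<in> S" "wlen (w \<otimes> s) = wlen w + 1"
  shows "nonneg (rep w (basis s))"
  using assms
proof (induction "wlen w" arbitrary: w s rule: less_induct)
  case less
  show ?case
  proof (cases "w = \<one>")
    case True
    then show ?thesis by simp
  next
    case False
    obtain t where t: "t \<in> S" "wlen (w \<otimes> t) < wlen w"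
      using descent_right_ex less.prems(1) False by blast
    then have st: "s \<noteq> t" using less.prems by auto
    define Q where "Q n \<longleftrightarrow> (\<exists>us\<in>lists S. \<exists>vs\<in>lists {s, t}. wp (us @ vs) = w \<and>
      length us + length vs = wlen w \<and> length us = n)" for n
    have "Q (wlen w - 1)"
    proof -
      obtain xs where xs: "reduced xs" "wp xs = w \<otimes> t"
        using reduced_word_ex less.prems(1) t(1) by (metis gen_closed m_closed)
      have "wlen w = wlen (w \<otimes> t) + 1" using wlen_mult_gen less.prems(1) t by fastforce
      with xs t less.prems(1) show ?thesis
        unfolding Q_def by (intro bexI[of _ xs] bexI[of _ "[t]"]) (auto simp: wp_append reduced_def)
    qed
    then have "Q (LEAST n. Q n)" and le: "(LEAST n. Q n) \<le> wlen w - 1"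
      by (auto intro: LeastI Least_le)
    then obtain us vs where us: "us \<in> lists S" and vs: "vs \<in> lists {s, t}"
      and w: "wp (us @ vs) = w" "length us + length vs = wlen w" and least: "length us = (LEAST n. Q n)"
      unfolding Q_def by blast
    have vsS: "vs \<in> lists S" using vs less.prems(2) t(1) lists_mono[of "{s, t}" S] by auto
    have red: "reduced (us @ vs)" using us vsS w by (simp add: reduced_def)
    define v where "v = wp us"
    have v: "v \<in> carrier W" "wlen v = length us"
      using us reduced_appendD(1)[OF red] by (auto simp: v_def reduced_def)
    have "wlen w > 0" using False wlen_eq_0 less.prems(1) by auto
    then have small: "wlen v < wlen w" using le v(2) least by simp
    have IH: "nonneg (rep v (basis r))" if r: "r = s \<or> r = t" for r
    proof (rule less.hyps[OF small v(1)])
      show rS: "r \<in> S" using r less.prems(2) t(1) by auto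
      show "wlen (v \<otimes> r) = wlen v + 1"
      proof (rule ccontr)
        assume "\<not> ?thesis"
        then have *: "wlen v = wlen (v \<otimes> r) + 1" using wlen_mult_gen[OF v(1) rS] by simp
        obtain us' where us': "reduced us'" "wp us' = v \<otimes> r"
          using reduced_word_ex v(1) rS by (metis gen_closed m_closed)
        then have "wp (us' @ r # vs) = w"
          using w(1) us vsS rS v(1) by (simp add: reduced_def wp_append v_def m_assoc)
        moreover have "length us' + 1 = length us" using us' * v(2) by (simp add: reduced_def)
        ultimately have "Q (length us')"
          unfolding Q_def using us' vs r w(2)
          by (intro bexI[of _ us'] bexI[of _ "r # vs"]) (auto simp: reduced_def)
        then show False using Least_le[of Q "length us'"] least \<open>length us' + 1 = length us\<close> by simp
      qed
    qed
    have "vs = [] \<or> last vs \<noteq> s"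
    proof (rule ccontr)
      assume "\<not> ?thesis"
      then obtain ys where "vs = ys @ [s]" by (metis append_butlast_last_id)
      then have "reduced ((us @ ys) @ [s])" using red by simp
      moreover have "w = wp (us @ ys) \<otimes> s"
        using w(1) \<open>vs = ys @ [s]\<close> us vsS by (auto simp: wp_append m_assoc)
      then have "w \<otimes> s = wp (us @ ys)" using \<open>vs = ys @ [s]\<close> us vsS by auto
      ultimately show False
        using less.prems(3) w \<open>vs = ys @ [s]\<close> wlen_le[of "us @ ys"] us vsS by simp
    qed
    then have alt: "vs = alternating s t (length vs)"
      using reduced_alternating[OF less.prems(2) t(1) vs] reduced_appendD(2)[OF red] by simp
    have "length vs < ord (s \<otimes> t)"
    proof (rule ccontr)
      define m where "m = ord (s \<otimes> t)"
      assume "\<not> ?thesis"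
      then obtain ys where ys: "vs = ys @ alternating s t m"
        using alternating_suffix[of m "length vs" s t] alt by (auto simp: m_def)
      have "m \<noteq> 0" using cartan_cases[OF less.prems(2) t(1) st] by (auto simp: m_def)
      then obtain n where n: "m = Suc n" by (cases m) auto
      define xs where "xs = us @ ys @ alternating s t n"
      have in_S: "alternating s t k \<in> lists S" "alternating t s k \<in> lists S" for k
        using alternating_lists less.prems(2) t(1) by auto
      have xs: "xs \<in> lists S" using us vsS ys in_S by (auto simp: xs_def)
      have "wp (us @ ys @ alternating s t m) = wp (us @ ys @ alternating t s m)"
        using braid[OF less.prems(2) t(1) st] us vsS ys in_S by (simp add: wp_append m_def)
      then have "w = wp (xs @ [s])" using w(1) ys n by (simp add: xs_def)
      then have "w \<otimes> s = wp xs" using xs less.prems(2) by (simp add: wp_append)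
      moreover have "length xs < wlen w" using w(2) ys n by (simp add: xs_def)
      ultimately show False using wlen_le[OF xs] less.prems(3) by simp
    qed
    from dihedral_positive[OF less.prems(2) t(1) st this] alt
    obtain \<alpha> \<beta> where "0 \<le> \<alpha>" "0 \<le> \<beta>" and ab: "act vs (basis s) = comb \<alpha> (basis s) \<beta> (basis t)" by auto
    have "rep w (basis s) = rep v (act vs (basis s))"
      using w(1) us vsS rep_wp[of "us @ vs"] rep_wp[OF us] by (simp add: v_def act_append)
    also have "\<dots> = comb \<alpha> (rep v (basis s)) \<beta> (rep v (basis t))"
      by (simp add: ab rep_comb v(1))
    finally show ?thesis using IH \<open>0 \<le> \<alpha>\<close> \<open>0 \<le> \<beta>\<close> by (simp add: nonneg_comb)
  qed
qed

section \<open>The invariant form is positive semidefinite\<close>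

text \<open>
  The cross terms with the squares of the coordinates vanish because \<open>a\<close> lies in the radical. All
  coefficients on the right are nonnegative, since \<open>b\<close> is nonpositive off the diagonal.
\<close>

lemma frm_squares:
  "frm v v = (\<Sum>s\<in>S. \<Sum>t\<in>S. - b s t * a s * a t * (v s / a s - v t / a t)\<^sup>2) / 2"
proof -
  have nz: "a s \<noteq> 0" if "s \<in> S" for s using a_pos[OF that] by simp
  have "(\<Sum>s\<in>S. \<Sum>t\<in>S. - b s t * a s * a t * (v s / a s - v t / a t)\<^sup>2) =
    (\<Sum>s\<in>S. \<Sum>t\<in>S. 2 * (b s t * v s * v t) - (v s)\<^sup>2 / a s * (b s t * a t) - (v t)\<^sup>2 / a t * (b t s * a s))"
    by (intro sum.cong) (auto simp: nz b_sym power2_eq_square field_simps)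
  also have "\<dots> = 2 * frm v v - (\<Sum>s\<in>S. (v s)\<^sup>2 / a s * (\<Sum>t\<in>S. b s t * a t))
      - (\<Sum>s\<in>S. \<Sum>t\<in>S. (v t)\<^sup>2 / a t * (b t s * a s))"
    by (simp add: frm_def sum_subtractf sum_distrib_left)
  also have "(\<Sum>s\<in>S. \<Sum>t\<in>S. (v t)\<^sup>2 / a t * (b t s * a s)) = (\<Sum>t\<in>S. (v t)\<^sup>2 / a t * (\<Sum>s\<in>S. b t s * a s))"
    by (subst sum.swap) (simp add: sum_distrib_left)
  finally show ?thesis by (simp add: a_null)
qed

lemma squares_nonneg:
  "s \<in> S \<Longrightarrow> t \<in> S \<Longrightarrow> 0 \<le> - b s t * a s * a t * (v s / a s - v t / a t)\<^sup>2"
proof (cases "s = t")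
  case False
  moreover assume "s \<in> S" "t \<in> S"
  ultimately have "0 \<le> - b s t" "0 \<le> a s" "0 \<le> a t"
    using b_off[of s t] a_pos[of s] a_pos[of t] by simp_all
  then show ?thesis by (intro mult_nonneg_nonneg zero_le_power2)
qed simp

lemma frm_nonneg: "0 \<le> frm v v"
  unfolding frm_squares by (intro divide_nonneg_pos sum_nonneg squares_nonneg) auto

text \<open>
  All terms of the sum of squares vanish, so \<open>v s / a s\<close> is constant along the edges of the
  connected diagram.
\<close>

lemma frm_zero:
  assumes "frm v v = 0" "s \<in> S" shows "v s = v z * a s"
proof -
  have zero: "- b s t * a s * a t * (v s / a s - v t / a t)\<^sup>2 = 0" if "s \<in> S" "t \<in> S" for s t
  proof -
    have "(\<Sum>s\<in>S. \<Sum>t\<in>S. - b s t * a s * a t * (v s / a s - v t / a t)\<^sup>2) = 0"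
      using assms(1) unfolding frm_squares by simp
    from sum_nonneg_0[OF fin _ this that(1)]
    have "(\<Sum>t\<in>S. - b s t * a s * a t * (v s / a s - v t / a t)\<^sup>2) = 0"
      using sum_nonneg squares_nonneg by meson
    from sum_nonneg_0[OF fin _ this that(2)] show ?thesis
      using squares_nonneg[OF that(1)] by blast
  qed
  have "{s \<in> S. v s / a s = v z} = S"
  proof (rule conn)
    fix s t assume "s \<in> {s \<in> S. v s / a s = v z}" "t \<in> S" "b s t \<noteq> 0"
    then show "t \<in> {s \<in> S. v s / a s = v z}" using zero[of s t] a_pos[of s] a_pos[of t] by auto
  qed (use z_in a_z in auto)
  then have "v s / a s = v z" using assms(2) by blast
  then show ?thesis using a_pos[OF assms(2)] by (simp add: field_simps)
qed

lemma frm_cong: "(\<And>s. s \<in> S \<Longrightarrow> w s = w' s) \<Longrightarrow> frm v w = frm v w'"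
  by (simp add: frm_def)

lemma cauchy_schwarz: "(frm v w)\<^sup>2 \<le> frm v v * frm w w"
proof (cases "frm w w = 0")
  case True
  have "frm v w = frm v (comb (w z) a 0 a)"
  proof (rule frm_cong)
    fix s assume "s \<in> S"
    show "w s = comb (w z) a 0 a s" using frm_zero[OF True \<open>s \<in> S\<close>] by simp
  qed
  then show ?thesis using True by (simp add: frm_comb_right)
next
  case False
  then have pos: "frm w w > 0" using frm_nonneg[of w] by simp
  have "0 \<le> frm (comb (frm w w) v (- frm v w) w) (comb (frm w w) v (- frm v w) w)" by (rule frm_nonneg)
  also have "\<dots> = frm w w * (frm v v * frm w w - (frm v w)\<^sup>2)"
    by (simp add: frm_comb_left frm_comb_right frm_sym[of w v] power2_eq_square algebra_simps)
  finally show ?thesis using pos by (simp add: zero_le_mult_iff)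
qed

lemma frm_expand: "frm v w = (\<Sum>s\<in>S. v s * frm (basis s) w)"
proof -
  have "frm (basis s) w = (\<Sum>t\<in>S. b s t * w t)" if "s \<in> S" for s
    using b_pos[OF that] by (simp add: frm_basis_left that coroot_def sum_divide_distrib[symmetric] sum_distrib_left field_simps)
  then show ?thesis by (simp add: frm_def sum_distrib_left algebra_simps)
qed

lemma orthogonal_to_basis: "(\<And>t. t \<in> S \<Longrightarrow> frm (basis t) x = 0) \<Longrightarrow> s \<in> S \<Longrightarrow> x s = x z * a s"
  using frm_zero[of x s] by (simp add: frm_expand[of x x])

section \<open>Real roots and half-spaces\<close>

definition real_roots :: "'w set \<Rightarrow> ('w \<Rightarrow> real) set" where
  "real_roots K = {rep w (basis s) | w s. w \<in> generate W K \<and> s \<in> K}"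

definition half :: "('w \<Rightarrow> real) \<Rightarrow> 'w set" where
  "half x = {w \<in> carrier W. nonneg (rep (inv w) x)}"

lemma real_rootI: "w \<in> generate W K \<Longrightarrow> s \<in> K \<Longrightarrow> rep w (basis s) \<in> real_roots K"
  by (auto simp: real_roots_def)

lemma real_rootE:
  assumes "x \<in> real_roots S"
  obtains w s where "w \<in> carrier W" "s \<in> S" "x = rep w (basis s)"
  using assms by (auto simp: real_roots_def gen_generate)

lemma basis_root: "s \<in> K \<Longrightarrow> basis s \<in> real_roots K"
  using real_rootI[OF generate.one, of s K] by simp

lemma generate_closed: "K \<subseteq> S \<Longrightarrow> w \<in> generate W K \<Longrightarrow> w \<in> carrier W"
  using generate_incl[of K] gen_closed by blast

lemma rep_root: "K \<subseteq> S \<Longrightarrow> w \<in> generate W K \<Longrightarrow> x \<in> real_roots K \<Longrightarrow> rep w x \<in> real_roots K"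
proof -
  assume K: "K \<subseteq> S" "w \<in> generate W K" "x \<in> real_roots K"
  then obtain v s where v: "v \<in> generate W K" "s \<in> K" "x = rep v (basis s)"
    by (auto simp: real_roots_def)
  then have "rep w x = rep (w \<otimes> v) (basis s)" using K generate_closed by (simp add: rep_mult)
  then show "rep w x \<in> real_roots K" using v K by (auto intro!: real_rootI generate.eng)
qed

lemma rep_root': "w \<in> carrier W \<Longrightarrow> x \<in> real_roots S \<Longrightarrow> rep w x \<in> real_roots S"
  using rep_root[of S] by (simp add: gen_generate)

lemma real_roots_mono: "K \<subseteq> S \<Longrightarrow> real_roots K \<subseteq> real_roots S"
proof
  fix x assume "K \<subseteq> S" "x \<in> real_roots K"
  then obtain v s where "v \<in> generate W K" "s \<in> K" "x = rep v (basis s)"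
    by (auto simp: real_roots_def)
  with \<open>K \<subseteq> S\<close> have "v \<in> carrier W" "s \<in> S" "x = rep v (basis s)"
    using generate_closed by auto
  then show "x \<in> real_roots S" by (auto intro: real_rootI simp: gen_generate)
qed

lemma root_support: "K \<subseteq> S \<Longrightarrow> x \<in> real_roots K \<Longrightarrow> u \<notin> K \<Longrightarrow> x u = 0"
  by (auto simp: real_roots_def rep_support basis_def)

lemma root_int: "x \<in> real_roots S \<Longrightarrow> x u \<in> \<int>"
  by (elim real_rootE) (auto intro!: rep_int simp: basis_def)

lemma frm_root: "w \<in> carrier W \<Longrightarrow> s \<in> S \<Longrightarrow> frm (rep w (basis s)) (rep w (basis s)) = b s s"
  by (simp add: frm_rep frm_basis)

lemma root_norm: "x \<in> real_roots S \<Longrightarrow> 2 \<le> frm x x"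
  by (elim real_rootE) (simp add: frm_root b_diag)

lemma rep_basis_flip:
  "w \<in> carrier W \<Longrightarrow> s \<in> S \<Longrightarrow> rep (w \<otimes> s) (basis s) = comb (- 1) (rep w (basis s)) 0 a"
  by (simp add: rep_mult srefl_basis_self rep_comb) (simp add: comb_def)

lemma not_both_signs: "x \<in> real_roots S \<Longrightarrow> nonneg x \<Longrightarrow> \<not> nonneg (comb (- 1) x 0 a)"
proof
  assume x: "x \<in> real_roots S" "nonneg x" "nonneg (comb (- 1) x 0 a)"
  then have "x u = 0" for u by (auto simp: nonneg_def intro: antisym)
  then have "frm x x = 0" by (simp add: frm_def)
  with root_norm[OF x(1)] show False by simp
qed

lemma positive_iff_length:
  assumes "w \<in> carrier W" "s \<in> S"
  shows "nonneg (rep w (basis s)) \<longleftrightarrow> wlen (w \<otimes> s) = wlen w + 1"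
proof
  assume pos: "nonneg (rep w (basis s))"
  show "wlen (w \<otimes> s) = wlen w + 1"
  proof (rule ccontr)
    assume "\<not> ?thesis"
    then have "wlen (w \<otimes> s \<otimes> s) = wlen (w \<otimes> s) + 1"
      using wlen_mult_gen[OF assms] assms by simp
    then have "nonneg (rep (w \<otimes> s) (basis s))"
      using length_increases_imp_positive assms by simp
    moreover have "rep w (basis s) \<in> real_roots S"
      using assms by (intro real_rootI) (auto simp: gen_generate)
    ultimately show False using not_both_signs pos assms by (simp add: rep_basis_flip)
  qed
qed (rule length_increases_imp_positive[OF assms])

lemma root_sign:
  assumes "x \<in> real_roots S"
  shows "nonneg x \<or> nonneg (comb (- 1) x 0 a)"
proof -
  obtain w s where x: "w \<in> carrier W" "s \<in> S" "x = rep w (basis s)" using assms by (rule real_rootE)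
  show ?thesis
  proof (cases "wlen (w \<otimes> s) = wlen w + 1")
    case False
    then have "wlen (w \<otimes> s \<otimes> s) = wlen (w \<otimes> s) + 1" using wlen_mult_gen[OF x(1,2)] x by simp
    then have "nonneg (rep (w \<otimes> s) (basis s))"
      using length_increases_imp_positive x by simp
    then show ?thesis using x by (simp add: rep_basis_flip)
  qed (use positive_iff_length x in auto)
qed

lemma negative_coord: "x \<in> real_roots S \<Longrightarrow> \<not> nonneg x \<Longrightarrow> x u \<le> 0"
  using root_sign[of x] by (auto simp: nonneg_def)

text \<open>
  A simple reflection changes a single coordinate, and all coordinates of a root have the same sign.
  So if the sign changes there is only one nonzero coordinate.
\<close>

lemma simple_reflection_permutes:
  assumes x: "x \<in> real_roots S" "nonneg x" and s: "s \<in> S" and neg: "\<not> nonneg (srefl s x)"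
  shows "x = basis s"
proof -
  have root: "srefl s x \<in> real_roots S" using rep_root'[of s x] x s by simp
  have 0: "x u = 0" if "u \<noteq> s" for u
    using negative_coord[OF root neg, of u] x(2) that by (auto simp: nonneg_def srefl_def intro: antisym)
  define c where "c = x s"
  have xc: "x = comb c (basis s) 0 a" using 0 by (auto simp: c_def basis_def)
  have c: "c \<in> \<int>" "c \<ge> 0" using root_int[OF x(1)] x(2) by (auto simp: c_def nonneg_def)
  have "c \<noteq> 0" using root_norm[OF x(1)] by (auto simp: xc frm_comb_left)
  obtain w t where w: "w \<in> carrier W" "t \<in> S" "x = rep w (basis t)" using x(1) by (rule real_rootE)
  \<comment> \<open>Both \<open>c\<close> and its inverse are integral, because \<open>rep\<close> preserves the integral vectors.\<close>
  have "comb c (rep (inv w) (basis s)) 0 a = basis t"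
    using w rep_comb[of "inv w" c "basis s" 0 a] by (simp flip: xc)
  from fun_cong[OF this, of t] have "c * rep (inv w) (basis s) t = 1" by simp
  moreover have "rep (inv w) (basis s) t \<in> \<int>" using w by (intro rep_int) (auto simp: basis_def)
  ultimately have "c = 1" using c
    by (auto elim!: Ints_cases) (metis mult.commute of_int_1 of_int_eq_iff of_int_mult pos_zmult_eq_1_iff_lemma
        zmult_eq_1_iff of_int_0_le_iff minus_equation_iff not_one_le_zero le_minus_one_simps(3))
  then show ?thesis using xc by (auto simp: fun_eq_iff)
qed

lemma eq_comb_null:
  assumes "x \<in> real_roots S" "y \<in> real_roots S" "\<And>s. s \<in> S \<Longrightarrow> comb 1 y (- c) x s = k * a s"
  shows "y = comb c x k a"
proof
  fix u show "y u = comb c x k a u"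
  proof (cases "u \<in> S")
    case True
    from assms(3)[OF this] show ?thesis by simp
  next
    case False
    then show ?thesis
      using root_support[OF order_refl assms(1)] root_support[OF order_refl assms(2)] a_outside by simp
  qed
qed

lemma half_rep:
  assumes "u \<in> carrier W"
  shows "half (rep u x) = (\<lambda>w. u \<otimes> w) ` half x"
proof
  show "half (rep u x) \<subseteq> (\<lambda>w. u \<otimes> w) ` half x"
  proof
    fix w assume "w \<in> half (rep u x)"
    then have "inv u \<otimes> w \<in> half x" "w = u \<otimes> (inv u \<otimes> w)"
      using assms by (auto simp: half_def inv_mult_group rep_mult m_assoc[symmetric])
    then show "w \<in> (\<lambda>w. u \<otimes> w) ` half x" by blast
  qed
  show "(\<lambda>w. u \<otimes> w) ` half x \<subseteq> half (rep u x)"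
    using assms by (auto simp: half_def inv_mult_group rep_mult)
qed

lemma half_basis: "s \<in> S \<Longrightarrow> half (basis s) = simple_root W S s"
proof -
  assume s: "s \<in> S"
  have "nonneg (rep (inv w) (basis s)) \<longleftrightarrow> wlen w < wlen (s \<otimes> w)" if w: "w \<in> carrier W" for w
  proof -
    have "wlen (inv w \<otimes> s) = wlen (s \<otimes> w)" using wlen_inv[of "s \<otimes> w"] s w by (simp add: inv_mult_group)
    then have "nonneg (rep (inv w) (basis s)) \<longleftrightarrow> wlen (s \<otimes> w) = wlen w + 1"
      using positive_iff_length[of "inv w" s] s w by (simp add: wlen_inv)
    then show ?thesis using wlen_gen_mult[OF w s] by auto
  qed
  then show ?thesis by (auto simp: half_def simple_root_def)
qed

lemma roots_as_half:
  "{(\<lambda>w. v \<otimes> w) ` simple_root W S s | v s. v \<in> carrier W \<and> s \<in> S} = half ` real_roots S"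
proof -
  have "half ` real_roots S = {half (rep v (basis s)) | v s. v \<in> carrier W \<and> s \<in> S}"
    unfolding real_roots_def gen_generate by blast
  also have "\<dots> = {(\<lambda>w. v \<otimes> w) ` simple_root W S s | v s. v \<in> carrier W \<and> s \<in> S}"
    by (intro Collect_cong ex_cong1) (auto simp: half_rep half_basis)
  finally show ?thesis by simp
qed

lemma half_mono:
  assumes "y = comb c x k a" "0 \<le> c" "0 \<le> k"
  shows "half x \<subseteq> half y"
  using assms by (auto simp: half_def rep_comb nonneg_comb)

section \<open>Existence of translations\<close>

text \<open>
  Induction on the sum of the coordinates. As the norm is positive there is a coordinate \<open>v s > 0\<close> with
  positive coroot pairing \<open>m\<close>. Since 2 is the least norm of a simple root, the Cauchy-Schwarz
  inequality leaves \<open>m = 1\<close>, where the reflection subtracts \<open>basis s\<close>, and \<open>m = 2\<close>, which forces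
  \<open>v = basis s\<close>.
\<close>

lemma short_vector_is_root:
  assumes "\<And>u. v u \<in> \<int>" "nonneg v" "\<And>u. u \<notin> S - {z} \<Longrightarrow> v u = 0" "frm v v = 2"
  shows "v \<in> real_roots (S - {z})"
proof -
  have "\<exists>n::nat. (\<Sum>u\<in>S. v u) = real n"
  proof -
    have "(\<Sum>u\<in>S. v u) \<in> \<int>" "0 \<le> (\<Sum>u\<in>S. v u)"
      using assms(1,2) by (auto simp: nonneg_def intro: sum_nonneg)
    then show ?thesis by (metis Ints_cases of_int_0_le_iff of_nat_nat zero_le_imp_eq_int of_int_of_nat_eq)
  qed
  then obtain n :: nat where "(\<Sum>u\<in>S. v u) = real n" by blast
  then show ?thesis using assms
  proof (induction n arbitrary: v rule: less_induct)
    case (less n)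
    have "\<exists>s\<in>S. 0 < v s * frm (basis s) v"
    proof (rule ccontr)
      assume "\<not> ?thesis"
      then have "frm v v \<le> 0" unfolding frm_expand[of v v] by (auto intro!: sum_nonpos simp: not_less)
      with less.prems show False by simp
    qed
    then obtain s where s: "s \<in> S" "0 < v s * frm (basis s) v" by blast
    then have vs: "0 < v s" and fs: "0 < frm (basis s) v"
      using less.prems(3) by (auto simp: nonneg_def zero_less_mult_iff not_less[symmetric])
    have sz: "s \<in> S - {z}" using less.prems(4)[of s] s(1) vs by fastforce
    define m where "m = coroot s v"
    have "m \<in> \<int>" unfolding m_def coroot_def
      using s less.prems(2) b_cartan by (intro Ints_sum Ints_mult) auto
    then obtain M where M: "m = of_int M" by (rule Ints_cases)
    have bs: "2 \<le> b s s" using b_diag s(1) .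
    have fm: "frm (basis s) v = b s s * m / 2" using frm_basis_left[OF s(1)] by (simp add: m_def)
    have "0 < m" using fs bs by (simp add: fm zero_less_mult_iff)
    then have "1 \<le> M" by (simp add: M)
    have "(b s s * m / 2)\<^sup>2 \<le> b s s * 2"
      using cauchy_schwarz[of "basis s" v] less.prems(5) s(1) by (simp add: fm frm_basis)
    then have "b s s * (b s s * m\<^sup>2) \<le> b s s * 8" by (simp add: power2_eq_square algebra_simps)
    then have bm: "b s s * m\<^sup>2 \<le> 8" using bs by simp
    show ?case
    proof (cases "M = 1")
      case True
      define v' where "v' = srefl s v"
      have v': "v' = comb 1 v (- 1) (basis s)" using True by (simp add: v'_def srefl_eq M flip: m_def)
      have "v s \<ge> 1"
        using vs less.prems(2)[of s] by (auto elim!: Ints_cases)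
      then have nn: "nonneg v'" using less.prems(3) by (auto simp: v' nonneg_def basis_def)
      have sum: "(\<Sum>u\<in>S. v' u) = real n - 1"
        using less.prems(1) fin s(1) by (simp add: v' basis_def sum_subtractf)
      moreover have "0 \<le> (\<Sum>u\<in>S. v' u)" using nn by (auto simp: nonneg_def intro: sum_nonneg)
      ultimately have n: "n \<ge> 1" by simp
      have "v' \<in> real_roots (S - {z})"
      proof (rule less.IH[of "n - 1"])
        show "(\<Sum>u\<in>S. v' u) = real (n - 1)" using sum n by (simp add: of_nat_diff)
        show "v' u \<in> \<int>" for u using less.prems(2) by (auto simp: v' basis_def)
        show "u \<notin> S - {z} \<Longrightarrow> v' u = 0" for u using less.prems(4) sz by (auto simp: v' basis_def)
        show "frm v' v' = 2" using less.prems(5) s(1) by (simp add: v'_def frm_srefl)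
      qed (use n nn in auto)
      then have "rep s v' \<in> real_roots (S - {z})"
        using sz by (intro rep_root) (auto intro: generate.incl)
      then show ?thesis using s(1) by (simp add: v'_def)
    next
      case False
      then have M2: "2 \<le> M" using \<open>1 \<le> M\<close> by simp
      have "2\<^sup>2 \<le> m\<^sup>2" using M2 by (intro power_mono) (simp_all add: M)
      then have "b s s * 4 \<le> b s s * m\<^sup>2" using bs by (intro mult_left_mono) simp_all
      then have b2: "b s s = 2" using bm bs by linarith
      then have "m\<^sup>2 \<le> 2\<^sup>2" using bm by simp
      then have "m \<le> 2" by (rule power2_le_imp_le) simp
      then have m2: "m = 2" using M2 by (simp add: M)
      have d: "frm (comb 1 v (- 1) (basis s)) (comb 1 v (- 1) (basis s)) = 0"
        using less.prems(5) s(1) b2 m2 fm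
        by (simp add: frm_comb_left frm_comb_right frm_basis frm_sym[of v "basis s"])
      have vz: "v z = basis s z" using less.prems(4)[of z] sz by (auto simp: basis_def)
      have "v u = basis s u" for u
      proof (cases "u \<in> S")
        case True
        from frm_zero[OF d this] vz show ?thesis by simp
      next
        case False
        then show ?thesis using less.prems(4)[of u] sz by (auto simp: basis_def)
      qed
      then have "v = basis s" by auto
      then show ?thesis using basis_root[OF sz] by simp
    qed
  qed
qed

text \<open>
  Modulo the null vector, this is the negative of the simple root at \<open>z\<close>. It is supported on the other
  nodes, where it is the highest short root.
\<close>

definition theta :: "'w \<Rightarrow> real" where
  "theta = comb 1 a (- 1) (basis z)"

lemma theta_root: "theta \<in> real_roots (S - {z})"
proof (rule short_vector_is_root)
  show "theta u \<in> \<int>" for u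
    using a_int[of u] a_outside[of u] by (cases "u \<in> S") (auto simp: theta_def basis_def)
  show "nonneg theta"
    using nonneg_null a_z by (auto simp: theta_def nonneg_def basis_def)
  show "u \<notin> S - {z} \<Longrightarrow> theta u = 0" for u
    by (cases "u = z") (simp_all add: theta_def a_z a_outside)
  show "frm theta theta = 2"
    using z_in b_z by (simp add: theta_def frm_comb_left frm_comb_right frm_basis)
qed

text \<open>
  The reflection in \<open>theta\<close>. The pairing with \<open>theta\<close> is minus the pairing with \<open>basis z\<close>.
\<close>

lemma theta_reflection:
  obtains u where "u \<in> generate W (S - {z})" "\<And>x. rep u x = comb 1 x (coroot z x) theta"
proof -
  obtain w s where w: "w \<in> generate W (S - {z})" "s \<in> S - {z}" "theta = rep w (basis s)"
    using theta_root by (auto simp: real_roots_def)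
  have wc: "w \<in> carrier W" using w generate_closed by blast
  have sc: "s \<in> S" using w by auto
  have norm: "b s s = 2"
    using frm_root[OF wc sc] z_in b_z
    by (simp add: frm_comb_left frm_comb_right frm_basis theta_def flip: w(3))
  have "rep (w \<otimes> s \<otimes> inv w) x = comb 1 x (coroot z x) theta" for x
  proof -
    have "coroot s (rep (inv w) x) = frm (rep w (basis s)) x"
      using frm_basis_left[OF sc, of "rep (inv w) x"] norm frm_rep_left[of w "x" "basis s"] wc
      by (simp add: frm_sym)
    also have "\<dots> = - coroot z x"
      using frm_basis_left[OF z_in, of x] b_z by (simp add: theta_def frm_comb_left flip: w(3))
    finally have *: "coroot s (rep (inv w) x) = - coroot z x" .
    have "rep (w \<otimes> s \<otimes> inv w) x = rep w (srefl s (rep (inv w) x))"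
      using wc sc by (simp add: rep_mult)
    also have "\<dots> = comb 1 x (coroot z x) (rep w (basis s))"
      using wc by (simp add: srefl_eq rep_comb *)
    finally show ?thesis by (simp flip: w(3))
  qed
  moreover have "w \<otimes> s \<otimes> inv w \<in> generate W (S - {z})"
  proof (intro generate.eng)
    show "inv w \<in> generate W (S - {z})"
      using generate_m_inv_closed[OF _ w(1)] gen_closed by blast
  qed (use w in \<open>auto intro: generate.incl\<close>)
  ultimately show ?thesis using that by blast
qed

text \<open>
  Displacements along the null vector that come from group elements. They form an abelian group of
  functionals, rich enough to separate directions.
\<close>

definition shifts :: "(('w \<Rightarrow> real) \<Rightarrow> real) set" where
  "shifts = {f. \<exists>t\<in>carrier W. \<forall>x. rep t x = comb 1 x (f x) a}"

lemma shiftsI: "t \<in> carrier W \<Longrightarrow> (\<And>x. rep t x = comb 1 x (f x) a) \<Longrightarrow> f \<in> shifts"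
  by (auto simp: shifts_def)

lemma shifts_add: "f \<in> shifts \<Longrightarrow> g \<in> shifts \<Longrightarrow> (\<lambda>x. f x + g x) \<in> shifts"
proof -
  assume "f \<in> shifts" "g \<in> shifts"
  then obtain t u where t: "t \<in> carrier W" "\<And>x. rep t x = comb 1 x (f x) a"
    and u: "u \<in> carrier W" "\<And>x. rep u x = comb 1 x (g x) a" by (auto simp: shifts_def)
  have "rep (t \<otimes> u) x = comb 1 x (f x + g x) a" for x
  proof -
    have "rep (t \<otimes> u) x = comb 1 (rep t x) (g x) (rep t a)"
      using t(1) u(1) by (simp only: rep_mult u(2) rep_comb)
    then show ?thesis using t(1) rep_null[of t] by (auto simp: t(2) fun_eq_iff algebra_simps)
  qed
  then show "(\<lambda>x. f x + g x) \<in> shifts" by (rule shiftsI[rotated]) (use t(1) u(1) in simp)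
qed

lemma shifts_uminus: "f \<in> shifts \<Longrightarrow> (\<lambda>x. - f x) \<in> shifts"
proof -
  assume "f \<in> shifts"
  then obtain t where t: "t \<in> carrier W" "\<And>x. rep t x = comb 1 x (f x) a" by (auto simp: shifts_def)
  have "rep (inv t) x = comb 1 x (- f x) a" for x
  proof -
    have "rep t (comb 1 x (- f x) a) = comb 1 (rep t x) (- f x) a"
      using t(1) by (simp add: rep_comb)
    also have "\<dots> = x" by (auto simp: t(2))
    finally show ?thesis using rep_inv_cancel(1)[OF t(1)] by metis
  qed
  then show "(\<lambda>x. - f x) \<in> shifts" by (rule shiftsI[rotated]) (use t(1) in simp)
qed

lemma shifts_scale: "f \<in> shifts \<Longrightarrow> (\<lambda>x. of_int n * f x) \<in> shifts"
proof -
  assume f: "f \<in> shifts"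
  have nat: "(\<lambda>x. real k * f x) \<in> shifts" for k
  proof (induction k)
    case 0
    then show ?case by (auto simp: shifts_def fun_eq_iff intro!: bexI[of _ \<one>])
  next
    case (Suc k)
    from shifts_add[OF this f] show ?case by (simp add: algebra_simps)
  qed
  show ?thesis
  proof (cases "n \<ge> 0")
    case True
    then show ?thesis using nat[of "nat n"] by simp
  next
    case False
    then show ?thesis using shifts_uminus[OF nat[of "nat (- n)"]] by simp
  qed
qed

text \<open>
  The reflections in \<open>basis z\<close> and \<open>theta\<close> agree modulo the null vector, so their product is a
  translation. Its conjugates have the stated functionals.
\<close>

lemma basic_shift: "v \<in> carrier W \<Longrightarrow> (\<lambda>x. frm x (rep v (basis z))) \<in> shifts"
proof -
  assume v: "v \<in> carrier W"
  obtain u where u: "u \<in> generate W (S - {z})" "\<And>x. rep u x = comb 1 x (coroot z x) theta"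
    using theta_reflection by blast
  have uc: "u \<in> carrier W" using u(1) generate_closed by blast
  have zu: "rep (z \<otimes> u) x = comb 1 x (coroot z x) a" for x
    using uc z_in
    by (simp add: rep_mult u(2) srefl_comb theta_def srefl_basis_self)
       (auto simp: srefl_eq fun_eq_iff algebra_simps)
  have "rep (v \<otimes> (z \<otimes> u) \<otimes> inv v) x = comb 1 x (frm x (rep v (basis z))) a" for x
  proof -
    have "rep (v \<otimes> (z \<otimes> u) \<otimes> inv v) x = rep v (rep (z \<otimes> u) (rep (inv v) x))"
      using v uc z_in by (simp only: rep_mult m_closed gen_closed inv_closed)
    also have "\<dots> = comb 1 x (coroot z (rep (inv v) x)) a"
      using v by (simp add: zu rep_comb)
    also have "coroot z (rep (inv v) x) = frm x (rep v (basis z))"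
      using frm_basis_left[OF z_in, of "rep (inv v) x"] b_z frm_rep_left[OF v, of x "basis z"]
      by (simp add: frm_sym)
    finally show ?thesis .
  qed
  then show "(\<lambda>x. frm x (rep v (basis z))) \<in> shifts"
    by (rule shiftsI[rotated]) (use v uc z_in in simp)
qed

text \<open>
  The orthogonality to \<open>basis z\<close> and all its images spreads along the edges of the diagram.
\<close>

lemma radical:
  assumes "\<And>v. v \<in> carrier W \<Longrightarrow> frm x (rep v (basis z)) = 0" "s \<in> S"
  shows "x s = x z * a s"
proof -
  have "{s \<in> S. \<forall>v\<in>carrier W. frm x (rep v (basis s)) = 0} = S"
  proof (rule conn)
    fix s t assume s: "s \<in> {s \<in> S. \<forall>v\<in>carrier W. frm x (rep v (basis s)) = 0}"
      and t: "t \<in> S" "b s t \<noteq> 0"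
    have "frm x (rep v (basis t)) = 0" if v: "v \<in> carrier W" for v
    proof -
      have "rep (v \<otimes> t) (basis s) = comb 1 (rep v (basis s)) (- coroot t (basis s)) (rep v (basis t))"
        using v t by (simp add: rep_mult srefl_eq rep_comb)
      moreover have "frm x (rep (v \<otimes> t) (basis s)) = 0" using s v t by simp
      ultimately have "coroot t (basis s) * frm x (rep v (basis t)) = 0"
        using s v by (simp add: frm_comb_right)
      moreover have "coroot t (basis s) \<noteq> 0"
        using s t b_pos[of t] by (simp add: coroot_basis b_sym[of t s])
      ultimately show ?thesis by simp
    qed
    with t show "t \<in> {s \<in> S. \<forall>v\<in>carrier W. frm x (rep v (basis s)) = 0}" by simp
  qed (use z_in assms in auto)
  then have "\<forall>v\<in>carrier W. frm x (rep v (basis s)) = 0" if "s \<in> S" for s using that by blast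
  then have "frm (basis s) x = 0" if "s \<in> S" for s
    using that rep_one[of "basis s"] frm_sym by (metis one_closed)
  then show ?thesis using orthogonal_to_basis assms(2) by blast
qed

text \<open>
  A translation by \<open>f\<close> with \<open>f x \<ge> 0\<close> moves a point of \<open>half x\<close> inside \<open>half x\<close>. If \<open>f y\<close> were
  negative, its iterates would leave \<open>half y\<close>. Thus \<open>f x \<ge> 0\<close> implies \<open>f y \<ge> 0\<close> for all
  available \<open>f\<close>, in particular for integral combinations chosen such that \<open>f x = 0\<close>. So \<open>x\<close> and \<open>y\<close>
  have proportional pairings with all images of \<open>basis z\<close>, with a positive factor.
\<close>

theorem nested_half_parallel:
  assumes x: "x \<in> real_roots S" and y: "y \<in> real_roots S" and sub: "half x \<subseteq> half y"
  obtains c k where "0 < c" "y = comb c x k a"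
proof -
  obtain w0 where w0: "w0 \<in> half x"
  proof -
    obtain w s where "w \<in> carrier W" "s \<in> S" "x = rep w (basis s)" using x by (rule real_rootE)
    then have "w \<in> half x" by (simp add: half_def)
    then show ?thesis using that by blast
  qed
  then have w0c: "w0 \<in> carrier W" by (simp add: half_def)
  have bound: "0 \<le> rep (inv w0) y z + f y" if f: "f \<in> shifts" "0 \<le> f x" for f
  proof -
    obtain t where t: "t \<in> carrier W" "\<And>x. rep t x = comb 1 x (f x) a"
      using f(1) by (auto simp: shifts_def)
    have *: "rep (inv (inv t \<otimes> w0)) v = comb 1 (rep (inv w0) v) (f v) a" for v
      using t w0c by (simp add: inv_mult_group rep_mult rep_comb)
    have "inv t \<otimes> w0 \<in> half x" using w0 f(2) t(1) by (simp add: half_def * nonneg_comb)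
    with sub have "inv t \<otimes> w0 \<in> half y" by blast
    then have "nonneg (comb 1 (rep (inv w0) y) (f y) a)" by (simp add: half_def *)
    then show ?thesis unfolding nonneg_def using a_z by (metis comb_apply mult.right_neutral mult_1)
  qed
  have pos: "0 \<le> f y" if f: "f \<in> shifts" "0 \<le> f x" for f
  proof (rule ccontr)
    assume neg: "\<not> 0 \<le> f y"
    obtain n :: nat where "rep (inv w0) y z / (- f y) < real n" using reals_Archimedean2 by blast
    then have "rep (inv w0) y z + real n * f y < 0" using neg by (simp add: field_simps)
    moreover have "0 \<le> rep (inv w0) y z + of_int (int n) * f y"
      using bound[OF shifts_scale[OF f(1), of "int n"]] f(2) by simp
    ultimately show False by simp
  qed
  define f where "f v x = frm x (rep v (basis z))" for v x
  have fs: "f v \<in> shifts" if "v \<in> carrier W" for v using basic_shift[OF that] by (simp add: f_def[abs_def])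
  have fint: "f v x \<in> \<int>" if "v \<in> carrier W" for v
    unfolding f_def frm_def
    using that b_int root_int[OF x] by (intro Ints_sum Ints_mult rep_int) (auto simp: basis_def)
  obtain v2 where v2: "v2 \<in> carrier W" "f v2 x \<noteq> 0"
  proof -
    have "\<exists>v\<in>carrier W. f v x \<noteq> 0"
    proof (rule ccontr)
      assume "\<not> ?thesis"
      then have *: "x s = x z * a s" if "s \<in> S" for s using radical[of x s] that by (auto simp: f_def)
      have "frm x x = frm x (comb (x z) a 0 a)"
      proof (rule frm_cong)
        fix s assume "s \<in> S"
        from *[OF this] show "x s = comb (x z) a 0 a s" by simp
      qed
      then show False using root_norm[OF x] by (simp add: frm_comb_right)
    qed
    then show ?thesis using that by blast
  qed
  define c where "c = f v2 y / f v2 x"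
  have scaled: "f v y = c * f v x" if v: "v \<in> carrier W" for v
  proof -
    obtain A B where AB: "f v2 x = of_int A" "f v x = of_int B" using fint v v2(1) by (metis Ints_cases)
    \<comment> \<open>This combination vanishes at \<open>x\<close>, so that both it and its negative are nonnegative at \<open>y\<close>.\<close>
    have g: "(\<lambda>u. of_int A * f v u + of_int (- B) * f v2 u) \<in> shifts"
      by (intro shifts_add shifts_scale fs v v2)
    have "0 \<le> f v2 x * f v y - f v x * f v2 y"
      using pos[OF g] by (simp add: AB)
    moreover have "f v2 x * f v y - f v x * f v2 y \<le> 0"
      using pos[OF shifts_uminus[OF g]] by (simp add: AB)
    ultimately show ?thesis using v2(2) by (simp add: c_def field_simps)
  qed
  have "0 \<le> c"
  proof (cases "0 < f v2 x")
    case True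
    then show ?thesis using pos[OF fs[OF v2(1)]] by (simp add: c_def)
  next
    case False
    then show ?thesis using pos[OF shifts_uminus[OF fs[OF v2(1)]]] v2(2)
      by (simp add: c_def divide_nonpos_neg)
  qed
  define d where "d = comb 1 y (- c) x"
  have d: "d s = d z * a s" if "s \<in> S" for s
    using radical[OF _ that, of d] scaled by (auto simp: d_def frm_comb_left f_def)
  have yeq: "y = comb c x (d z) a"
    by (rule eq_comb_null[OF x y]) (use d in \<open>simp add: d_def\<close>)
  have "c \<noteq> 0"
  proof
    assume "c = 0"
    then have "frm y y = 0" using yeq frm_comb_left[of c x "d z" a y] by simp
    with root_norm[OF y] show False by simp
  qed
  with \<open>0 \<le> c\<close> yeq that show ?thesis by (metis order_le_less)
qed

lemma linear_expand:
  assumes lin: "\<And>p v q w. L (comb p v q w) = p * L v + q * L w"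
    and "finite K" "\<And>u. u \<notin> K \<Longrightarrow> v u = 0"
  shows "L v = (\<Sum>s\<in>K. v s * (L (basis s) :: real))"
  using assms(2,3)
proof (induction K arbitrary: v)
  case empty
  then have "v = comb 0 v 0 v" by auto
  with lin[of 0 v 0 v] show ?case by simp
next
  case (insert k K)
  define v' where "v' = v(k := 0)"
  have "v = comb 1 v' (v k) (basis k)" by (auto simp: v'_def basis_def)
  then have "L v = L v' + v k * L (basis k)" using lin by (metis mult_1)
  also have "L v' = (\<Sum>s\<in>K. v' s * L (basis s))"
    using insert.prems by (intro insert.IH) (auto simp: v'_def)
  also have "\<dots> = (\<Sum>s\<in>K. v s * L (basis s))" using insert.hyps by (intro sum.cong) (auto simp: v'_def)
  finally show ?case using insert.hyps by simp
qed

lemma act_root: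
  assumes "K \<subseteq> S" "xs \<in> lists K" "s \<in> K"
  shows "act xs (basis s) \<in> real_roots K"
proof -
  have "xs \<in> lists S" using lists_mono[OF assms(1)] assms(2) by blast
  then have "act xs (basis s) = rep (wp xs) (basis s)" by (simp add: rep_wp)
  then show ?thesis using real_rootI[OF word_in_generate[OF assms(2)] assms(3)] by simp
qed

lemma real_root_act:
  assumes "K \<subseteq> S" "x \<in> real_roots K"
  obtains xs s where "xs \<in> lists K" "s \<in> K" "x = act xs (basis s)"
proof -
  obtain w s where w: "w \<in> generate W K" "s \<in> K" "x = rep w (basis s)"
    using assms(2) by (auto simp: real_roots_def)
  obtain xs where xs: "xs \<in> lists K" "wp xs = w" using word_over[OF w(1) assms(1)] by blast
  then have "xs \<in> lists S" using lists_mono[OF assms(1)] by blast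
  then show ?thesis using that[OF xs(1) w(2)] w(3) rep_wp[of xs] xs(2) by simp
qed

lemma neg_root:
  assumes "K \<subseteq> S" "x \<in> real_roots K" shows "comb (- 1) x 0 a \<in> real_roots K"
proof -
  obtain w s where w: "w \<in> generate W K" "s \<in> K" "x = rep w (basis s)"
    using assms(2) by (auto simp: real_roots_def)
  then have "comb (- 1) x 0 a = rep (w \<otimes> s) (basis s)"
    using assms(1) generate_closed by (subst rep_basis_flip) auto
  moreover have "w \<otimes> s \<in> generate W K" using w(1) generate.incl[OF w(2)] by (rule generate.eng)
  ultimately show ?thesis using real_rootI[OF _ w(2)] by simp
qed

section \<open>Translations as shifts along the null vector\<close>

definition shift :: "'w \<Rightarrow> ('w \<Rightarrow> real) \<Rightarrow> real" where
  "shift t x = rep t x z - x z"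

definition translation :: "'w \<Rightarrow> bool" where
  "translation t \<longleftrightarrow> t \<in> carrier W \<and> (\<forall>x\<in>real_roots S. rep t x = comb 1 x (shift t x) a)"

lemma translation_closed [simp]: "translation t \<Longrightarrow> t \<in> carrier W"
  and translation_rep: "translation t \<Longrightarrow> x \<in> real_roots S \<Longrightarrow> rep t x = comb 1 x (shift t x) a"
  by (simp_all add: translation_def)

lemma shift_comb: "t \<in> carrier W \<Longrightarrow> shift t (comb p v q w) = p * shift t v + q * shift t w"
  by (simp add: shift_def rep_comb algebra_simps)

lemma shift_null [simp]: "t \<in> carrier W \<Longrightarrow> shift t a = 0"
  by (simp add: shift_def)

lemma translationI:
  assumes "t \<in> carrier W" "\<And>x. x \<in> real_roots S \<Longrightarrow> rep t x = comb 1 x (f x) a"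
  shows "translation t" "x \<in> real_roots S \<Longrightarrow> shift t x = f x"
proof -
  have *: "shift t x = f x" if "x \<in> real_roots S" for x
    using assms(2)[OF that] a_z by (simp add: shift_def)
  then show "translation t" using assms by (simp add: translation_def)
  show "x \<in> real_roots S \<Longrightarrow> shift t x = f x" by (rule *)
qed

text \<open>
  By \<open>nested_half_parallel\<close> the image of a root vector \<open>x\<close> is \<open>c x + k a\<close> with \<open>c > 0\<close>, and
  \<open>c = 1\<close> as the norm is preserved.
\<close>

lemma parallel_preserving_translation:
  assumes t: "t \<in> carrier W"
    and par: "\<And>x. x \<in> real_roots S \<Longrightarrow> half (rep t x) \<subseteq> half x \<or> half x \<subseteq> half (rep t x)"
  shows "translation t"
proof -
  have "\<exists>k. rep t x = comb 1 x k a" if x: "x \<in> real_roots S" for x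
  proof -
    have tx: "rep t x \<in> real_roots S" using rep_root' t x by simp
    have norm: "frm (rep t x) (rep t x) = frm x x" "frm x x \<noteq> 0"
      using frm_rep t root_norm[OF x] by auto
    have one: "c = 1" if "0 < c" "frm x x = c * c * frm x x" for c :: real
      using that norm(2) by (auto simp: square_eq_1_iff)
    from par[OF x] show ?thesis
    proof
      assume "half (rep t x) \<subseteq> half x"
      then obtain c k where c: "0 < c" "x = comb c (rep t x) k a" using nested_half_parallel[OF tx x] by blast
      then have "frm x x = frm (comb c (rep t x) k a) (comb c (rep t x) k a)" by simp
      then have "c = 1" using one[OF c(1)] norm by (simp add: frm_comb_left frm_comb_right)
      have "rep t x = comb 1 x (- k) a"
      proof
        fix u
        show "rep t x u = comb 1 x (- k) a u"
          using fun_cong[OF c(2), of u] \<open>c = 1\<close> by simp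
      qed
      then show ?thesis by blast
    next
      assume "half x \<subseteq> half (rep t x)"
      then obtain c k where c: "0 < c" "rep t x = comb c x k a" using nested_half_parallel[OF x tx] by blast
      then have "frm x x = c * c * frm x x" using norm(1) by (simp add: frm_comb_left frm_comb_right)
      then show ?thesis using one[OF c(1)] c(2) by blast
    qed
  qed
  then obtain f where "\<And>x. x \<in> real_roots S \<Longrightarrow> rep t x = comb 1 x (f x) a" by metis
  then show ?thesis using translationI(1)[OF t] by blast
qed

lemma translation_mult:
  assumes "translation t" "translation u"
  shows "translation (t \<otimes> u)" "x \<in> real_roots S \<Longrightarrow> shift (t \<otimes> u) x = shift t x + shift u x"
proof -
  have "rep (t \<otimes> u) x = comb 1 x (shift t x + shift u x) a" if "x \<in> real_roots S" for x
  proof -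
    have "rep (t \<otimes> u) x = comb 1 (rep t x) (shift u x) (rep t a)"
      using assms that translation_rep[of u x] by (simp add: rep_mult rep_comb)
    then show ?thesis using assms(1) translation_rep[OF assms(1) that] by (simp add: fun_eq_iff algebra_simps)
  qed
  note * = translationI[OF _ this]
  show "translation (t \<otimes> u)" "x \<in> real_roots S \<Longrightarrow> shift (t \<otimes> u) x = shift t x + shift u x"
    using * assms by auto
qed

lemma translation_one: "translation \<one>" and shift_one [simp]: "shift \<one> x = 0"
  by (auto simp: translation_def shift_def)

lemma translation_inv:
  assumes "translation t"
  shows "translation (inv t)" "x \<in> real_roots S \<Longrightarrow> shift (inv t) x = - shift t x"
proof -
  have "rep (inv t) x = comb 1 x (- shift t x) a" if "x \<in> real_roots S" for x
  proof -
    have "rep t (comb 1 x (- shift t x) a) = comb 1 (rep t x) (- shift t x) a"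
      using assms by (simp add: rep_comb)
    also have "\<dots> = x" using translation_rep[OF assms that] by (simp add: fun_eq_iff)
    finally show ?thesis using rep_inv_cancel(1)[of t] assms by (metis translation_closed)
  qed
  note * = translationI[OF _ this]
  show "translation (inv t)" "x \<in> real_roots S \<Longrightarrow> shift (inv t) x = - shift t x"
    using * assms by auto
qed

lemma translation_nat_pow:
  assumes "translation t"
  shows "translation (t [^] (n::nat)) \<and> (\<forall>x\<in>real_roots S. shift (t [^] n) x = n * shift t x)"
proof (induction n)
  case (Suc n)
  then show ?case using translation_mult[of "t [^] n" t] assms by (auto simp: algebra_simps)
qed (auto simp: translation_one)

lemma translation_int_pow:
  assumes "translation t"
  shows "translation (t [^] (n::int))" "x \<in> real_roots S \<Longrightarrow> shift (t [^] n) x = n * shift t x"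
proof -
  have "translation (t [^] n) \<and> (\<forall>x\<in>real_roots S. shift (t [^] n) x = n * shift t x)"
  proof (cases n)
    case (nonneg m)
    then show ?thesis using translation_nat_pow[OF assms, of m] by (simp add: int_pow_int)
  next
    case (neg m)
    then have "t [^] n = inv (t [^] Suc m)" using assms int_pow_neg_int[of t "Suc m"] by simp
    moreover have nn: "real_of_int n = - real (Suc m)" using neg by simp
    have "translation (inv (t [^] Suc m))"
      "\<forall>x\<in>real_roots S. shift (inv (t [^] Suc m)) x = real_of_int n * shift t x"
      unfolding nn
      using translation_nat_pow[OF assms, of "Suc m"] translation_inv[of "t [^] Suc m"]
      by (auto simp del: of_nat_Suc nat_pow_Suc)
    ultimately show ?thesis by simp
  qed
  then show "translation (t [^] n)" "x \<in> real_roots S \<Longrightarrow> shift (t [^] n) x = n * shift t x" by auto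
qed

lemma translation_word_prod:
  assumes "\<And>t. t \<in> set ts \<Longrightarrow> translation t"
  shows "translation (word_prod W ts) \<and>
    (\<forall>x\<in>real_roots S. shift (word_prod W ts) x = (\<Sum>t\<leftarrow>ts. shift t x))"
  using assms
proof (induction ts)
  case (Cons t ts)
  then show ?case using translation_mult[of t "word_prod W ts"] by auto
qed (auto simp: translation_one)

lemma translation_half_mono:
  assumes "translation t" "x \<in> real_roots S"
  shows "0 \<le> shift t x \<Longrightarrow> half x \<subseteq> half (rep t x)" "shift t x \<le> 0 \<Longrightarrow> half (rep t x) \<subseteq> half x"
proof -
  note tx = translation_rep[OF assms]
  show "0 \<le> shift t x \<Longrightarrow> half x \<subseteq> half (rep t x)" using half_mono[OF tx] by simp
  have "x = comb 1 (rep t x) (- shift t x) a" by (subst tx) auto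
  then show "shift t x \<le> 0 \<Longrightarrow> half (rep t x) \<subseteq> half x" using half_mono by fastforce
qed

lemma shift_neg_of_psubset:
  "translation t \<Longrightarrow> x \<in> real_roots S \<Longrightarrow> half (rep t x) \<subset> half x \<Longrightarrow> shift t x < 0"
  using translation_half_mono(1)[of t x] by (meson leI psubset_imp_subset psubsetD subset_not_subset_eq)

lemma coord_pos_nonneg: "x \<in> real_roots S \<Longrightarrow> 0 < x z \<Longrightarrow> nonneg x"
  using negative_coord[of x z] by fastforce

text \<open>
  If \<open>t\<close> preserves \<open>half x\<close>, then the sign of \<open>x + n (shift t x) a\<close> is the same for all integers \<open>n\<close>,
  whereas its coordinate at \<open>z\<close> takes both signs unless the shift is zero.
\<close>

lemma shift_zero_of_eq:
  assumes t: "translation t" and x: "x \<in> real_roots S" and eq: "half (rep t x) = half x"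
  shows "shift t x = 0"
proof (rule ccontr)
  assume nz: "shift t x \<noteq> 0"
  define P where "P n \<longleftrightarrow> nonneg (rep (t [^] (n::int)) x)" for n
  have tc: "t \<in> carrier W" using t by simp
  have step: "P (n + 1) \<longleftrightarrow> P n" for n
  proof -
    have "rep (t [^] (n + 1)) x = rep (t [^] n) (rep t x)"
      using tc int_pow_mult[OF tc, of n 1] by (simp add: rep_mult)
    then show ?thesis
      using eq tc unfolding P_def half_def
      by (auto simp: set_eq_iff dest!: spec[of _ "inv (t [^] n)"])
  qed
  have const: "P n \<longleftrightarrow> P 0" for n
  proof (induction n rule: int_induct[where k = 0])
    case (step2 i)
    then show ?case using step[of "i - 1"] by simp
  qed (use step in auto)
  have coord: "rep (t [^] n) x z = x z + of_int n * shift t x" for n :: int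
    using translation_rep[OF translation_int_pow(1)[OF t] x, of n] translation_int_pow(2)[OF t x, of n] a_z
    by simp
  obtain k where k: "\<bar>x z\<bar> < of_int k * \<bar>shift t x\<bar>"
    using ex_less_of_int[of "\<bar>x z\<bar> / \<bar>shift t x\<bar>"] nz by (auto simp: field_simps)
  define n where "n = (if shift t x > 0 then k else - k)"
  have up: "0 < x z + of_int n * shift t x" and down: "x z + of_int (- n) * shift t x < 0"
    using k by (auto simp: n_def abs_if split: if_splits)
  have "P n" unfolding P_def
    using coord_pos_nonneg[OF rep_root'[OF _ x]] tc up coord by simp
  moreover have "\<not> P (- n)" unfolding P_def nonneg_def using coord[of "- n"] down
    by (metis not_le)
  ultimately show False using const by blast
qed

section \<open>Parallel classes of roots at a special vertex\<close>

text \<open>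
  Modulo the null vector, \<open>basis z\<close> and its reflection are \<open>- theta\<close> and the reflection in \<open>theta\<close>,
  which belong to the parabolic subgroup of the other nodes.
\<close>

lemma root_parallel_linear:
  assumes "x \<in> real_roots S"
  shows "\<exists>y\<in>real_roots (S - {z}). \<exists>k. x = comb 1 y k a"
proof -
  define P where "P v \<longleftrightarrow> (\<exists>y\<in>real_roots (S - {z}). \<exists>k. v = comb 1 y k a)" for v
  obtain u where u: "u \<in> generate W (S - {z})" "\<And>x. rep u x = comb 1 x (coroot z x) theta"
    using theta_reflection by blast
  obtain w s where w: "w \<in> carrier W" "s \<in> S" "x = rep w (basis s)" using assms by (rule real_rootE)
  have "P (rep w (basis s))"
  proof (rule rep_induct'[OF w(1)])
    show "P (basis s)"
    proof (cases "s = z")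
      case True
      then have "basis s = comb 1 (comb (- 1) theta 0 a) 1 a" by (auto simp: theta_def)
      then show ?thesis unfolding P_def using neg_root[OF _ theta_root] by blast
    next
      case False
      have "basis s = comb 1 (basis s) 0 a" by auto
      then show ?thesis unfolding P_def using basis_root[of s "S - {z}"] False w(2) by blast
    qed
  next
    fix s v assume s: "s \<in> S" and "P v"
    then obtain y k where y: "y \<in> real_roots (S - {z})" "v = comb 1 y k a" by (auto simp: P_def)
    have sv: "srefl s v = comb 1 (srefl s y) k a" using s by (simp add: y(2) srefl_comb)
    show "P (srefl s v)"
    proof (cases "s = z")
      case True
      have "rep u y \<in> real_roots (S - {z})" using rep_root[OF _ u(1) y(1)] by blast
      moreover have "srefl s v = comb 1 (rep u y) (k - coroot z y) a"
        using sv True by (auto simp: u(2) srefl_eq theta_def algebra_simps)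
      ultimately show ?thesis unfolding P_def by blast
    next
      case False
      then have "rep s y \<in> real_roots (S - {z})"
        using s y(1) by (intro rep_root) (auto intro: generate.incl)
      then show ?thesis unfolding P_def using sv s by auto
    qed
  qed
  then show ?thesis by (simp add: P_def w(3))
qed

text \<open>
  The normalised pairings with the simple roots determine a root vector up to positive multiples and
  multiples of the null vector.
\<close>

definition direction :: "('w \<Rightarrow> real) \<Rightarrow> 'w \<Rightarrow> real" where
  "direction x = (\<lambda>s\<in>S. frm (basis s) x / sqrt (frm x x))"

lemma direction_eqD:
  assumes x: "x \<in> real_roots S" and y: "y \<in> real_roots S" and eq: "direction x = direction y"
  obtains c k where "0 < c" "y = comb c x k a"
proof -
  have pos: "0 < sqrt (frm x x)" "0 < sqrt (frm y y)" using root_norm x y by fastforce+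
  define c where "c = sqrt (frm y y) / sqrt (frm x x)"
  define d where "d = comb 1 y (- c) x"
  have "frm (basis s) d = 0" if "s \<in> S" for s
    using fun_cong[OF eq, of s] that pos
    by (simp add: direction_def d_def frm_comb_right c_def field_simps)
  then have d: "d s = d z * a s" if "s \<in> S" for s using orthogonal_to_basis that by blast
  have "y = comb c x (d z) a"
    by (rule eq_comb_null[OF x y]) (unfold d_def[symmetric], rule d)
  moreover have "0 < c" using pos by (simp add: c_def)
  ultimately show ?thesis using that by blast
qed

lemma direction_comb:
  assumes "0 < c" shows "direction (comb c x k a) = direction x"
proof -
  have "frm (comb c x k a) (comb c x k a) = c\<^sup>2 * frm x x"
    by (simp add: frm_comb_left frm_comb_right power2_eq_square)
  then have "sqrt (frm (comb c x k a) (comb c x k a)) = c * sqrt (frm x x)"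
    using assms by (simp add: real_sqrt_mult)
  then show ?thesis using assms by (auto simp: direction_def frm_comb_right)
qed

text \<open>
  The pairings are integers, bounded by the Cauchy-Schwarz inequality.
\<close>

lemma finite_directions: "finite (direction ` real_roots S)"
proof -
  define M where "M = (\<Sum>s\<in>S. b s s)"
  have bM: "b s s \<le> M" if "s \<in> S" for s
    unfolding M_def using that fin b_pos by (intro member_le_sum) (auto intro: less_imp_le)
  define V where "V = (\<lambda>(r, n). r / sqrt n) ` ({r \<in> \<int>. \<bar>r\<bar> \<le> M} \<times> (\<lambda>s. b s s) ` S)"
  have "direction x \<in> (\<Pi>\<^sub>E s\<in>S. V)" if x: "x \<in> real_roots S" for x
  proof -
    obtain w t where w: "w \<in> carrier W" "t \<in> S" "x = rep w (basis t)" using x by (rule real_rootE)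
    have norm: "frm x x = b t t" using w frm_root by simp
    have "frm (basis s) x / sqrt (frm x x) \<in> V" if s: "s \<in> S" for s
    proof -
      have "frm (basis s) x \<in> \<int>" unfolding frm_def
        using b_int root_int[OF x] by (intro Ints_sum Ints_mult) (auto simp: basis_def)
      moreover have "(frm (basis s) x)\<^sup>2 \<le> b s s * b t t"
        using cauchy_schwarz[of "basis s" x] norm s by (simp add: frm_basis)
      then have "(frm (basis s) x)\<^sup>2 \<le> M\<^sup>2"
        unfolding power2_eq_square[of M]
        using mult_mono[OF bM[OF s] bM[OF w(2)]] b_pos[OF s] b_pos[OF w(2)] bM[OF s] by linarith
      then have "\<bar>frm (basis s) x\<bar> \<le> M"
        using bM[OF s] b_pos[OF s] by (simp add: abs_le_square_iff[symmetric])
      ultimately show ?thesis using w(2) norm unfolding V_def by force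
    qed
    then show ?thesis by (auto simp: direction_def)
  qed
  moreover have "finite (\<Pi>\<^sub>E s\<in>S. V)"
    unfolding V_def using fin finite_abs_int_segment by (intro finite_PiE) auto
  ultimately show ?thesis by (meson finite_subset image_subsetI)
qed

text \<open>
  Both sides are \<open>- cos (\<pi> / m)\<close> with \<open>m\<close> the order of the product.
\<close>

lemma normalized_form_unique:
  assumes "s \<in> S" "t \<in> S" "s' \<in> S" "t' \<in> S" "s \<noteq> t" "s' \<noteq> t'" "ord (s' \<otimes> t') = ord (s \<otimes> t)"
  shows "b s' t' / (sqrt (b s' s') * sqrt (b t' t')) = b s t / (sqrt (b s s) * sqrt (b t t))"
proof -
  define f where "f s t = b s t / (sqrt (b s s) * sqrt (b t t))" for s t
  have sq: "4 * (f s t)\<^sup>2 = 4 * (b s t)\<^sup>2 / (b s s * b t t)" if "s \<in> S" "t \<in> S" for s t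
    using b_pos[OF that(1)] b_pos[OF that(2)] by (simp add: f_def power_divide power_mult_distrib)
  have "4 * (f s' t')\<^sup>2 = 4 * (f s t)\<^sup>2"
    using b_ord[OF assms(1,2,5)] b_ord[OF assms(3,4,6)] assms(1-4,7) by (auto simp: sq)
  moreover have "f s t \<le> 0" "f s' t' \<le> 0"
    using b_off b_pos assms by (auto simp: f_def intro!: divide_nonpos_pos)
  ultimately have "f s' t' = f s t" by (auto simp: power2_eq_iff)
  then show ?thesis by (simp add: f_def)
qed

text \<open>
  An isomorphism \<open>\<eta>\<close> of Coxeter diagrams intertwines the actions of both parabolic subgroups in
  coordinates scaled by the lengths of the simple roots. The roots of each subgroup are determined by
  their directions, because adding a nonzero multiple of \<open>a\<close> to a vector supported on a proper subset
  of \<open>S\<close> makes it nonzero elsewhere. So there are at least as many directions for \<open>J\<close> as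
  for \<open>S - {z}\<close>. The latter are all directions by \<open>root_parallel_linear\<close>, and there are finitely
  many.
\<close>

theorem special_vertex_directions:
  assumes J: "J \<subset> S" and \<eta>: "bij_betw \<eta> (S - {z}) J"
    and ord: "\<And>s t. \<lbrakk>s \<in> S - {z}; t \<in> S - {z}; s \<noteq> t\<rbrakk> \<Longrightarrow> ord (\<eta> s \<otimes> \<eta> t) = ord (s \<otimes> t)"
    and x: "x \<in> real_roots S"
  shows "\<exists>y\<in>real_roots J. \<exists>c>0. \<exists>k. x = comb c y k a"
proof -
  define K where "K = S - {z}"
  have KS: "K \<subseteq> S" and JS: "J \<subseteq> S" using J by (auto simp: K_def)
  have \<eta>J: "\<eta> s \<in> J" if "s \<in> K" for s using \<eta> that by (auto simp: bij_betw_def K_def)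
  have \<eta>S: "\<eta> s \<in> S" if "s \<in> K" for s using \<eta>J that JS by blast
  define n where "n s = sqrt (b s s)" for s
  have n: "0 < n s" if "s \<in> S" for s using b_pos[OF that] by (simp add: n_def)
  define \<kappa> where "\<kappa> s t = 2 * b s t / (n s * n t)" for s t
  have \<kappa>: "\<kappa> (\<eta> s) (\<eta> t) = \<kappa> s t" if "s \<in> K" "t \<in> K" for s t
  proof (cases "s = t")
    case True
    have "\<kappa> s s = 2" if "s \<in> S" for s using n[OF that] b_pos[OF that] by (simp add: \<kappa>_def n_def)
    then show ?thesis using True that KS \<eta>S by auto
  next
    case False
    then have "\<eta> s \<noteq> \<eta> t" using \<eta> that by (auto simp: bij_betw_def inj_on_def K_def)
    then show ?thesis
      using normalized_form_unique[of s t "\<eta> s" "\<eta> t"] False that KS \<eta>S ord[of s t]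
      by (auto simp: \<kappa>_def n_def K_def)
  qed
  \<comment> \<open>Coordinates scaled by the lengths of the simple roots only see the Coxeter matrix.\<close>
  have refl_scaled: "srefl s v s * n s = v s * n s - (\<Sum>t\<in>L. \<kappa> s t * (v t * n t))"
    if "s \<in> S" "L \<subseteq> S" "\<And>u. u \<notin> L \<Longrightarrow> v u = 0" for s v L
  proof -
    have "coroot s v * n s = (\<Sum>t\<in>S. \<kappa> s t * (v t * n t))"
      unfolding coroot_def sum_distrib_right
    proof (intro sum.cong)
      fix t assume "t \<in> S"
      have "n s * n s = b s s" using b_pos[OF that(1)] by (simp add: n_def)
      then show "2 * b s t / b s s * v t * n s = \<kappa> s t * (v t * n t)"
        using n[OF that(1)] n[OF \<open>t \<in> S\<close>] b_pos[OF that(1)] by (simp add: \<kappa>_def field_simps)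
    qed simp
    also have "\<dots> = (\<Sum>t\<in>L. \<kappa> s t * (v t * n t))"
      using that fin by (intro sum.mono_neutral_right) auto
    finally show ?thesis by (simp add: srefl_def algebra_simps)
  qed
  define X where "X p = act (fst p) (basis (snd p))" for p
  define X' where "X' p = act (map \<eta> (fst p)) (basis (\<eta> (snd p)))" for p
  define P where "P = lists K \<times> K"
  have in_J: "map \<eta> xs \<in> lists J" if "xs \<in> lists K" for xs
    using that \<eta>J by (auto simp: in_lists_conv_set)
  have XK: "X p \<in> real_roots K" and XJ: "X' p \<in> real_roots J" if "p \<in> P" for p
    using that act_root[OF KS] act_root[OF JS] in_J \<eta>J by (auto simp: X_def X'_def P_def)
  have rootsK: "X ` P = real_roots K"
  proof
    show "real_roots K \<subseteq> X ` P"
    proof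
      fix x assume "x \<in> real_roots K"
      then obtain xs s where "xs \<in> lists K" "s \<in> K" "x = act xs (basis s)"
        by (rule real_root_act[OF KS])
      then show "x \<in> X ` P" by (intro image_eqI[of _ _ "(xs, s)"]) (simp_all add: X_def P_def)
    qed
  qed (use XK in blast)
  have rootsJ: "X' ` P = real_roots J"
  proof
    show "real_roots J \<subseteq> X' ` P"
    proof
      fix x assume "x \<in> real_roots J"
      then obtain ys s where ys: "ys \<in> lists J" "s \<in> J" "x = act ys (basis s)"
        by (rule real_root_act[OF JS])
      have "J = \<eta> ` K" using \<eta> by (auto simp: bij_betw_def K_def)
      then obtain xs t where "xs \<in> lists K" "ys = map \<eta> xs" "t \<in> K" "s = \<eta> t"
        using ys(1,2) by (auto simp: lists_image)
      then show "x \<in> X' ` P" using ys(3) by (intro image_eqI[of _ _ "(xs, t)"]) (simp_all add: X'_def P_def)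
    qed
  qed (use XJ in blast)
  have scaled: "X' p (\<eta> u) * n (\<eta> u) / n (\<eta> (snd p)) = X p u * n u / n (snd p)"
    if p: "p \<in> P" and u: "u \<in> K" for p u
  proof -
    obtain xs s where p_eq: "p = (xs, s)" by (cases p)
    with p have xs: "xs \<in> lists K" and s: "s \<in> K" by (auto simp: P_def)
    define r where "r = n s / n (\<eta> s)"
    have ns: "0 < n s" "0 < n (\<eta> s)" using n s KS \<eta>S by auto
    have supp: "u \<notin> K \<Longrightarrow> act xs (basis s) u = 0" "u \<notin> J \<Longrightarrow> act (map \<eta> xs) (basis (\<eta> s)) u = 0"
      if "xs \<in> lists K" for xs u
      using root_support[OF KS act_root[OF KS that s]] root_support[OF JS act_root[OF JS in_J[OF that] \<eta>J[OF s]]]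
      by simp_all
    have "act (map \<eta> xs) (basis (\<eta> s)) (\<eta> u) * n (\<eta> u) * r = act xs (basis s) u * n u" if "u \<in> K" for u
      using that xs
    proof (induction xs arbitrary: u)
      case Nil
      have "\<eta> u = \<eta> s \<longleftrightarrow> u = s" using \<eta> s Nil.prems by (auto simp: bij_betw_def inj_on_def K_def)
      then show ?case using ns by (auto simp: basis_def r_def)
    next
      case (Cons t xs)
      then have t: "t \<in> K" and xsK: "xs \<in> lists K" by auto
      let ?v = "act xs (basis s)" and ?v' = "act (map \<eta> xs) (basis (\<eta> s))"
      show ?case
      proof (cases "u = t")
        case False
        moreover have "\<eta> u \<noteq> \<eta> t" using \<eta> t Cons.prems False by (auto simp: bij_betw_def inj_on_def K_def)
        ultimately show ?thesis using Cons.IH[OF Cons.prems(1) xsK] by (simp add: srefl_def)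
      next
        case True
        have "(\<Sum>w\<in>J. \<kappa> (\<eta> t) w * (?v' w * n w)) = (\<Sum>w\<in>K. \<kappa> (\<eta> t) (\<eta> w) * (?v' (\<eta> w) * n (\<eta> w)))"
          by (subst sum.reindex_bij_betw[OF \<eta>, symmetric]) (simp add: K_def)
        then have "(\<Sum>w\<in>J. \<kappa> (\<eta> t) w * (?v' w * n w)) * r = (\<Sum>w\<in>K. \<kappa> t w * (?v w * n w))"
          using Cons.IH[OF _ xsK] \<kappa>[OF t] by (simp add: sum_distrib_right mult.assoc)
        then show ?thesis
          using refl_scaled[of "\<eta> t" J ?v'] refl_scaled[of t K ?v] supp[OF xsK] t True KS JS \<eta>S[OF t]
            Cons.IH[OF t xsK] by (auto simp: left_diff_distrib)
      qed
    qed
    from this[OF u] show ?thesis using ns by (simp add: p_eq X_def X'_def r_def field_simps)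
  qed
  have det: "direction (X p) = direction (X q)"
    if p: "p \<in> P" "q \<in> P" and eq: "direction (X' p) = direction (X' q)" for p q
  proof -
    have in_S: "X' p \<in> real_roots S" "X' q \<in> real_roots S"
      using p rootsJ real_roots_mono[OF JS] by blast+
    obtain c k where c: "0 < c" "X' q = comb c (X' p) k a" using direction_eqD[OF in_S eq] by blast
    obtain s where s: "s \<in> S" "s \<notin> J" using J by blast
    have "X' p s = 0" "X' q s = 0" using root_support[OF JS _ s(2)] p rootsJ by blast+
    then have "k = 0" using c(2) a_pos[OF s(1)] by simp
    define r where "r p = n (\<eta> (snd p)) / n (snd p)" for p :: "'w list \<times> 'w"
    have r: "0 < r p" "0 < r q" using p n KS \<eta>S by (auto simp: r_def P_def)
    have "X q = comb (c * r p / r q) (X p) 0 a"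
    proof
      fix u
      show "X q u = comb (c * r p / r q) (X p) 0 a u"
      proof (cases "u \<in> K")
        case True
        then have nu: "0 < n u" "0 < n (\<eta> u)" using n KS \<eta>S by auto
        have *: "X' p (\<eta> u) * n (\<eta> u) = X p u * n u * r p" if "p \<in> P" for p
          using scaled[OF that True] n[of "snd p"] n[of "\<eta> (snd p)"] that KS \<eta>S
          by (auto simp: r_def P_def field_simps)
        have "X q u * n u * r q = X' q (\<eta> u) * n (\<eta> u)" using *[OF p(2)] by simp
        also have "\<dots> = c * (X' p (\<eta> u) * n (\<eta> u))" using c(2) \<open>k = 0\<close> by simp
        also have "\<dots> = c * (X p u * n u * r p)" using *[OF p(1)] by simp
        finally show ?thesis using nu r by (simp add: field_simps)
      next
        case False
        then show ?thesis using root_support[OF KS _ False] p rootsK by (metis comb_apply image_eqI mult_zero_left mult_zero_right add_0)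
      qed
    qed
    then show ?thesis using direction_comb[of "c * r p / r q"] c(1) r by simp
  qed
  have all: "direction ` real_roots S = direction ` real_roots K"
  proof
    show "direction ` real_roots S \<subseteq> direction ` real_roots K"
    proof
      fix d assume "d \<in> direction ` real_roots S"
      then obtain x where "x \<in> real_roots S" "d = direction x" by blast
      moreover from this(1) obtain y k where "y \<in> real_roots K" "x = comb 1 y k a"
        using root_parallel_linear unfolding K_def by blast
      ultimately show "d \<in> direction ` real_roots K" using direction_comb[of 1 y k] by simp
    qed
    show "direction ` real_roots K \<subseteq> direction ` real_roots S" using real_roots_mono[OF KS] by blast
  qed
  have "\<exists>g. \<forall>p\<in>P. g (direction (X' p)) = direction (X p)"
  proof
    show "\<forall>p\<in>P. (\<lambda>d. direction (X (SOME p. p \<in> P \<and> direction (X' p) = d))) (direction (X' p)) = direction (X p)"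
    proof
      fix p assume p: "p \<in> P"
      define q where "q = (SOME q. q \<in> P \<and> direction (X' q) = direction (X' p))"
      have "q \<in> P \<and> direction (X' q) = direction (X' p)"
        unfolding q_def by (rule someI[of _ p]) (use p in simp)
      then show "(\<lambda>d. direction (X (SOME p. p \<in> P \<and> direction (X' p) = d))) (direction (X' p)) = direction (X p)"
        using det[of q p] p by (simp add: q_def)
    qed
  qed
  then obtain g where g: "\<And>p. p \<in> P \<Longrightarrow> g (direction (X' p)) = direction (X p)" by blast
  have finJ: "finite (direction ` real_roots J)"
    using finite_subset[OF image_mono[OF real_roots_mono[OF JS]] finite_directions] .
  have "direction ` real_roots K \<subseteq> g ` direction ` real_roots J"
    unfolding rootsK[symmetric] rootsJ[symmetric] using g by force
  then have "card (direction ` real_roots K) \<le> card (direction ` real_roots J)"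
    using finJ by (meson card_image_le card_mono finite_imageI le_trans)
  then have "direction ` real_roots J = direction ` real_roots S"
    using card_seteq[OF finite_directions image_mono[OF real_roots_mono[OF JS], of direction]] all by simp
  then obtain y where y: "y \<in> real_roots J" "direction y = direction x" using x by (metis image_iff)
  then have "y \<in> real_roots S" using real_roots_mono[OF JS] by blast
  from direction_eqD[OF this x y(2)] show ?thesis using y(1) by metis
qed

section \<open>Roots containing the translates along a gallery\<close>

lemma half_neg: "x \<in> real_roots S \<Longrightarrow> w \<in> carrier W \<Longrightarrow> w \<in> half (comb (- 1) x 0 a) \<longleftrightarrow> w \<notin> half x"
  using root_sign[of "rep (inv w) x"] not_both_signs[of "rep (inv w) x"] rep_root'[of "inv w" x]
  by (auto simp: half_def rep_comb)

lemma one_in_half: "\<one> \<in> half x \<longleftrightarrow> nonneg x"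
  by (simp add: half_def)

text \<open>
  No \<open>s \<in> J\<close> lengthens the longest element \<open>w0\<close>, so its inverse makes every simple root of \<open>J\<close>
  negative, and then all positive roots of the subgroup.
\<close>

lemma longest_makes_negative:
  assumes J: "J \<subseteq> S" and w0: "w0 \<in> generate W J"
    and longest: "\<And>w. w \<in> generate W J \<Longrightarrow> wlen w \<le> wlen w0"
    and y: "y \<in> real_roots J"
  shows "w0 \<in> half y \<longleftrightarrow> \<not> nonneg y"
proof -
  have w0c: "w0 \<in> carrier W" using generate_closed J w0 by blast
  have *: "w0 \<notin> half y" if y: "y \<in> real_roots J" and pos: "nonneg y" for y
  proof
    assume "w0 \<in> half y"
    then have nn: "nonneg (rep (inv w0) y)" by (simp add: half_def)
    have yS: "y \<in> real_roots S" using real_roots_mono[OF J] y by blast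
    have neg: "rep (inv w0) (basis s) u \<le> 0" if s: "s \<in> J" for s u
    proof -
      have sS: "s \<in> S" using s J by blast
      have "s \<otimes> w0 \<in> generate W J" by (rule generate.eng[OF generate.incl[OF s] w0])
      then have "wlen (s \<otimes> w0) \<le> wlen w0" using longest by blast
      then have "wlen (inv w0 \<otimes> s) \<le> wlen (inv w0)"
        using wlen_inv[OF w0c] wlen_inv[of "s \<otimes> w0"] w0c sS by (simp add: inv_mult_group)
      then have "\<not> nonneg (rep (inv w0) (basis s))"
        using positive_iff_length[of "inv w0" s] w0c sS by simp
      moreover have "rep (inv w0) (basis s) \<in> real_roots S"
        using rep_root'[of "inv w0"] basis_root[OF sS] w0c by simp
      ultimately show ?thesis using negative_coord by blast
    qed
    have "rep (inv w0) y u \<le> 0" for u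
    proof -
      have "rep (inv w0) y u = (\<Sum>s\<in>J. y s * rep (inv w0) (basis s) u)"
        using w0c fin J root_support[OF J y]
        by (intro linear_expand[of "\<lambda>v. rep (inv w0) v u"]) (auto simp: rep_comb intro: finite_subset)
      also have "\<dots> \<le> 0"
        using neg pos by (intro sum_nonpos) (auto simp: nonneg_def intro: mult_nonneg_nonpos)
      finally show ?thesis .
    qed
    then have "nonneg (comb (- 1) (rep (inv w0) y) 0 a)" by (simp add: nonneg_def)
    moreover have "rep (inv w0) y \<in> real_roots S" using rep_root'[OF _ yS] w0c by simp
    ultimately show False using not_both_signs nn by blast
  qed
  have yS: "y \<in> real_roots S" using real_roots_mono[OF J] y by blast
  show ?thesis
  proof
    assume "w0 \<in> half y"
    then show "\<not> nonneg y" using *[OF y] by blast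
  next
    assume "\<not> nonneg y"
    then have "nonneg (comb (- 1) y 0 a)" using root_sign[OF yS] by blast
    then have "w0 \<notin> half (comb (- 1) y 0 a)" using *[OF neg_root[OF J y]] by blast
    then show "w0 \<in> half y" using half_neg[OF yS w0c] by blast
  qed
qed

lemma half_crossing:
  assumes x: "x \<in> real_roots S" and w: "w \<in> carrier W" and s: "s \<in> S"
    and "w \<in> half x" "w \<otimes> s \<notin> half x"
  shows "x = rep w (basis s)"
proof -
  have "rep (inv (w \<otimes> s)) x = srefl s (rep (inv w) x)" using w s by (simp add: inv_mult_group rep_mult)
  then have "rep (inv w) x = basis s"
    using assms rep_root'[of "inv w" x] by (intro simple_reflection_permutes) (auto simp: half_def)
  then show ?thesis using rep_inv_cancel(2)[OF w] by metis
qed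

text \<open>
  Of a root and its negative, one contains the identity but not the product of \<open>ws\<close>. The first step of
  the gallery that leaves this one determines it by \<open>half_crossing\<close>, and it is also a step at which
  the other of the two roots compared is left.
\<close>

lemma gallery_sides_determine_root:
  assumes J: "J \<subseteq> S" and ws: "ws \<in> lists J"
    and longest: "\<And>w. w \<in> generate W J \<Longrightarrow> wlen w \<le> wlen (wp ws)"
    and y: "y \<in> real_roots J" "y' \<in> real_roots J" and nonempty: "ws \<noteq> []"
    and same: "\<And>i. i \<in> {1..length ws} \<Longrightarrow> wp (take i ws) \<in> half y \<longleftrightarrow> wp (take i ws) \<in> half y'"
  shows "y = y'"
proof -
  have wsS: "ws \<in> lists S" using lists_mono[OF J] ws by blast
  have takeS: "take i ws \<in> lists S" for i using wsS by (metis append_in_lists_conv append_take_drop_id)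
  have yS: "y \<in> real_roots S" "y' \<in> real_roots S" using real_roots_mono[OF J] y by blast+
  have last: "wp ws \<in> half v \<longleftrightarrow> \<not> nonneg v" if "v \<in> real_roots J" for v
    using longest_makes_negative[OF J word_in_generate[OF ws] longest that] .
  have sign: "nonneg y \<longleftrightarrow> nonneg y'"
    using same[of "length ws"] last[OF y(1)] last[OF y(2)] nonempty by (auto simp: Suc_le_eq)
  have key: "v = v'"
    if v: "v \<in> real_roots S" "v' \<in> real_roots S" "nonneg v" "nonneg v'" "wp ws \<notin> half v"
      and same: "\<And>i. i \<le> length ws \<Longrightarrow> wp (take i ws) \<in> half v \<longleftrightarrow> wp (take i ws) \<in> half v'" for v v'
  proof -
    define j where "j = (LEAST j. wp (take j ws) \<notin> half v)"
    have ex: "wp (take (length ws) ws) \<notin> half v" using v(5) by simp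
    have j: "wp (take j ws) \<notin> half v" unfolding j_def by (rule LeastI[of _ "length ws"]) (rule ex)
    have j_le: "j \<le> length ws" unfolding j_def by (rule Least_le) (rule ex)
    have "j \<noteq> 0" using j v(3) one_in_half by (intro notI) auto
    then obtain i where i: "j = Suc i" by (cases j) auto
    have in_i: "wp (take i ws) \<in> half v"
      using not_less_Least[of i "\<lambda>j. wp (take j ws) \<notin> half v"] i by (simp add: j_def)
    have s: "ws ! i \<in> S" using wsS j_le i by (auto simp: in_lists_conv_set)
    have step: "wp (take j ws) = wp (take i ws) \<otimes> ws ! i"
      using takeS[of i] s j_le i by (simp add: take_Suc_conv_app_nth wp_append)
    have "v = rep (wp (take i ws)) (basis (ws ! i))"
      using half_crossing[OF v(1) _ s in_i] j step takeS by simp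
    moreover have "v' = rep (wp (take i ws)) (basis (ws ! i))"
      using half_crossing[OF v(2) _ s] same[of i] same[of j] in_i j step takeS j_le i by simp
    ultimately show ?thesis by simp
  qed
  have same0: "wp (take i ws) \<in> half y \<longleftrightarrow> wp (take i ws) \<in> half y'" if "i \<le> length ws" for i
    using same[of i] that sign one_in_half by (cases i) auto
  show ?thesis
  proof (cases "nonneg y")
    case True
    then show ?thesis using key[OF yS] sign last[OF y(1)] same0 by blast
  next
    case False
    let ?n = "\<lambda>v. comb (- 1) v 0 a"
    have "?n y = ?n y'"
    proof (rule key)
      show "?n y \<in> real_roots S" "?n y' \<in> real_roots S" using neg_root[OF order_refl] yS by auto
      show "nonneg (?n y)" "nonneg (?n y')" using root_sign yS False sign by blast+
      show "wp ws \<notin> half (?n y)" using half_neg[OF yS(1)] wsS last[OF y(1)] False by simp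
      show "wp (take i ws) \<in> half (?n y) \<longleftrightarrow> wp (take i ws) \<in> half (?n y')" if "i \<le> length ws" for i
        using half_neg[OF yS(1)] half_neg[OF yS(2)] same0[OF that] takeS by simp
    qed
    then show ?thesis by (auto simp: fun_eq_iff)
  qed
qed

text \<open>
  A root vector that is positive seen from \<open>u\<close> is a nonnegative combination of the vectors
  \<open>rep u (basis s)\<close>, and the shift is linear.
\<close>

lemma shift_sign:
  assumes J: "J \<subseteq> S" and u: "u \<in> generate W J" and t: "translation t"
    and base: "\<And>s. s \<in> J \<Longrightarrow> shift t (rep u (basis s)) < 0" and y: "y \<in> real_roots J"
  shows "u \<in> half y \<Longrightarrow> shift t y < 0" "u \<notin> half y \<Longrightarrow> 0 < shift t y"
proof -
  have uc: "u \<in> carrier W" using generate_closed J u by blast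
  have *: "shift t y < 0" if y: "y \<in> real_roots J" and "u \<in> half y" for y
  proof -
    define v where "v = rep (inv u) y"
    have v: "v \<in> real_roots J" unfolding v_def
      using rep_root[OF J _ y] generate_m_inv_closed[OF _ u] J gen_closed by blast
    have pos: "nonneg v" using that(2) by (simp add: v_def half_def)
    have "shift t y = shift t (rep u v)" using uc by (simp add: v_def)
    also have "\<dots> = (\<Sum>s\<in>J. v s * shift t (rep u (basis s)))"
      using uc t fin J root_support[OF J v]
      by (intro linear_expand[of "\<lambda>v. shift t (rep u v)"]) (auto simp: rep_comb shift_comb intro: finite_subset)
    also have "\<dots> < 0"
    proof -
      have le: "v s * shift t (rep u (basis s)) \<le> 0" if "s \<in> J" for s
        using base[OF that] pos by (auto simp: nonneg_def intro!: mult_nonneg_nonpos)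
      have "\<exists>s\<in>J. v s \<noteq> 0"
      proof (rule ccontr)
        assume "\<not> ?thesis"
        then have "v s = 0" for s using root_support[OF J v] by blast
        then have "nonneg (comb (- 1) v 0 a)" by (simp add: nonneg_def)
        then show False using not_both_signs pos v real_roots_mono[OF J] by blast
      qed
      then obtain s where s: "s \<in> J" "v s \<noteq> 0" by blast
      have "v s > 0" using s(2) pos by (metis nonneg_def order_le_less)
      then have "v s * shift t (rep u (basis s)) < 0" using base[OF s(1)] by (simp add: mult_pos_neg)
      then show ?thesis
        using sum_strict_mono_ex1[of J "\<lambda>s. v s * shift t (rep u (basis s))" "\<lambda>_. 0"] le s(1) fin J
        by (auto intro: finite_subset)
    qed
    finally show ?thesis .
  qed
  show "u \<in> half y \<Longrightarrow> shift t y < 0" using * y by blast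
  assume "u \<notin> half y"
  then have "u \<in> half (comb (- 1) y 0 a)"
    using half_neg uc y real_roots_mono[OF J] by blast
  then have "shift t (comb (- 1) y 0 a) < 0" using *[OF neg_root[OF J y]] by blast
  then show "0 < shift t y" using t by (simp add: shift_comb)
qed

text \<open>
  After division by \<open>c\<close> the vectors differ by multiples of \<open>a\<close> and are compared by their
  coordinates at \<open>z\<close>. The squares of these coordinates, multiplied by a common denominator, are natural
  numbers. So one of them is the least.
\<close>

lemma minimal_parallel_root:
  assumes \<R>: "\<R> \<subseteq> real_roots S" "\<R> \<noteq> {}" and y: "y \<in> real_roots S"
    and pos: "\<And>x. x \<in> \<R> \<Longrightarrow> nonneg x"
    and par: "\<And>x. x \<in> \<R> \<Longrightarrow> \<exists>c>0. \<exists>k. x = comb c y k a"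
  shows "\<exists>x0\<in>\<R>. \<forall>x\<in>\<R>. half x0 \<subseteq> half x"
proof -
  define p where "p = (\<Prod>s\<in>S. b s s)"
  define \<mu> where "\<mu> x = (x z)\<^sup>2 * p / frm x x" for x
  have p: "0 < p" unfolding p_def using b_pos by (intro prod_pos) auto
  have nat: "\<exists>n::nat. \<mu> x = real n" if x: "x \<in> \<R>" for x
  proof -
    obtain w t where w: "w \<in> carrier W" "t \<in> S" "x = rep w (basis t)" using x \<R>(1) real_rootE by blast
    have "p = b t t * (\<Prod>s\<in>S - {t}. b s s)" unfolding p_def using fin w(2) by (rule prod.remove)
    moreover have "frm x x = b t t" using frm_root w by simp
    ultimately have "\<mu> x = (x z)\<^sup>2 * (\<Prod>s\<in>S - {t}. b s s)" using b_pos[OF w(2)] by (simp add: \<mu>_def)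
    moreover have "x z \<in> \<int>" using root_int x \<R>(1) by blast
    then have "(x z)\<^sup>2 * (\<Prod>s\<in>S - {t}. b s s) \<in> \<int>"
      using b_int by (intro Ints_mult Ints_power Ints_prod) auto
    moreover have "0 \<le> \<mu> x" using p frm_nonneg[of x] by (simp add: \<mu>_def)
    ultimately show ?thesis by (metis Ints_cases of_int_0_le_iff zero_le_imp_eq_int of_int_of_nat_eq)
  qed
  obtain x0 where x0: "x0 \<in> \<R>" "\<And>x. x \<in> \<R> \<Longrightarrow> nat \<lfloor>\<mu> x0\<rfloor> \<le> nat \<lfloor>\<mu> x\<rfloor>"
    using ex_has_least_nat[of "\<lambda>x. x \<in> \<R>" _ "\<lambda>x. nat \<lfloor>\<mu> x\<rfloor>"] \<R>(2) by blast
  have least: "\<mu> x0 \<le> \<mu> x" if "x \<in> \<R>" for x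
    using x0(2)[OF that] nat[OF that] nat[OF x0(1)] by auto
  obtain c0 k0 where c0: "0 < c0" "x0 = comb c0 y k0 a" using par x0(1) by blast
  have norm: "frm y y > 0" using root_norm[OF y] by simp
  have "half x0 \<subseteq> half x" if x: "x \<in> \<R>" for x
  proof -
    obtain c k where c: "0 < c" "x = comb c y k a" using par x by blast
    have \<mu>: "\<mu> v = (v z / c)\<^sup>2 * (p / frm y y)" if "0 < c" "v = comb c y k a" for v c k
    proof -
      have "frm v v = c\<^sup>2 * frm y y" using that(2) by (simp add: frm_comb_left frm_comb_right power2_eq_square)
      then show ?thesis by (simp add: \<mu>_def power_divide)
    qed
    have "(x0 z / c0)\<^sup>2 * (p / frm y y) \<le> (x z / c)\<^sup>2 * (p / frm y y)"
      using least[OF x] \<mu>[OF c] \<mu>[OF c0] by simp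
    then have "(x0 z / c0)\<^sup>2 \<le> (x z / c)\<^sup>2"
      by (rule mult_right_le_imp_le) (use p norm in simp)
    moreover have "0 \<le> x z / c" using pos[OF x] c(1) by (simp add: nonneg_def)
    ultimately have "x0 z / c0 \<le> x z / c" by (rule power2_le_imp_le)
    moreover have "x0 z / c0 = y z + k0 / c0" "x z / c = y z + k / c"
      using c0 c a_z by (simp_all add: field_simps)
    ultimately have le: "0 \<le> k - c * (k0 / c0)" using c(1) by (simp add: field_simps)
    have "x = comb (c / c0) x0 (k - c * (k0 / c0)) a"
    proof
      fix u show "x u = comb (c / c0) x0 (k - c * (k0 / c0)) a u"
        using fun_cong[OF c(2), of u] fun_cong[OF c0(2), of u] c0(1) by (simp add: field_simps)
    qed
    then show ?thesis using half_mono le c(1) c0(1) by simp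
  qed
  then show ?thesis using x0(1) by blast
qed

text \<open>
  If \<open>half x\<close> contains all nonnegative powers of \<open>t i\<close> to the power \<open>\<epsilon> i\<close>, then the shift of \<open>x\<close> by
  this element is not positive. For the root vector \<open>y\<close> of \<open>J\<close> parallel to \<open>x\<close> this says that the
  \<open>i\<close>-th chamber of the gallery lies in \<open>half y\<close> if and only if \<open>\<epsilon> i = 1\<close>. So \<open>y\<close> is the same for
  all \<open>x\<close>.
\<close>

theorem roots_containing_translates:
  fixes ws :: "'w list" and t :: "nat \<Rightarrow> 'w" and \<epsilon> :: "nat \<Rightarrow> int"
  defines "\<R> \<equiv> {x \<in> real_roots S. \<forall>i\<in>{1..length ws}. \<forall>n::nat. t i [^] (\<epsilon> i * int n) \<in> half x}"
  assumes J: "J \<subseteq> S" and ws: "ws \<in> lists J" "ws \<noteq> []"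
    and longest: "\<And>w. w \<in> generate W J \<Longrightarrow> wlen w \<le> wlen (wp ws)"
    and special: "\<And>x. x \<in> real_roots S \<Longrightarrow> \<exists>y\<in>real_roots J. \<exists>c>0. \<exists>k. x = comb c y k a"
    and t: "\<And>i. i \<in> {1..length ws} \<Longrightarrow> translation (t i)"
    and base: "\<And>i s. i \<in> {1..length ws} \<Longrightarrow> s \<in> J \<Longrightarrow> shift (t i) (rep (wp (take i ws)) (basis s)) < 0"
    and \<epsilon>: "\<And>i. i \<in> {1..length ws} \<Longrightarrow> \<epsilon> i \<in> {1, -1}"
  shows "\<R> = {} \<or> (\<exists>x0\<in>\<R>. (\<forall>x\<in>\<R>. half x0 \<subseteq> half x) \<and>
    (\<forall>i\<in>{1..length ws}. of_int (\<epsilon> i) * shift (t i) x0 \<le> 0))"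
proof (cases "\<R> = {}")
  case False
  have one_in: "1 \<in> {1..length ws}" using ws(2) by (simp add: Suc_le_eq)
  have wsS: "ws \<in> lists S" using lists_mono[OF J] ws by blast
  have pow: "rep (inv (t i [^] (\<epsilon> i * int n))) x = comb 1 x (- (of_int (\<epsilon> i) * real n * shift (t i) x)) a"
    if "i \<in> {1..length ws}" "x \<in> real_roots S" for i n x
    using translation_rep[OF translation_inv(1)[OF translation_int_pow(1)[OF t[OF that(1)]]] that(2)]
      translation_inv(2)[OF translation_int_pow(1)[OF t[OF that(1)]] that(2)]
      translation_int_pow(2)[OF t[OF that(1)] that(2)] by simp
  have pos: "nonneg x" if "x \<in> \<R>" for x
  proof -
    have "t 1 [^] (\<epsilon> 1 * int 0) \<in> half x" using that one_in unfolding \<R>_def by blast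
    then show ?thesis using one_in_half by simp
  qed
  have le: "of_int (\<epsilon> i) * shift (t i) x \<le> 0" if x: "x \<in> \<R>" and i: "i \<in> {1..length ws}" for i x
  proof (rule ccontr)
    assume neg: "\<not> ?thesis"
    have xS: "x \<in> real_roots S" using x by (simp add: \<R>_def)
    obtain n :: nat where n: "x z / (of_int (\<epsilon> i) * shift (t i) x) < real n"
      using reals_Archimedean2 by blast
    have "t i [^] (\<epsilon> i * int n) \<in> half x" using x i unfolding \<R>_def by blast
    then have "nonneg (comb 1 x (- (of_int (\<epsilon> i) * real n * shift (t i) x)) a)"
      using pow[OF i xS, of n] by (simp add: half_def)
    then have "0 \<le> x z - of_int (\<epsilon> i) * real n * shift (t i) x"
      unfolding nonneg_def using a_z by (auto dest: spec[of _ z])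
    with n neg show False by (simp add: field_simps)
  qed
  have sides: "wp (take i ws) \<in> half y \<longleftrightarrow> \<epsilon> i = 1"
    if x: "x \<in> \<R>" and y: "y \<in> real_roots J" "0 < c" "x = comb c y k a" and i: "i \<in> {1..length ws}"
    for x y c k i
  proof -
    have u: "wp (take i ws) \<in> generate W J"
      using ws(1) by (intro word_in_generate) (metis append_in_lists_conv append_take_drop_id)
    have "shift (t i) x = c * shift (t i) y" using t[OF i] y(3) by (simp add: shift_comb)
    then have "c * (of_int (\<epsilon> i) * shift (t i) y) \<le> 0" using le[OF x i] by (simp add: algebra_simps)
    then have *: "of_int (\<epsilon> i) * shift (t i) y \<le> 0" using y(2) by (simp add: mult_le_0_iff)
    show ?thesis
    proof (cases "wp (take i ws) \<in> half y")
      case True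
      then have "shift (t i) y < 0" using shift_sign(1)[OF J u t[OF i] base[OF i] y(1)] by blast
      then show ?thesis using * \<epsilon>[OF i] True by auto
    next
      case False
      then have "0 < shift (t i) y" using shift_sign(2)[OF J u t[OF i] base[OF i] y(1)] by blast
      then show ?thesis using * \<epsilon>[OF i] False by auto
    qed
  qed
  obtain x1 where x1: "x1 \<in> \<R>" using False by blast
  obtain y c1 k1 where y: "y \<in> real_roots J" "0 < c1" "x1 = comb c1 y k1 a"
    using special[of x1] x1 by (auto simp: \<R>_def)
  have "\<exists>x0\<in>\<R>. \<forall>x\<in>\<R>. half x0 \<subseteq> half x"
  proof (rule minimal_parallel_root)
    show "y \<in> real_roots S" using y(1) real_roots_mono[OF J] by blast
    show "\<R> \<subseteq> real_roots S" by (auto simp: \<R>_def)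
    show "\<exists>c>0. \<exists>k. x = comb c y k a" if x: "x \<in> \<R>" for x
    proof -
      obtain y' c k where y': "y' \<in> real_roots J" "0 < c" "x = comb c y' k a"
        using special[of x] x by (auto simp: \<R>_def)
      have "y = y'"
        using gallery_sides_determine_root[OF J ws(1) longest y(1) y'(1) ws(2)]
          sides[OF x1 y] sides[OF x y'] by blast
      then show ?thesis using y' by blast
    qed
  qed (use False pos in auto)
  then show ?thesis using le by blast
qed blast

text \<open>
  Elements of the subgroup generated by \<open>J\<close> do not change coordinates outside \<open>J\<close>, whereas the inverse
  of the product of a reduced word makes the simple root of its first letter negative.
\<close>

lemma reduced_word_in_parabolic:
  assumes J: "J \<subseteq> S" and "reduced ws" "wp ws \<in> generate W J"
  shows "ws \<in> lists J"
  using assms(2,3)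
proof (induction ws)
  case (Cons s ws)
  have s: "s \<in> S" and wsS: "ws \<in> lists S" using Cons.prems(1) by (auto simp: reduced_def)
  \<comment> \<open>The inverse of the product makes \<open>basis s\<close> negative without changing coordinates outside \<open>J\<close>.\<close>
  have "reduced (rev ws @ [s])" using reduced_rev[OF Cons.prems(1)] by simp
  from reduced_snocD(2)[OF this] have pos: "nonneg (rep (inv (wp ws)) (basis s))"
    using length_increases_imp_positive[of "inv (wp ws)" s] s wsS by (simp add: wp_rev)
  have "rep (inv (wp (s # ws))) (basis s) = comb (- 1) (rep (inv (wp ws)) (basis s)) 0 a"
    using s wsS rep_basis_flip[of "inv (wp ws)" s] by (simp add: inv_mult_group)
  then have neg: "rep (inv (wp (s # ws))) (basis s) s \<le> 0" using pos by (simp add: nonneg_def)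
  have "s \<in> J"
  proof (rule ccontr)
    assume "s \<notin> J"
    then have "rep (inv (wp (s # ws))) (basis s) s = basis s s"
      using generate_m_inv_closed[OF _ Cons.prems(2)] J gen_closed
      by (intro rep_support[OF _ J]) blast+
    with neg show False by simp
  qed
  moreover have "wp ws \<in> generate W J"
  proof -
    have "s \<otimes> wp (s # ws) \<in> generate W J"
      by (rule generate.eng[OF generate.incl[OF \<open>s \<in> J\<close>] Cons.prems(2)])
    then show ?thesis using s wsS by simp
  qed
  ultimately show ?case using Cons.IH reduced_appendD(2)[of "[s]" ws] Cons.prems(1) by simp
qed simp

end

section \<open>Integral forms on the affine diagrams\<close>

text \<open>
  The edges of the diagram come with an orientation, which \<open>joined\<close> forgets.
\<close>

definition joined :: "cartan_type \<Rightarrow> nat \<Rightarrow> nat \<Rightarrow> bool" where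
  "joined X i j \<longleftrightarrow> (\<exists>m. (i, j, m) \<in> affine_edges X \<or> (j, i, m) \<in> affine_edges X)"

definition edge :: "cartan_type \<Rightarrow> nat \<Rightarrow> nat \<Rightarrow> bool" where
  "edge X i j \<longleftrightarrow> (\<exists>m. (i, j, m) \<in> affine_edges X)"

lemma joined_edge: "joined X i j \<longleftrightarrow> edge X i j \<or> edge X j i"
  by (auto simp: joined_def edge_def)

lemma edge_A: "2 \<le> n \<Longrightarrow> edge (Type_A n) i j \<longleftrightarrow> (1 \<le> i \<and> i < n \<and> j = i + 1) \<or> (i = 0 \<and> (j = 1 \<or> j = n))"
  by (auto simp: edge_def affine_edges_def)

lemma edge_B:
  assumes "3 \<le> n" shows "edge (Type_B n) i j \<longleftrightarrow> (1 \<le> i \<and> i < n \<and> j = i + 1) \<or> (i = 0 \<and> j = 2)"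
proof -
  have "edge (Type_B n) i j \<longleftrightarrow> (1 \<le> i \<and> i + 1 < n \<and> j = i + 1) \<or> (i = n - 1 \<and> j = n) \<or> (i = 0 \<and> j = 2)"
    by (auto simp: edge_def affine_edges_def)
  then show ?thesis using assms by linarith
qed

lemma edge_C:
  assumes "2 \<le> n" shows "edge (Type_C n) i j \<longleftrightarrow> i < n \<and> j = i + 1"
proof -
  have "edge (Type_C n) i j \<longleftrightarrow> (1 \<le> i \<and> i + 1 < n \<and> j = i + 1) \<or> (i = n - 1 \<and> j = n) \<or> (i = 0 \<and> j = 1)"
    by (auto simp: edge_def affine_edges_def)
  then show ?thesis using assms by linarith
qed

lemma edge_D:
  assumes "4 \<le> n"
  shows "edge (Type_D n) i j \<longleftrightarrow> (1 \<le> i \<and> i + 1 < n \<and> j = i + 1) \<or> (i = 0 \<and> j = 2) \<or> (i + 2 = n \<and> j = n)"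
proof -
  have "edge (Type_D n) i j \<longleftrightarrow> (1 \<le> i \<and> i + 1 < n \<and> j = i + 1) \<or> (i = n - 2 \<and> j = n) \<or> (i = 0 \<and> j = 2)"
    by (auto simp: edge_def affine_edges_def)
  then show ?thesis using assms by linarith
qed

lemma edge_E:
  "edge (Type_E n) i j \<longleftrightarrow> (3 \<le> i \<and> i < n \<and> j = i + 1) \<or> (i = 1 \<and> j = 3) \<or> (i = 2 \<and> j = 4) \<or>
     (i = 0 \<and> j = (if n = 6 then 2 else if n = 7 then 1 else 8))"
  by (auto simp: edge_def affine_edges_def)

lemma edge_F4: "edge Type_F4 i j \<longleftrightarrow> i < 4 \<and> j = i + 1"
proof -
  have *: "edge Type_F4 i j \<longleftrightarrow> (i = 0 \<and> j = 1) \<or> (i = 1 \<and> j = 2) \<or> (i = 2 \<and> j = 3) \<or> (i = 3 \<and> j = 4)"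
    by (auto simp: edge_def affine_edges_def)
  show ?thesis
  proof
    assume "i < 4 \<and> j = i + 1"
    moreover from this have "i = 0 \<or> i = 1 \<or> i = 2 \<or> i = 3" by linarith
    ultimately show "edge Type_F4 i j" unfolding * by (elim disjE) simp_all
  qed (unfold *, elim disjE, simp_all)
qed

lemma edge_G2: "edge Type_G2 i j \<longleftrightarrow> j = 2 \<and> (i = 0 \<or> i = 1)"
  by (auto simp: edge_def affine_edges_def)

text \<open>
  The norms of the simple roots. In the types that are not simply laced they are those of a twisted affine
  root system: only the Coxeter diagram matters, and the norms are chosen such that the additional
  node is short. The marks are the coefficients of the null vector for this choice.
\<close>

fun node_norm :: "cartan_type \<Rightarrow> nat \<Rightarrow> real" where
  "node_norm (Type_B n) i = (if i = n then 4 else 2)"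
| "node_norm (Type_C n) i = (if i = 0 \<or> i = n then 2 else 4)"
| "node_norm Type_F4 i = (if 3 \<le> i then 4 else 2)"
| "node_norm Type_G2 i = (if i = 1 then 6 else 2)"
| "node_norm _ i = 2"

fun mark :: "cartan_type \<Rightarrow> nat \<Rightarrow> nat" where
  "mark (Type_B n) i = (if i = 0 \<or> i = 1 \<or> i = n then 1 else 2)"
| "mark (Type_D n) i = (if i = 0 \<or> i = 1 \<or> i = n - 1 \<or> i = n then 1 else 2)"
| "mark (Type_E n) i = (if n = 6 then [1, 1, 2, 2, 3, 2, 1] ! i
     else if n = 7 then [1, 2, 2, 3, 4, 3, 2, 1] ! i else [1, 2, 3, 4, 6, 5, 4, 3, 2] ! i)"
| "mark Type_F4 i = [1, 2, 3, 2, 1] ! i"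
| "mark Type_G2 i = [1, 1, 2] ! i"
| "mark _ i = 1"

definition gram :: "cartan_type \<Rightarrow> nat \<Rightarrow> nat \<Rightarrow> real" where
  "gram X i j = (if i = j then node_norm X i
     else if joined X i j then - max (node_norm X i) (node_norm X j) / 2 else 0)"

lemma valid_E: "valid_cartan_type (Type_E n) \<Longrightarrow> n = 6 \<or> n = 7 \<or> n = 8"
  by auto

lemma joined_sym: "joined X i j \<longleftrightarrow> joined X j i"
  by (auto simp: joined_def)

lemma gram_sym: "gram X i j = gram X j i"
  by (simp add: gram_def joined_sym[of X i j] max.commute)

lemma edge_norms_conj:
  assumes "valid_cartan_type X" "2 \<le> cartan_rank X" "(i, j, m) \<in> affine_edges X"
  shows "i \<le> cartan_rank X \<and> j \<le> cartan_rank X \<and> i \<noteq> j \<and>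
    ((m = 3 \<and> node_norm X i = node_norm X j) \<or>
     (m = 4 \<and> (node_norm X i = 2 * node_norm X j \<or> node_norm X j = 2 * node_norm X i)) \<or>
     (m = 6 \<and> (node_norm X i = 3 * node_norm X j \<or> node_norm X j = 3 * node_norm X i)))"
proof (cases X)
  case (Type_E n)
  then show ?thesis using assms valid_E[of n] by (auto simp: affine_edges_def)
qed (use assms in \<open>auto simp: affine_edges_def split: if_splits\<close>)

lemmas edge_norms = edge_norms_conj[THEN conjunct1] edge_norms_conj[THEN conjunct2, THEN conjunct1]
  edge_norms_conj[THEN conjunct2, THEN conjunct2, THEN conjunct1]
  edge_norms_conj[THEN conjunct2, THEN conjunct2, THEN conjunct2]

lemma node_norm_cases: "node_norm X i \<in> {2, 4, 6}"
  by (cases X) auto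

lemma gram_properties:
  assumes "valid_cartan_type X" "2 \<le> cartan_rank X"
  shows "gram X i j \<in> \<int>" "2 * gram X i j / gram X i i \<in> \<int>" "2 \<le> gram X i i" "i \<noteq> j \<Longrightarrow> gram X i j \<le> 0"
proof -
  show "gram X i j \<in> \<int>" "2 \<le> gram X i i" "i \<noteq> j \<Longrightarrow> gram X i j \<le> 0"
    using node_norm_cases[of X i] node_norm_cases[of X j] by (auto simp: gram_def)
  show "2 * gram X i j / gram X i i \<in> \<int>"
  proof (cases "i \<noteq> j \<and> joined X i j")
    case True
    then obtain m where "(i, j, m) \<in> affine_edges X \<or> (j, i, m) \<in> affine_edges X"
      by (auto simp: joined_def)
    then show ?thesis using edge_norms(4)[OF assms, of i j m] edge_norms(4)[OF assms, of j i m] True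
        node_norm_cases[of X i] by (auto simp: gram_def)
  next
    case False
    then show ?thesis using node_norm_cases[of X i] by (auto simp: gram_def)
  qed
qed

lemma gram_edge:
  assumes "valid_cartan_type X" "2 \<le> cartan_rank X" "(i, j, m) \<in> affine_edges X"
  shows "(m, 4 * (gram X i j)\<^sup>2 / (gram X i i * gram X j j)) \<in> {(2, 0), (3, 1), (4, 2), (6, 3)}"
proof -
  define u v where "u = node_norm X i" and "v = node_norm X j"
  have pos: "0 < u" "0 < v" using node_norm_cases[of X i] node_norm_cases[of X j] by (auto simp: u_def v_def)
  have "joined X i j" using assms(3) by (auto simp: joined_def)
  then have "4 * (gram X i j)\<^sup>2 / (gram X i i * gram X j j) = (max u v)\<^sup>2 / (u * v)"
    using edge_norms(3)[OF assms] by (simp add: gram_def u_def v_def power_divide)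
  moreover from edge_norms(4)[OF assms] have "(m, (max u v)\<^sup>2 / (u * v)) \<in> {(2, 0), (3, 1), (4, 2), (6, 3)}"
    unfolding u_def[symmetric] v_def[symmetric]
    using pos by (elim disjE conjE) (simp_all add: power2_eq_square)
  ultimately show ?thesis by simp
qed

lemma gram_nonedge: "i \<noteq> j \<Longrightarrow> \<not> joined X i j \<Longrightarrow> gram X i j = 0"
  by (simp add: gram_def)

text \<open>
  A row of the Gram matrix only involves the neighbours \<open>N\<close> of the node.
\<close>

lemma gram_row:
  assumes "i \<le> n" "N \<subseteq> {0..n} - {i}" "\<And>j. j \<le> n \<Longrightarrow> j \<noteq> i \<Longrightarrow> joined X i j \<longleftrightarrow> j \<in> N"
    and "node_norm X i * mark X i = (\<Sum>j\<in>N. max (node_norm X i) (node_norm X j) / 2 * mark X j)"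
  shows "(\<Sum>j\<in>{0..n}. gram X i j * mark X j) = 0"
proof -
  have "(\<Sum>j\<in>{0..n}. gram X i j * mark X j) =
      gram X i i * mark X i + (\<Sum>j\<in>{0..n} - {i}. gram X i j * mark X j)"
    using assms(1) by (simp add: sum.remove)
  also have "(\<Sum>j\<in>{0..n} - {i}. gram X i j * mark X j) = (\<Sum>j\<in>N. gram X i j * mark X j)"
    using assms(2,3) by (intro sum.mono_neutral_right) (auto simp: gram_def)
  also have "\<dots> = (\<Sum>j\<in>N. - (max (node_norm X i) (node_norm X j) / 2 * mark X j))"
    using assms(2,3) by (intro sum.cong) (auto simp: gram_def)
  also have "\<dots> = - (node_norm X i * mark X i)" by (simp add: assms(4) sum_negf)
  finally show ?thesis by (simp add: gram_def)
qed

lemma gram_null: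
  assumes "valid_cartan_type X" "2 \<le> cartan_rank X" "i \<le> cartan_rank X"
  shows "(\<Sum>j\<in>{0..cartan_rank X}. gram X i j * mark X j) = 0"
proof (cases X)
  case (Type_A n)
  then have n: "2 \<le> n" "i \<le> n" using assms by auto
  have j: "joined (Type_A n) i j \<longleftrightarrow> edge (Type_A n) i j \<or> edge (Type_A n) j i" for i j
    by (rule joined_edge)
  note j = j[unfolded edge_A[OF n(1)]]
  consider "i = 0" | "i = n" | "1 \<le> i" "i < n" using n by linarith
  then show ?thesis
  proof cases
    case 1 show ?thesis unfolding Type_A cartan_rank.simps
      by (rule gram_row[where N = "{1, n}"]; use 1 n in \<open>(simp add: j; arith) | auto simp: j\<close>)
  next
    case 2 show ?thesis unfolding Type_A cartan_rank.simps
      by (rule gram_row[where N = "{0, n - 1}"]; use 2 n in \<open>(simp add: j; arith) | auto simp: j\<close>)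
  next
    case 3 show ?thesis unfolding Type_A cartan_rank.simps
      by (rule gram_row[where N = "{i - 1, i + 1}"]; use 3 n in \<open>(simp add: j; arith) | auto simp: j\<close>)
  qed
next
  case (Type_B n)
  then have n: "3 \<le> n" "i \<le> n" using assms by auto
  have j: "joined (Type_B n) i j \<longleftrightarrow> edge (Type_B n) i j \<or> edge (Type_B n) j i" for i j
    by (rule joined_edge)
  note j = j[unfolded edge_B[OF n(1)]]
  consider "i = 0" | "i = 1" | "i = 2" | "i = n" | "3 \<le> i" "i < n" using n by linarith
  then show ?thesis
  proof cases
    case 1 show ?thesis unfolding Type_B cartan_rank.simps
      by (rule gram_row[where N = "{2}"]; use 1 n in \<open>(simp add: j; arith) | auto simp: j\<close>)
  next
    case 2 show ?thesis unfolding Type_B cartan_rank.simps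
      by (rule gram_row[where N = "{2}"]; use 2 n in \<open>(simp add: j; arith) | auto simp: j\<close>)
  next
    case 3 show ?thesis unfolding Type_B cartan_rank.simps
      by (rule gram_row[where N = "{0, 1, 3}"]; use 3 n in \<open>(simp add: j; arith) | auto simp: j\<close>)
  next
    case 4 show ?thesis unfolding Type_B cartan_rank.simps
      by (rule gram_row[where N = "{n - 1}"]; use 4 n in \<open>(simp add: j; arith) | auto simp: j\<close>)
  next
    case 5 show ?thesis unfolding Type_B cartan_rank.simps
      by (rule gram_row[where N = "{i - 1, i + 1}"]; use 5 n in \<open>(simp add: j; arith) | auto simp: j\<close>)
  qed
next
  case (Type_C n)
  then have n: "2 \<le> n" "i \<le> n" using assms by auto
  have j: "joined (Type_C n) i j \<longleftrightarrow> edge (Type_C n) i j \<or> edge (Type_C n) j i" for i j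
    by (rule joined_edge)
  note j = j[unfolded edge_C[OF n(1)]]
  consider "i = 0" | "i = n" | "1 \<le> i" "i < n" using n by linarith
  then show ?thesis
  proof cases
    case 1 show ?thesis unfolding Type_C cartan_rank.simps
      by (rule gram_row[where N = "{1}"]; use 1 n in \<open>(simp add: j; arith) | auto simp: j\<close>)
  next
    case 2 show ?thesis unfolding Type_C cartan_rank.simps
      by (rule gram_row[where N = "{n - 1}"]; use 2 n in \<open>(simp add: j; arith) | auto simp: j\<close>)
  next
    case 3 show ?thesis unfolding Type_C cartan_rank.simps
      by (rule gram_row[where N = "{i - 1, i + 1}"]; use 3 n in \<open>(simp add: j; arith) | auto simp: j\<close>)
  qed
next
  case (Type_D n)
  then have n: "4 \<le> n" "i \<le> n" using assms by auto
  have j: "joined (Type_D n) i j \<longleftrightarrow> edge (Type_D n) i j \<or> edge (Type_D n) j i" for i j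
    by (rule joined_edge)
  note j = j[unfolded edge_D[OF n(1)]]
  consider "i = 0" | "i = 1" | "i = n" | "i + 1 = n" | "i = 2" "n = 4" | "i = 2" "4 < n" | "4 < n" "i + 2 = n" | "3 \<le> i" "i + 2 < n"
    using n by linarith
  then show ?thesis
  proof cases
    case 1 show ?thesis unfolding Type_D cartan_rank.simps
      by (rule gram_row[where N = "{2}"]; use 1 n in \<open>(simp add: j; arith) | auto simp: j\<close>)
  next
    case 2 show ?thesis unfolding Type_D cartan_rank.simps
      by (rule gram_row[where N = "{2}"]; use 2 n in \<open>(simp add: j; arith) | auto simp: j\<close>)
  next
    case 3 show ?thesis unfolding Type_D cartan_rank.simps
      by (rule gram_row[where N = "{n - 2}"]; use 3 n in \<open>(simp add: j; arith) | auto simp: j\<close>)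
  next
    case 4 show ?thesis unfolding Type_D cartan_rank.simps
      by (rule gram_row[where N = "{n - 2}"]; use 4 n in \<open>(simp add: j; arith) | auto simp: j\<close>)
  next
    case 5 show ?thesis unfolding Type_D cartan_rank.simps
      by (rule gram_row[where N = "{0, 1, 3, 4}"]; use 5 n in \<open>auto simp: joined_edge edge_D\<close>)
  next
    case 6 show ?thesis unfolding Type_D cartan_rank.simps
      by (rule gram_row[where N = "{0, 1, 3}"]; use 6 n in \<open>(simp add: j; arith) | auto simp: j\<close>)
  next
    case 7
    then have m: "i = (i - 3) + 3" "n = (i - 3) + 5" by simp_all
    define m where "m = i - 3"
    have "i = m + 3" "n = m + 5" using m by (simp_all add: m_def)
    then show ?thesis unfolding Type_D cartan_rank.simps
      by (intro gram_row[where N = "{m + 2, m + 4, m + 5}"]) (auto simp: joined_edge edge_D)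
  next
    case 8 show ?thesis unfolding Type_D cartan_rank.simps
      by (rule gram_row[where N = "{i - 1, i + 1}"]; use 8 n in \<open>(simp add: j; arith) | auto simp: j\<close>)
  qed
next
  case (Type_E n)
  have n: "n = 6 \<or> n = 7 \<or> n = 8" using assms(1) Type_E valid_E by blast
  have "i \<in> {0, 1, 2, 3, 4, 5, 6, 7, 8}" using assms(3) n Type_E by auto
  then show ?thesis
    using n assms(3) by (elim disjE insertE) (simp_all add: gram_def joined_edge edge_E Type_E numeral_eq_Suc)
next
  case Type_F4
  have "i \<in> {0, 1, 2, 3, 4}" using assms(3) Type_F4 by auto
  then show ?thesis
    by (elim insertE) (simp_all add: gram_def joined_edge edge_F4 Type_F4 numeral_eq_Suc)
next
  case Type_G2
  have "i \<in> {0, 1, 2}" using assms(3) Type_G2 by auto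
  then show ?thesis
    by (elim insertE) (simp_all add: gram_def joined_edge edge_G2 Type_G2 numeral_eq_Suc)
qed

lemma mark_pos:
  assumes "valid_cartan_type X" "i \<le> cartan_rank X" shows "0 < mark X i"
proof (cases X)
  case (Type_E n)
  then have "n = 6 \<or> n = 7 \<or> n = 8" "i \<in> {0, 1, 2, 3, 4, 5, 6, 7, 8}" using assms by auto
  with assms(2) show ?thesis by (elim disjE insertE) (simp_all add: Type_E)
next
  case Type_F4
  then have "i \<in> {0, 1, 2, 3, 4}" using assms by auto
  with assms(2) show ?thesis by (elim insertE) (simp_all add: Type_F4)
next
  case Type_G2
  then have "i \<in> {0, 1, 2}" using assms by auto
  with assms(2) show ?thesis by (elim insertE) (simp_all add: Type_G2)
qed auto

lemma node_zero:
  assumes "valid_cartan_type X" "2 \<le> cartan_rank X" shows "node_norm X 0 = 2" "mark X 0 = 1"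
  using assms by (cases X; auto)+

lemma diagram_connected:
  assumes "valid_cartan_type X" "2 \<le> cartan_rank X" "0 \<in> A"
    and closed: "\<And>i j. i \<in> A \<Longrightarrow> j \<le> cartan_rank X \<Longrightarrow> joined X i j \<Longrightarrow> j \<in> A"
    and i: "i \<le> cartan_rank X"
  shows "i \<in> A"
proof -
  have edge: "j \<in> A" if "(i, j, m) \<in> affine_edges X \<or> (j, i, m) \<in> affine_edges X" "i \<in> A" for i j m
    using that closed[of i j] edge_norms[OF assms(1,2), of i j m] edge_norms[OF assms(1,2), of j i m]
    by (auto simp: joined_def)
  have chain: "j \<in> A"
    if "l \<le> j" "j \<le> r" "l \<in> A" "\<And>j. l \<le> j \<Longrightarrow> j < r \<Longrightarrow> \<exists>m. (j, j + 1, m) \<in> affine_edges X" for l r j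
    using that(1,2)
  proof (induction j rule: dec_induct)
    case (step j)
    then show ?case using that(4)[of j] edge[of j "j + 1"] by auto
  qed (rule that(3))
  show ?thesis
  proof (cases X)
    case (Type_A n)
    have "1 \<in> A" using edge[of 0 1 3] assms by (auto simp: affine_edges_def Type_A)
    from chain[OF _ _ this, of i n] show ?thesis
      using i assms(3) Type_A by (cases "i = 0") (auto simp: affine_edges_def)
  next
    case (Type_B n)
    have 2: "2 \<in> A" using edge[of 0 2 3] assms by (auto simp: affine_edges_def Type_B)
    then have 1: "1 \<in> A" using edge[of 2 1 3] assms by (auto simp: affine_edges_def Type_B)
    have "\<exists>m. (j, j + 1, m) \<in> affine_edges X" if "2 \<le> j" "j < n" for j
      using that by (cases "j + 1 = n") (auto simp: affine_edges_def Type_B)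
    from chain[OF _ _ 2 this, of i n] show ?thesis
      using i assms(3) 1 2 Type_B by (cases "i = 0"; cases "i = 1") auto
  next
    case (Type_C n)
    have 1: "1 \<in> A" using edge[of 0 1 4] assms by (auto simp: affine_edges_def Type_C)
    have "\<exists>m. (j, j + 1, m) \<in> affine_edges X" if "1 \<le> j" "j < n" for j
      using that by (cases "j + 1 = n") (auto simp: affine_edges_def Type_C)
    from chain[OF _ _ 1 this, of i n] show ?thesis
      using i assms(3) Type_C by (cases "i = 0") auto
  next
    case (Type_D n)
    have n: "4 \<le> n" using assms Type_D by simp
    have 2: "2 \<in> A" using edge[of 0 2 3] assms by (auto simp: affine_edges_def Type_D)
    then have 1: "1 \<in> A" using edge[of 2 1 3] assms by (auto simp: affine_edges_def Type_D)
    have "\<exists>m. (j, j + 1, m) \<in> affine_edges X" if "2 \<le> j" "j < n - 1" for j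
      using that by (auto simp: affine_edges_def Type_D)
    note mid = chain[OF _ _ 2 this, of _ "n - 1"]
    have "n - 2 \<in> A" using mid[of "n - 2"] n by simp
    then have "n \<in> A" using edge[of "n - 2" n 3] by (auto simp: affine_edges_def Type_D)
    with mid[of i] show ?thesis
      using i assms(3) 1 2 Type_D by (cases "i = 0"; cases "i = 1"; cases "i = n") auto
  next
    case (Type_E n)
    have n: "n = 6 \<or> n = 7 \<or> n = 8" using assms(1) Type_E valid_E by blast
    have "i \<in> {0, 1, 2, 3, 4, 5, 6, 7, 8}" using i n Type_E by auto
    have up: "(j, j + 1, 3) \<in> affine_edges X" if "3 \<le> j" "j < n" for j
      using that by (auto simp: affine_edges_def Type_E)
    have es: "(1, 3, 3) \<in> affine_edges X" "(2, 4, 3) \<in> affine_edges X" by (auto simp: affine_edges_def Type_E)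
    have 34: "3 \<in> A \<longleftrightarrow> 4 \<in> A" and 13: "1 \<in> A \<longleftrightarrow> 3 \<in> A" and 24: "2 \<in> A \<longleftrightarrow> 4 \<in> A"
      using edge[of 3 4 3] edge[of 4 3 3] edge[of 1 3 3] edge[of 3 1 3] edge[of 2 4 3] edge[of 4 2 3] up[of 3] es n
      by auto
    have "3 \<in> A"
    proof -
      consider "n = 6" | "n = 7" | "n = 8" using n by blast
      then show ?thesis
      proof cases
        case 1
        then have "2 \<in> A" using edge[of 0 2 3] assms(3) by (auto simp: affine_edges_def Type_E)
        with 34 24 show ?thesis by simp
      next
        case 2
        then have "1 \<in> A" using edge[of 0 1 3] assms(3) by (auto simp: affine_edges_def Type_E)
        with 13 show ?thesis by simp
      next
        case 3
        then have "8 \<in> A" using edge[of 0 8 3] assms(3) by (auto simp: affine_edges_def Type_E)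
        then have "7 \<in> A" using edge[of 8 7 3] up[of 7] 3 by simp
        then have "6 \<in> A" using edge[of 7 6 3] up[of 6] 3 by simp
        then have "5 \<in> A" using edge[of 6 5 3] up[of 5] 3 by simp
        then have "4 \<in> A" using edge[of 5 4 3] up[of 4] 3 by simp
        with 34 show ?thesis by simp
      qed
    qed
    from chain[OF _ _ this, of i n] up have "3 \<le> i \<Longrightarrow> i \<in> A" using i Type_E by auto
    moreover have "i = 0 \<or> i = 1 \<or> i = 2 \<or> 3 \<le> i" by linarith
    ultimately show ?thesis using \<open>3 \<in> A\<close> 34 13 24 assms(3) by auto
  next
    case Type_F4
    have "\<exists>m. (j, j + 1, m) \<in> affine_edges X" if "j < 4" for j
      using that by (auto simp: affine_edges_def Type_F4 less_Suc_eq numeral_eq_Suc)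
    from chain[OF _ _ assms(3) this, of i 4] show ?thesis using i Type_F4 by auto
  next
    case Type_G2
    have 2: "2 \<in> A" using edge[of 0 2 3] assms by (auto simp: affine_edges_def Type_G2)
    then have "1 \<in> A" using edge[of 2 1 6] assms by (auto simp: affine_edges_def Type_G2)
    moreover have "i = 0 \<or> i = 1 \<or> i = 2" using i Type_G2 by auto
    ultimately show ?thesis using 2 assms(3) by auto
  qed
qed

text \<open>
  The two products are conjugate.
\<close>

lemma (in group) ord_mult_commute:
  assumes "x \<in> carrier G" "y \<in> carrier G" shows "ord (x \<otimes> y) = ord (y \<otimes> x)"
proof -
  have "ord (y \<otimes> x) dvd ord (x \<otimes> y)" if "x \<in> carrier G" "y \<in> carrier G" for x y
  proof -
    have "(y \<otimes> x) [^] Suc n = y \<otimes> (x \<otimes> y) [^] n \<otimes> x" for n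
    proof (induction n)
      case (Suc n)
      have "(y \<otimes> x) [^] Suc (Suc n) = (y \<otimes> (x \<otimes> y) [^] n \<otimes> x) \<otimes> (y \<otimes> x)" using Suc by simp
      also have "\<dots> = y \<otimes> (x \<otimes> y) [^] Suc n \<otimes> x" using that by (simp add: m_assoc)
      finally show ?case .
    qed (use that in simp)
    then have "(y \<otimes> x) [^] ord (x \<otimes> y) \<otimes> (y \<otimes> x) = y \<otimes> x"
      using that by simp
    then show ?thesis using that pow_eq_id by (simp add: r_cancel_one)
  qed
  with assms show ?thesis by (meson dvd_antisym)
qed

text \<open>
  The role of \<open>z\<close> is played by the additional node of the affine diagram. The special vertex \<open>p\<close>
  may be another one, but removing either of them leaves a diagram of the same spherical type.
\<close>

lemma affine_diagram_coxeter:
  fixes W :: "('w, 'm) monoid_scheme" (structure)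
  assumes cox: "coxeter_system W S" and X: "valid_cartan_type X" "2 \<le> cartan_rank X"
    and diag: "has_diagram W S {0..cartan_rank X} (affine_edges X)"
    and special: "p \<in> S" "has_diagram W (S - {p}) {1..cartan_rank X} (spherical_edges X)"
  obtains b a z \<eta> where "affine_coxeter W S b a z" "bij_betw \<eta> (S - {z}) (S - {p})"
    "\<And>s t. \<lbrakk>s \<in> S - {z}; t \<in> S - {z}; s \<noteq> t\<rbrakk> \<Longrightarrow> group.ord W (\<eta> s \<otimes> \<eta> t) = group.ord W (s \<otimes> t)"
proof -
  interpret group W using cox by (simp add: coxeter_system_def)
  interpret coxeter W S by unfold_locales (rule cox)
  define n where "n = cartan_rank X"
  obtain \<phi> where \<phi>: "bij_betw \<phi> {0..n} S"
    and edge: "\<And>i j m. (i, j, m) \<in> affine_edges X \<Longrightarrow> ord (\<phi> i \<otimes> \<phi> j) = m"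
    and nonedge: "\<And>i j. i \<in> {0..n} \<Longrightarrow> j \<in> {0..n} \<Longrightarrow> i \<noteq> j \<Longrightarrow> \<not> joined X i j \<Longrightarrow> ord (\<phi> i \<otimes> \<phi> j) = 2"
    using diag unfolding has_diagram_def joined_def n_def by fast
  obtain \<chi> where \<chi>: "bij_betw \<chi> {1..n} (S - {p})"
    and sedge: "\<And>i j m. (i, j, m) \<in> spherical_edges X \<Longrightarrow> ord (\<chi> i \<otimes> \<chi> j) = m"
    and snonedge: "\<And>i j. i \<in> {1..n} \<Longrightarrow> j \<in> {1..n} \<Longrightarrow> i \<noteq> j \<Longrightarrow>
      \<nexists>m. (i, j, m) \<in> spherical_edges X \<or> (j, i, m) \<in> spherical_edges X \<Longrightarrow> ord (\<chi> i \<otimes> \<chi> j) = 2"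
    using special(2) unfolding has_diagram_def n_def by fast
  define ix where "ix = the_inv_into {0..n} \<phi>"
  have ix: "ix s \<in> {0..n}" "\<phi> (ix s) = s" if "s \<in> S" for s
    using that \<phi> the_inv_into_into[of \<phi> "{0..n}" s "{0..n}"] f_the_inv_into_f[of \<phi> "{0..n}" s]
    by (auto simp: ix_def bij_betw_def)
  have ix_\<phi>: "ix (\<phi> i) = i" if "i \<in> {0..n}" for i
    using that \<phi> by (simp add: ix_def bij_betw_def the_inv_into_f_f)
  have bij_ix: "bij_betw ix S {0..n}" unfolding ix_def using \<phi> by (rule bij_betw_the_inv_into)
  have \<phi>S: "\<phi> i \<in> S" if "i \<in> {0..n}" for i using that \<phi> by (auto simp: bij_betw_def)
  define b where "b s t = gram X (ix s) (ix t)" for s t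
  define a where "a s = (if s \<in> S then real (mark X (ix s)) else 0)" for s
  have ix_le: "ix s \<le> cartan_rank X" if "s \<in> S" for s using ix(1)[OF that] by (simp add: n_def)
  have ix_inj: "ix s = ix t \<longleftrightarrow> s = t" if "s \<in> S" "t \<in> S" for s t using ix(2) that by metis
  have "affine_coxeter W S b a (\<phi> 0)"
  proof unfold_locales
    show "finite S" using \<phi> bij_betw_finite by blast
    show "b s t = b t s" for s t by (simp add: b_def gram_sym)
    show "b s t \<in> \<int>" "2 * b s t / b s s \<in> \<int>" "2 \<le> b s s" for s t
      unfolding b_def using gram_properties[OF X] by auto
    show "b s t \<le> 0" if "s \<in> S" "t \<in> S" "s \<noteq> t" for s t
      unfolding b_def using gram_properties[OF X] ix_inj that by auto
    show "(ord (s \<otimes> t), 4 * (b s t)\<^sup>2 / (b s s * b t t)) \<in> {(2, 0), (3, 1), (4, 2), (6, 3)}"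
      if st: "s \<in> S" "t \<in> S" "s \<noteq> t" for s t
    proof (cases "joined X (ix s) (ix t)")
      case True
      then obtain m where "(ix s, ix t, m) \<in> affine_edges X \<or> (ix t, ix s, m) \<in> affine_edges X"
        by (auto simp: joined_def)
      then show ?thesis
      proof
        assume *: "(ix s, ix t, m) \<in> affine_edges X"
        show ?thesis using gram_edge[OF X *] edge[OF *] ix st by (simp add: b_def)
      next
        assume *: "(ix t, ix s, m) \<in> affine_edges X"
        show ?thesis using gram_edge[OF X *] edge[OF *] ix st ord_mult_commute[of s t]
          by (simp add: b_def gram_sym mult.commute)
      qed
    next
      case False
      then show ?thesis using nonedge[of "ix s" "ix t"] ix st ix_inj
        by (simp add: b_def gram_nonedge)
    qed
    show "a s = 0" if "s \<notin> S" for s using that by (simp add: a_def)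
    show "0 < a s" "a s \<in> \<int>" if "s \<in> S" for s
      using that mark_pos[OF X(1) ix_le] by (auto simp: a_def)
    show "(\<Sum>t\<in>S. b s t * a t) = 0" if "s \<in> S" for s
    proof -
      have "(\<Sum>t\<in>S. b s t * a t) = (\<Sum>t\<in>S. gram X (ix s) (ix t) * mark X (ix t))"
        by (intro sum.cong) (auto simp: b_def a_def)
      also have "\<dots> = (\<Sum>j\<in>{0..n}. gram X (ix s) j * mark X j)"
        by (rule sum.reindex_bij_betw[OF bij_ix])
      finally show ?thesis using gram_null[OF X ix_le[OF that]] by (simp add: n_def)
    qed
    show "\<phi> 0 \<in> S" "b (\<phi> 0) (\<phi> 0) = 2" "a (\<phi> 0) = 1"
      using node_zero[OF X] \<phi>S[of 0] ix_\<phi>[of 0] by (auto simp: b_def a_def gram_def)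
    show "A = S"
      if A: "A \<subseteq> S" "\<phi> 0 \<in> A" "\<And>s t. s \<in> A \<Longrightarrow> t \<in> S \<Longrightarrow> b s t \<noteq> 0 \<Longrightarrow> t \<in> A" for A
    proof
      show "S \<subseteq> A"
      proof
        fix s assume s: "s \<in> S"
        have "ix s \<in> {i \<in> {0..n}. \<phi> i \<in> A}"
        proof (rule diagram_connected[OF X _ _ ix_le[OF s]])
          fix i j assume ij: "i \<in> {i \<in> {0..n}. \<phi> i \<in> A}" "j \<le> cartan_rank X" "joined X i j"
          have "gram X i j \<noteq> 0" using ij(3) node_norm_cases[of X i] node_norm_cases[of X j] by (auto simp: gram_def)
          then have "\<phi> j \<in> A" using A(3)[of "\<phi> i" "\<phi> j"] ij \<phi>S ix_\<phi> by (auto simp: b_def n_def)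
          then show "j \<in> {i \<in> {0..n}. \<phi> i \<in> A}" using ij(2) by (simp add: n_def)
        qed (use A(2) in auto)
        then show "s \<in> A" using ix(2)[OF s] by simp
      qed
    qed (rule A(1))
  qed
  moreover have ix_bij1: "bij_betw ix (S - {\<phi> 0}) {1..n}"
  proof -
    have "bij_betw ix (S - {\<phi> 0}) ({0..n} - {ix (\<phi> 0)})"
      using bij_betw_DiffI[OF bij_ix, of "{\<phi> 0}" "{ix (\<phi> 0)}"] \<phi>S[of 0] ix_\<phi>[of 0] by simp
    moreover have "{0..n} - {ix (\<phi> 0)} = {1..n}" using ix_\<phi>[of 0] by auto
    ultimately show ?thesis by simp
  qed
  moreover have "bij_betw (\<chi> \<circ> ix) (S - {\<phi> 0}) (S - {p})"
    using bij_betw_trans[OF ix_bij1 \<chi>] .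
  moreover have "ord ((\<chi> \<circ> ix) s \<otimes> (\<chi> \<circ> ix) t) = ord (s \<otimes> t)"
    if st: "s \<in> S - {\<phi> 0}" "t \<in> S - {\<phi> 0}" "s \<noteq> t" for s t
  proof -
    have i: "ix s \<in> {1..n}" "ix t \<in> {1..n}" using st ix_bij1 by (auto simp: bij_betw_def)
    have \<chi>S: "\<chi> (ix s) \<in> carrier W" "\<chi> (ix t) \<in> carrier W"
      using bij_betwE[OF \<chi>] i gen_closed by blast+
    have ne: "ix s \<noteq> ix t" using st ix_inj by auto
    have ext: "i = 0" if "(i, j, m) \<in> extending_edges X" for i j m
      using that by (cases X) (auto split: if_splits)
    show ?thesis
    proof (cases "joined X (ix s) (ix t)")
      case True
      then obtain m where "(ix s, ix t, m) \<in> affine_edges X \<or> (ix t, ix s, m) \<in> affine_edges X"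
        by (auto simp: joined_def)
      then have m: "(ix s, ix t, m) \<in> spherical_edges X \<or> (ix t, ix s, m) \<in> spherical_edges X"
        using ext[of "ix s" "ix t" m] ext[of "ix t" "ix s" m] i by (auto simp: affine_edges_def)
      then show ?thesis
      proof
        assume *: "(ix s, ix t, m) \<in> spherical_edges X"
        then show ?thesis using sedge[OF *] edge[of "ix s" "ix t" m] ix st by (simp add: affine_edges_def)
      next
        assume *: "(ix t, ix s, m) \<in> spherical_edges X"
        then show ?thesis
          using sedge[OF *] edge[of "ix t" "ix s" m] ix st ord_mult_commute[of s t] ord_mult_commute[OF \<chi>S]
          by (simp add: affine_edges_def)
      qed
    next
      case False
      then show ?thesis
        using snonedge[OF i ne] nonedge[of "ix s" "ix t"] i ne ix st
        by (auto simp: joined_def affine_edges_def)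
    qed
  qed
  ultimately show ?thesis using that by blast
qed

section \<open>Apartments are Coxeter complexes\<close>

locale weyl_building =
  fixes \<Delta> :: "('w, 'c) w_metric"
  assumes bldg: "building \<Delta>"

sublocale weyl_building \<subseteq> coxeter "weyl \<Delta>" "gens \<Delta>"
proof -
  have "coxeter_system (weyl \<Delta>) (gens \<Delta>)" using bldg by (simp add: building_def)
  then interpret group "weyl \<Delta>" by (simp add: coxeter_system_def)
  show "coxeter (weyl \<Delta>) (gens \<Delta>)" by unfold_locales fact
qed

context weyl_building
begin

abbreviation W where "W \<equiv> weyl \<Delta>"
abbreviation S where "S \<equiv> gens \<Delta>"
abbreviation C where "C \<equiv> chambers \<Delta>"
abbreviation \<delta> where "\<delta> \<equiv> wdist \<Delta>"
abbreviation wmult (infixl "\<cdot>" 70) where "x \<cdot> y \<equiv> x \<otimes>\<^bsub>weyl \<Delta>\<^esub> y"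

lemma dist_closed [simp]: "x \<in> C \<Longrightarrow> y \<in> C \<Longrightarrow> \<delta> x y \<in> carrier W"
  and dist_one_iff: "x \<in> C \<Longrightarrow> y \<in> C \<Longrightarrow> \<delta> x y = \<one>\<^bsub>W\<^esub> \<longleftrightarrow> x = y"
  and dist_step: "\<lbrakk>x \<in> C; y \<in> C; y' \<in> C; s \<in> S; \<delta> y y' = s\<rbrakk> \<Longrightarrow> \<delta> x y' \<in> {\<delta> x y, \<delta> x y \<cdot> s}"
  and dist_step_up: "\<lbrakk>x \<in> C; y \<in> C; y' \<in> C; s \<in> S; \<delta> y y' = s; wlen (\<delta> x y \<cdot> s) = wlen (\<delta> x y) + 1\<rbrakk>
    \<Longrightarrow> \<delta> x y' = \<delta> x y \<cdot> s"
  and dist_ex: "\<lbrakk>x \<in> C; y \<in> C; s \<in> S\<rbrakk> \<Longrightarrow> \<exists>y'\<in>C. \<delta> y y' = s \<and> \<delta> x y' = \<delta> x y \<cdot> s"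
proof -
  have ax1: "\<forall>x\<in>C. \<forall>y\<in>C. \<delta> x y \<in> carrier W"
    using bldg unfolding building_def by (elim conjE) assumption
  have ax2: "\<forall>x\<in>C. \<forall>y\<in>C. \<delta> x y = \<one>\<^bsub>W\<^esub> \<longleftrightarrow> x = y"
    using bldg unfolding building_def by (elim conjE) assumption
  have ax3: "\<forall>x\<in>C. \<forall>y\<in>C. \<forall>y'\<in>C. \<forall>s\<in>S. \<delta> y y' = s \<longrightarrow>
      \<delta> x y' \<in> {\<delta> x y, \<delta> x y \<cdot> s} \<and>
      (wlen (\<delta> x y \<cdot> s) = wlen (\<delta> x y) + 1 \<longrightarrow> \<delta> x y' = \<delta> x y \<cdot> s)"
    using bldg unfolding building_def by (elim conjE) assumption
  have ax4: "\<forall>x\<in>C. \<forall>y\<in>C. \<forall>s\<in>S. \<exists>y'\<in>C. \<delta> y y' = s \<and> \<delta> x y' = \<delta> x y \<cdot> s"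
    using bldg unfolding building_def by (elim conjE) assumption
  show "x \<in> C \<Longrightarrow> y \<in> C \<Longrightarrow> \<delta> x y \<in> carrier W" using ax1 by blast
  show "x \<in> C \<Longrightarrow> y \<in> C \<Longrightarrow> \<delta> x y = \<one>\<^bsub>W\<^esub> \<longleftrightarrow> x = y" using ax2 by blast
  show "\<lbrakk>x \<in> C; y \<in> C; y' \<in> C; s \<in> S; \<delta> y y' = s\<rbrakk> \<Longrightarrow> \<delta> x y' \<in> {\<delta> x y, \<delta> x y \<cdot> s}"
    using ax3 by blast
  show "\<lbrakk>x \<in> C; y \<in> C; y' \<in> C; s \<in> S; \<delta> y y' = s; wlen (\<delta> x y \<cdot> s) = wlen (\<delta> x y) + 1\<rbrakk>
    \<Longrightarrow> \<delta> x y' = \<delta> x y \<cdot> s" using ax3 by blast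
  show "\<lbrakk>x \<in> C; y \<in> C; s \<in> S\<rbrakk> \<Longrightarrow> \<exists>y'\<in>C. \<delta> y y' = s \<and> \<delta> x y' = \<delta> x y \<cdot> s"
    using ax4 by blast
qed

lemma dist_self [simp]: "x \<in> C \<Longrightarrow> \<delta> x x = \<one>\<^bsub>W\<^esub>"
  by (simp add: dist_one_iff)

lemma adjacent_sym:
  assumes "x \<in> C" "y \<in> C" "s \<in> S" "\<delta> x y = s" shows "\<delta> y x = s"
proof -
  have ne: "\<delta> y x \<noteq> \<one>\<^bsub>W\<^esub>"
  proof
    assume "\<delta> y x = \<one>\<^bsub>W\<^esub>"
    then have "y = x" using dist_one_iff assms(1,2) by blast
    then have "s = \<one>\<^bsub>W\<^esub>" using dist_one_iff assms by blast
    then show False using gen_neq_one[OF assms(3)] by contradiction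
  qed
  have "\<delta> y y \<in> {\<delta> y x, \<delta> y x \<cdot> s}"
    by (rule dist_step[OF assms(2,1,2,3,4)])
  then have "\<delta> y x \<cdot> s = \<one>\<^bsub>W\<^esub>" using ne dist_one_iff[OF assms(2,2)] by fastforce
  from inv_equality[OF this] have "\<delta> y x = inv\<^bsub>W\<^esub> s" using assms(1-3) by simp
  then show ?thesis using assms(3) by simp
qed

lemma gallery_length: "gallery \<Delta> xs \<Longrightarrow> wlen (\<delta> (hd xs) (last xs)) + 1 \<le> length xs"
proof (induction xs rule: rev_induct)
  case (snoc y xs)
  show ?case
  proof (cases "xs = []")
    case True
    with snoc show ?thesis by (simp add: gallery_def)
  next
    case False
    then have g: "gallery \<Delta> xs" and adj: "\<delta> (last xs) y \<in> S"
      and C: "hd xs \<in> C" "last xs \<in> C" "y \<in> C"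
      using snoc.prems by (auto simp: gallery_def successively_append_iff adjacent_def)
    then have "\<delta> (hd xs) y \<in> {\<delta> (hd xs) (last xs), \<delta> (hd xs) (last xs) \<cdot> \<delta> (last xs) y}"
      using dist_step[OF C adj] by blast
    then have "wlen (\<delta> (hd xs) y) \<le> wlen (\<delta> (hd xs) (last xs)) + 1"
      using wlen_mult_gen[of "\<delta> (hd xs) (last xs)", OF _ adj] C by auto
    then show ?thesis using snoc.IH[OF g] False by simp
  qed
qed (simp add: gallery_def)

lemma gallery_ex:
  assumes "x \<in> C" "y \<in> C"
  shows "\<exists>xs. gallery \<Delta> xs \<and> hd xs = x \<and> last xs = y \<and> length xs = wlen (\<delta> x y) + 1"
  using assms(2)
proof (induction "wlen (\<delta> x y)" arbitrary: y rule: less_induct)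
  case less
  show ?case
  proof (cases "\<delta> x y = \<one>\<^bsub>W\<^esub>")
    case True
    then show ?thesis using assms less.prems dist_one_iff
      by (intro exI[of _ "[x]"]) (auto simp: gallery_def)
  next
    case False
    then obtain s where s: "s \<in> S" "wlen (\<delta> x y \<cdot> s) < wlen (\<delta> x y)"
      using descent_right_ex[of "\<delta> x y"] assms less.prems by auto
    obtain y' where y': "y' \<in> C" "\<delta> y y' = s" "\<delta> x y' = \<delta> x y \<cdot> s"
      using dist_ex[OF assms(1) less.prems s(1)] by blast
    then obtain xs where xs: "gallery \<Delta> xs" "hd xs = x" "last xs = y'" "length xs = wlen (\<delta> x y') + 1"
      using less.hyps[of y'] s by auto
    have "wlen (\<delta> x y) = wlen (\<delta> x y') + 1"
      using wlen_mult_gen[of "\<delta> x y" s] s y'(3) assms less.prems by auto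
    moreover have "adjacent \<Delta> y' y" using adjacent_sym[OF less.prems y'(1) s(1) y'(2)] s(1)
      by (simp add: adjacent_def)
    ultimately show ?thesis using xs less.prems
      by (intro exI[of _ "xs @ [y]"]) (auto simp: gallery_def successively_append_iff)
  qed
qed

lemma gallery_snoc: "gallery \<Delta> xs \<Longrightarrow> y \<in> C \<Longrightarrow> adjacent \<Delta> (last xs) y \<Longrightarrow> gallery \<Delta> (xs @ [y])"
  by (auto simp: gallery_def successively_append_iff)

text \<open>
  The chamber \<open>y'\<close> is the last but one of a minimal gallery from \<open>x\<close> to \<open>y\<close>.
\<close>

lemma convex_contains_projection:
  assumes conv: "convex_chambers \<Delta> A" and x: "x \<in> A" "y \<in> A" and y': "y' \<in> C" "s \<in> S" "\<delta> y y' = s"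
    and d: "\<delta> x y' = \<delta> x y \<cdot> s" "wlen (\<delta> x y') < wlen (\<delta> x y)"
  shows "y' \<in> A"
proof -
  have C: "x \<in> C" "y \<in> C" using conv x by (auto simp: convex_chambers_def)
  obtain xs where xs: "gallery \<Delta> xs" "hd xs = x" "last xs = y'" "length xs = wlen (\<delta> x y') + 1"
    using gallery_ex[OF C(1) y'(1)] by blast
  have ne: "xs \<noteq> []" using xs(1) by (simp add: gallery_def)
  have "gallery \<Delta> (xs @ [y])"
    using gallery_snoc[OF xs(1) C(2)] adjacent_sym[OF C(2) y'(1,2,3)] xs(3) y'(2) by (simp add: adjacent_def)
  moreover have "length (xs @ [y]) \<le> length ys"
    if "gallery \<Delta> ys" "hd ys = x" "last ys = y" for ys
    using gallery_length[OF that(1)] that xs(4) d by simp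
  ultimately have "minimal_gallery \<Delta> (xs @ [y])" using xs(2) ne by (auto simp: minimal_gallery_def)
  then have "set (xs @ [y]) \<subseteq> A" using conv xs(2) ne x unfolding convex_chambers_def by force
  then show ?thesis using xs(3) ne by auto
qed

lemma generate_singleton:
  assumes "s \<in> S" shows "generate W {s} = {\<one>\<^bsub>W\<^esub>, s}"
proof
  show "generate W {s} \<subseteq> {\<one>\<^bsub>W\<^esub>, s}"
  proof
    fix w assume "w \<in> generate W {s}"
    then show "w \<in> {\<one>\<^bsub>W\<^esub>, s}" by (induction rule: generate.induct) (use assms in auto)
  qed
qed (auto intro: generate.intros)

end

locale apartment = weyl_building \<Delta> for \<Delta> :: "('w, 'c) w_metric" +
  fixes \<Sigma> :: "'c set"
  assumes apt: "\<Sigma> \<in> apartments \<Delta>"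
begin

lemma apt_convex: "convex_chambers \<Delta> \<Sigma>"
  and apt_subset: "\<Sigma> \<subseteq> C"
  and apt_panel: "P \<in> panels \<Delta> \<Longrightarrow> P \<inter> \<Sigma> = {} \<or> card (P \<inter> \<Sigma>) = 2"
  using apt by (auto simp: apartments_def convex_chambers_def)

lemma apt_neighbour:
  assumes x: "x \<in> \<Sigma>" and s: "s \<in> S"
  shows "\<exists>y\<in>\<Sigma>. \<delta> x y = s" "\<lbrakk>y \<in> \<Sigma>; y' \<in> \<Sigma>; \<delta> x y = s; \<delta> x y' = s\<rbrakk> \<Longrightarrow> y = y'"
proof -
  have xC: "x \<in> C" using x apt_subset by blast
  define P where "P = {y \<in> C. \<delta> x y \<in> generate W {s}}"
  have "P \<in> panels \<Delta>" using s xC by (auto simp: panels_def residues_def P_def)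
  moreover have "x \<in> P" using xC by (simp add: P_def generate.one)
  ultimately have "card (P \<inter> \<Sigma>) = 2" using apt_panel x by blast
  then obtain u v where uv: "P \<inter> \<Sigma> = {u, v}" "u \<noteq> v" by (auto simp: card_2_iff)
  then have "x \<in> {u, v}" using x \<open>x \<in> P\<close> by blast
  then obtain y0 where y0: "P \<inter> \<Sigma> = {x, y0}" "x \<noteq> y0" using uv by (metis empty_iff insertE insert_commute)
  have mem: "y \<in> P \<inter> \<Sigma> \<longleftrightarrow> y \<in> \<Sigma> \<and> (y = x \<or> \<delta> x y = s)" for y
    using apt_subset xC by (auto simp: P_def generate_singleton[OF s] dist_one_iff)
  have "\<delta> x y0 = s" "y0 \<in> \<Sigma>" using mem[of y0] y0 by auto
  then show "\<exists>y\<in>\<Sigma>. \<delta> x y = s" by blast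
  assume "y \<in> \<Sigma>" "y' \<in> \<Sigma>" "\<delta> x y = s" "\<delta> x y' = s"
  moreover from this have "y \<noteq> x" "y' \<noteq> x" using gen_neq_one[OF s] dist_self[OF xC] by metis+
  ultimately show "y = y'" using mem[of y] mem[of y'] y0(1) by auto
qed

text \<open>
  If the step leads towards \<open>x\<close>, then the chamber of the panel nearest to \<open>x\<close> lies in the apartment by
  convexity. It is \<open>y'\<close>, since the apartment contains only one other chamber of the panel.
\<close>

lemma apt_step:
  assumes "x \<in> \<Sigma>" "y \<in> \<Sigma>" "y' \<in> \<Sigma>" "s \<in> S" "\<delta> y y' = s"
  shows "\<delta> x y' = \<delta> x y \<cdot> s"
proof (cases "wlen (\<delta> x y \<cdot> s) = wlen (\<delta> x y) + 1")
  case True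
  then show ?thesis using dist_step_up assms apt_subset by blast
next
  case False
  have C: "x \<in> C" "y \<in> C" using assms apt_subset by auto
  obtain v where v: "v \<in> C" "\<delta> y v = s" "\<delta> x v = \<delta> x y \<cdot> s" using dist_ex[OF C assms(4)] by blast
  have "wlen (\<delta> x v) < wlen (\<delta> x y)"
    using wlen_mult_gen[of "\<delta> x y" s] False C assms(4) v(3) by auto
  then have "v \<in> \<Sigma>" using convex_contains_projection[OF apt_convex assms(1,2) v(1) assms(4) v(2,3)] by blast
  then have "v = y'" using apt_neighbour(2)[OF assms(2,4)] v(2) assms by blast
  then show ?thesis using v(3) by simp
qed

lemma apt_walk:
  assumes "xs \<in> lists S" "x \<in> \<Sigma>"
  shows "\<exists>y\<in>\<Sigma>. \<forall>u\<in>\<Sigma>. \<delta> u y = \<delta> u x \<cdot> wp xs"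
  using assms
proof (induction xs arbitrary: x rule: list.induct)
  case Nil
  have "\<delta> u x \<cdot> \<one>\<^bsub>W\<^esub> = \<delta> u x" if "u \<in> \<Sigma>" for u
    using that Nil.prems apt_subset by (intro r_one dist_closed) blast+
  then show ?case using Nil.prems by (intro bexI[of _ x]) simp_all
next
  case (Cons s xs)
  then have s: "s \<in> S" "xs \<in> lists S" by auto
  obtain x' where x': "x' \<in> \<Sigma>" "\<delta> x x' = s" using apt_neighbour(1)[OF Cons.prems(2) s(1)] by blast
  obtain y where y: "y \<in> \<Sigma>" "\<forall>u\<in>\<Sigma>. \<delta> u y = \<delta> u x' \<cdot> wp xs" using Cons.IH[OF s(2) x'(1)] by blast
  have "\<delta> u y = \<delta> u x \<cdot> wp (s # xs)" if u: "u \<in> \<Sigma>" for u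
  proof -
    have "u \<in> C" "x \<in> C" using u Cons.prems(2) apt_subset by auto
    then show ?thesis using y(2) u apt_step[OF u Cons.prems(2) x'(1) s(1) x'(2)] s by (simp add: m_assoc)
  qed
  then show ?case using y(1) by blast
qed

text \<open>
  Follow from \<open>x\<close> a word for the inverse of \<open>\<delta> y x\<close>. The distance from \<open>y\<close> to the end of this
  walk is trivial.
\<close>

lemma apt_cocycle:
  assumes "u \<in> \<Sigma>" "x \<in> \<Sigma>" "y \<in> \<Sigma>"
  shows "\<delta> u y = \<delta> u x \<cdot> \<delta> x y"
proof -
  have C: "u \<in> C" "x \<in> C" "y \<in> C" using assms apt_subset by auto
  have *: "\<delta> u y = \<delta> u x \<cdot> inv\<^bsub>W\<^esub> (\<delta> y x)" if "u \<in> \<Sigma>" for u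
  proof -
    obtain xs where xs: "xs \<in> lists S" "wp xs = inv\<^bsub>W\<^esub> (\<delta> y x)"
      using word_ex[of "inv\<^bsub>W\<^esub> (\<delta> y x)"] C by auto
    obtain y' where y': "y' \<in> \<Sigma>" "\<forall>u\<in>\<Sigma>. \<delta> u y' = \<delta> u x \<cdot> wp xs"
      using apt_walk[OF xs(1) assms(2)] by blast
    then have "\<delta> y y' = \<one>\<^bsub>W\<^esub>" using xs(2) assms(3) C by simp
    then have "y' = y" using dist_one_iff C(3) y'(1) apt_subset by blast
    then show ?thesis using y'(2) that xs(2) by simp
  qed
  have "\<delta> x y = inv\<^bsub>W\<^esub> (\<delta> y x)" using *[OF assms(2)] C by simp
  then show ?thesis using *[OF assms(1)] by simp
qed

theorem apartment_coordinates:
  assumes "c \<in> \<Sigma>"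
  obtains \<psi> where "\<psi> \<in> special_iso (coxeter_building W S) (on_chambers \<Delta> \<Sigma>)" "\<psi> \<one>\<^bsub>W\<^esub> = c"
proof -
  have cC: "c \<in> C" using assms apt_subset by blast
  have inj: "x = y" if "x \<in> \<Sigma>" "y \<in> \<Sigma>" "\<delta> c x = \<delta> c y" for x y
  proof -
    have C: "x \<in> C" "y \<in> C" using that apt_subset by auto
    have "\<delta> c x \<cdot> \<delta> x y = \<delta> c x" using apt_cocycle[OF assms that(1,2)] that(3) by simp
    then have "\<delta> x y = \<one>\<^bsub>W\<^esub>" using C cC by simp
    then show ?thesis using dist_one_iff C by blast
  qed
  have surj: "\<exists>y\<in>\<Sigma>. \<delta> c y = w" if w: "w \<in> carrier W" for w
  proof -
    obtain xs where xs: "xs \<in> lists S" "wp xs = w" using word_ex[OF w] by blast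
    obtain y where y: "y \<in> \<Sigma>" "\<forall>u\<in>\<Sigma>. \<delta> u y = \<delta> u c \<cdot> wp xs"
      using apt_walk[OF xs(1) assms] by blast
    have "\<delta> c y = w" using bspec[OF y(2) assms] cC w xs(2) by simp
    with y(1) show ?thesis by blast
  qed
  define \<psi> where "\<psi> w = (THE y. y \<in> \<Sigma> \<and> \<delta> c y = w)" for w
  have \<psi>: "\<psi> w \<in> \<Sigma>" "\<delta> c (\<psi> w) = w" if "w \<in> carrier W" for w
  proof -
    have "\<exists>!y. y \<in> \<Sigma> \<and> \<delta> c y = w" using surj[OF that] inj by blast
    from theI'[OF this] show "\<psi> w \<in> \<Sigma>" "\<delta> c (\<psi> w) = w" by (auto simp: \<psi>_def)
  qed
  have \<psi>\<delta>: "\<psi> (\<delta> c y) = y" if "y \<in> \<Sigma>" for y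
    using \<psi>[of "\<delta> c y"] inj[of "\<psi> (\<delta> c y)" y] that cC apt_subset by auto
  have "bij_betw \<psi> (carrier W) \<Sigma>"
    by (rule bij_betw_byWitness[where f' = "\<delta> c"]) (use \<psi> \<psi>\<delta> cC apt_subset in auto)
  moreover have "\<delta> (\<psi> v) (\<psi> w) = inv\<^bsub>W\<^esub> v \<cdot> w" if "v \<in> carrier W" "w \<in> carrier W" for v w
  proof -
    have C: "\<psi> v \<in> C" "\<psi> w \<in> C" using \<psi> that apt_subset by auto
    have "w = v \<cdot> \<delta> (\<psi> v) (\<psi> w)" using apt_cocycle[OF assms \<psi>(1) \<psi>(1)] \<psi>(2) that by metis
    then have "inv\<^bsub>W\<^esub> v \<cdot> w = inv\<^bsub>W\<^esub> v \<cdot> (v \<cdot> \<delta> (\<psi> v) (\<psi> w))" by simp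
    then show ?thesis using that C by (simp add: m_assoc[symmetric])
  qed
  ultimately have "\<psi> \<in> special_iso (coxeter_building W S) (on_chambers \<Delta> \<Sigma>)"
    by (simp add: special_iso_def coxeter_building_def on_chambers_def)
  moreover have "\<psi> \<one>\<^bsub>W\<^esub> = c" using \<psi>\<delta>[OF assms] cC by simp
  ultimately show ?thesis using that by blast
qed

end

locale coordinates = apartment \<Delta> \<Sigma> for \<Delta> :: "('w, 'c) w_metric" and \<Sigma> +
  fixes \<psi> :: "'w \<Rightarrow> 'c"
  assumes coords: "\<psi> \<in> special_iso (coxeter_building (weyl \<Delta>) (gens \<Delta>)) (on_chambers \<Delta> \<Sigma>)"
begin

lemma coord_bij: "bij_betw \<psi> (carrier W) \<Sigma>"
  and coord_dist: "v \<in> carrier W \<Longrightarrow> w \<in> carrier W \<Longrightarrow> \<delta> (\<psi> v) (\<psi> w) = inv\<^bsub>W\<^esub> v \<cdot> w"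
  using coords by (simp_all add: special_iso_def coxeter_building_def on_chambers_def)

lemma coord_in [simp]: "w \<in> carrier W \<Longrightarrow> \<psi> w \<in> \<Sigma>"
  using coord_bij by (auto simp: bij_betw_def)

lemma coord_in_C [simp]: "w \<in> carrier W \<Longrightarrow> \<psi> w \<in> C"
  using apt_subset coord_in by blast

lemma coord_inj: "v \<in> carrier W \<Longrightarrow> w \<in> carrier W \<Longrightarrow> \<psi> v = \<psi> w \<longleftrightarrow> v = w"
  using coord_bij by (auto simp: bij_betw_def inj_on_def)

lemma coord_image: "\<psi> ` carrier W = \<Sigma>"
  using coord_bij by (simp add: bij_betw_def)

lemma coord_eq_of_dist:
  assumes "v \<in> carrier W" "w \<in> carrier W" "y \<in> \<Sigma>" "\<delta> (\<psi> v) y = inv\<^bsub>W\<^esub> v \<cdot> w"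
  shows "y = \<psi> w"
proof -
  obtain u where u: "u \<in> carrier W" "y = \<psi> u" using assms(3) coord_image by blast
  then have "inv\<^bsub>W\<^esub> v \<cdot> u = inv\<^bsub>W\<^esub> v \<cdot> w" using assms coord_dist by simp
  then show ?thesis using u assms by simp
qed

lemma isometry_is_left_mult:
  assumes t: "\<And>w. w \<in> carrier W \<Longrightarrow> t w \<in> \<Sigma>"
    and iso: "\<And>v w. v \<in> carrier W \<Longrightarrow> w \<in> carrier W \<Longrightarrow> \<delta> (t v) (t w) = inv\<^bsub>W\<^esub> v \<cdot> w"
  obtains g where "g \<in> carrier W" "\<And>w. w \<in> carrier W \<Longrightarrow> t w = \<psi> (g \<cdot> w)"
proof -
  obtain g where g: "g \<in> carrier W" "t \<one>\<^bsub>W\<^esub> = \<psi> g" using t[OF one_closed] coord_image by blast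
  have "t w = \<psi> (g \<cdot> w)" if w: "w \<in> carrier W" for w
  proof (rule coord_eq_of_dist[OF g(1) _ t[OF w]])
    show "\<delta> (\<psi> g) (t w) = inv\<^bsub>W\<^esub> g \<cdot> (g \<cdot> w)"
      using iso[OF one_closed w] g w by (simp add: m_assoc[symmetric])
  qed (use g w in simp)
  with g(1) that show ?thesis by blast
qed

lemma roots_in_coordinates:
  "roots \<Delta> \<Sigma> = {\<psi> ` (\<lambda>w. v \<cdot> w) ` simple_root W S s | v s. v \<in> carrier W \<and> s \<in> S}"
proof
  show "{\<psi> ` (\<lambda>w. v \<cdot> w) ` simple_root W S s | v s. v \<in> carrier W \<and> s \<in> S} \<subseteq> roots \<Delta> \<Sigma>"
    using coords unfolding roots_def by blast
  show "roots \<Delta> \<Sigma> \<subseteq> {\<psi> ` (\<lambda>w. v \<cdot> w) ` simple_root W S s | v s. v \<in> carrier W \<and> s \<in> S}"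
  proof
    fix \<alpha> assume "\<alpha> \<in> roots \<Delta> \<Sigma>"
    then obtain \<phi> v s where \<alpha>: "\<alpha> = \<phi> ` (\<lambda>w. v \<cdot> w) ` simple_root W S s" "v \<in> carrier W" "s \<in> S"
      and \<phi>: "\<phi> \<in> special_iso (coxeter_building W S) (on_chambers \<Delta> \<Sigma>)"
      unfolding roots_def by blast
    have \<phi>\<Sigma>: "\<phi> w \<in> \<Sigma>" if "w \<in> carrier W" for w
      using \<phi> that by (auto simp: special_iso_def coxeter_building_def on_chambers_def bij_betw_def)
    have \<phi>\<delta>: "\<delta> (\<phi> v) (\<phi> w) = inv\<^bsub>W\<^esub> v \<cdot> w" if "v \<in> carrier W" "w \<in> carrier W" for v w
      using \<phi> that by (simp add: special_iso_def coxeter_building_def on_chambers_def)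
    obtain g where g: "g \<in> carrier W" "\<And>w. w \<in> carrier W \<Longrightarrow> \<phi> w = \<psi> (g \<cdot> w)"
      by (rule isometry_is_left_mult[of \<phi>, OF \<phi>\<Sigma> \<phi>\<delta>]) (assumption+, rule that)
    have sr: "simple_root W S s \<subseteq> carrier W" by (auto simp: simple_root_def)
    have "\<alpha> = \<psi> ` (\<lambda>w. (g \<cdot> v) \<cdot> w) ` simple_root W S s"
      unfolding \<alpha>(1) image_image using sr \<alpha>(2) g by (intro image_cong) (auto simp: m_assoc)
    then show "\<alpha> \<in> {\<psi> ` (\<lambda>w. v \<cdot> w) ` simple_root W S s | v s. v \<in> carrier W \<and> s \<in> S}"
      using g(1) \<alpha> by blast
  qed
qed

text \<open>
  A chamber of a panel that is nearest to a given chamber \<open>\<psi> u\<close> is unique.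
\<close>

lemma fixed_chamber_step:
  assumes x: "x \<in> special_aut \<Delta>" and uv: "u \<in> carrier W" "v \<in> carrier W" "s \<in> S"
    and fixed: "x (\<psi> u) = \<psi> u" "x (\<psi> v) = \<psi> v"
    and closer: "wlen (inv\<^bsub>W\<^esub> u \<cdot> v \<cdot> s) < wlen (inv\<^bsub>W\<^esub> u \<cdot> v)"
  shows "x (\<psi> (v \<cdot> s)) = \<psi> (v \<cdot> s)"
proof -
  define y y' where "y = \<psi> (v \<cdot> s)" and "y' = x y"
  have vs: "v \<cdot> s \<in> carrier W" using uv by simp
  have iso: "\<delta> (x p) (x q) = \<delta> p q" if "p \<in> C" "q \<in> C" for p q
    using x that by (simp add: special_aut_def)
  have xC: "x p \<in> C" if "p \<in> C" for p
    using x that by (auto simp: special_aut_def Bij_def bij_betw_def)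
  have C: "y \<in> C" "y' \<in> C" using vs xC by (simp_all add: y_def y'_def)
  have du: "\<delta> (\<psi> u) y = inv\<^bsub>W\<^esub> u \<cdot> v \<cdot> s" "\<delta> (\<psi> u) y' = inv\<^bsub>W\<^esub> u \<cdot> v \<cdot> s"
    using coord_dist[OF uv(1) vs] iso[of "\<psi> u" y] fixed C uv by (simp_all add: y_def y'_def m_assoc)
  have dv: "\<delta> (\<psi> v) y = s" "\<delta> (\<psi> v) y' = s"
    using coord_dist[OF uv(2) vs] iso[of "\<psi> v" y] fixed C uv by (simp_all add: y_def y'_def m_assoc[symmetric])
  \<comment> \<open>Two different such chambers would be \<open>s\<close>-adjacent, and one of them further away from \<open>\<psi> u\<close>.\<close>
  have "\<delta> y y' \<in> {\<delta> y (\<psi> v), \<delta> y (\<psi> v) \<cdot> s}"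
    using dist_step[OF C(1) _ C(2) uv(3) dv(2)] uv by simp
  moreover have "\<delta> y (\<psi> v) = s" using adjacent_sym[OF _ C(1) uv(3) dv(1)] uv by simp
  ultimately consider "\<delta> y y' = s" | "\<delta> y y' = \<one>\<^bsub>W\<^esub>" using uv by auto
  then show ?thesis
  proof cases
    case 1
    have "wlen (\<delta> (\<psi> u) y \<cdot> s) = wlen (\<delta> (\<psi> u) y) + 1"
      using wlen_mult_gen[of "inv\<^bsub>W\<^esub> u \<cdot> v" s] closer uv by (auto simp: du)
    then have "\<delta> (\<psi> u) y' = \<delta> (\<psi> u) y \<cdot> s"
      using dist_step_up[OF _ C uv(3) 1] uv by simp
    then have "wlen (\<delta> (\<psi> u) y) = wlen (\<delta> (\<psi> u) y) + 1"
      using du \<open>wlen (\<delta> (\<psi> u) y \<cdot> s) = wlen (\<delta> (\<psi> u) y) + 1\<close> by simp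
    then show ?thesis by simp
  next
    case 2
    then show ?thesis using dist_one_iff C by (simp add: y_def y'_def)
  qed
qed

text \<open>
  Choose a fixed chamber \<open>v\<close> nearest to \<open>y\<close> and a neighbour \<open>v s\<close> that is nearer. The root
  containing \<open>v\<close> but not \<open>v s\<close> contains all fixed chambers, as a fixed chamber on the other side
  would force \<open>v s\<close> to be fixed by \<open>fixed_chamber_step\<close>.
\<close>

lemma fixed_outside_root:
  assumes x: "x \<in> special_aut \<Delta>" and D: "D \<subseteq> carrier W" "D \<noteq> {}" "\<And>w. w \<in> D \<Longrightarrow> x (\<psi> w) = \<psi> w"
    and y: "y \<in> carrier W" "x (\<psi> y) \<noteq> \<psi> y"
  shows "\<exists>v\<in>carrier W. \<exists>s\<in>S. D \<subseteq> (\<lambda>w. v \<cdot> w) ` simple_root W S s \<and> y \<notin> (\<lambda>w. v \<cdot> w) ` simple_root W S s"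
proof -
  define E where "E = {w \<in> carrier W. x (\<psi> w) = \<psi> w}"
  have DE: "D \<subseteq> E" using D by (auto simp: E_def)
  then obtain w0 where "w0 \<in> E" using D(2) by blast
  obtain v where v: "v \<in> E" and least: "\<And>w. w \<in> E \<Longrightarrow> wlen (inv\<^bsub>W\<^esub> v \<cdot> y) \<le> wlen (inv\<^bsub>W\<^esub> w \<cdot> y)"
    using ex_has_least_nat[of "\<lambda>w. w \<in> E" w0 "\<lambda>w. wlen (inv\<^bsub>W\<^esub> w \<cdot> y)"] \<open>w0 \<in> E\<close> by blast
  have vc: "v \<in> carrier W" using v by (simp add: E_def)
  have "inv\<^bsub>W\<^esub> v \<cdot> y \<noteq> \<one>\<^bsub>W\<^esub>"
  proof
    assume "inv\<^bsub>W\<^esub> v \<cdot> y = \<one>\<^bsub>W\<^esub>"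
    then have "y = v" using vc y(1) by (metis inv_inv inv_closed inv_equality)
    then show False using v y(2) by (simp add: E_def)
  qed
  then obtain s where s: "s \<in> S" "wlen (s \<cdot> (inv\<^bsub>W\<^esub> v \<cdot> y)) < wlen (inv\<^bsub>W\<^esub> v \<cdot> y)"
    using descent_ex[of "inv\<^bsub>W\<^esub> v \<cdot> y"] vc y(1) by auto
  have mem: "w \<in> (\<lambda>w. v \<cdot> w) ` simple_root W S s \<longleftrightarrow>
      wlen (inv\<^bsub>W\<^esub> v \<cdot> w) < wlen (s \<cdot> (inv\<^bsub>W\<^esub> v \<cdot> w))" if w: "w \<in> carrier W" for w
  proof
    assume "wlen (inv\<^bsub>W\<^esub> v \<cdot> w) < wlen (s \<cdot> (inv\<^bsub>W\<^esub> v \<cdot> w))"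
    then show "w \<in> (\<lambda>w. v \<cdot> w) ` simple_root W S s"
      using w vc by (intro image_eqI[of _ _ "inv\<^bsub>W\<^esub> v \<cdot> w"]) (auto simp: simple_root_def m_assoc[symmetric])
  next
    assume "w \<in> (\<lambda>w. v \<cdot> w) ` simple_root W S s"
    then obtain w' where "w' \<in> carrier W" "wlen w' < wlen (s \<cdot> w')" "w = v \<cdot> w'"
      by (auto simp: simple_root_def)
    then show "wlen (inv\<^bsub>W\<^esub> v \<cdot> w) < wlen (s \<cdot> (inv\<^bsub>W\<^esub> v \<cdot> w))"
      using vc by (simp add: m_assoc[symmetric])
  qed
  have "w \<in> (\<lambda>w. v \<cdot> w) ` simple_root W S s" if "w \<in> D" for w
  proof (rule ccontr)
    have w: "w \<in> carrier W" "x (\<psi> w) = \<psi> w" using that D by auto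
    define g where "g = inv\<^bsub>W\<^esub> w \<cdot> v"
    have g: "g \<in> carrier W" using w vc by (simp add: g_def)
    have "inv\<^bsub>W\<^esub> g = inv\<^bsub>W\<^esub> v \<cdot> w" "inv\<^bsub>W\<^esub> (g \<cdot> s) = s \<cdot> (inv\<^bsub>W\<^esub> v \<cdot> w)"
      using w vc s by (simp_all add: g_def inv_mult_group)
    then have len: "wlen (inv\<^bsub>W\<^esub> v \<cdot> w) = wlen g"
        "wlen (s \<cdot> (inv\<^bsub>W\<^esub> v \<cdot> w)) = wlen (g \<cdot> s)"
      using wlen_inv[OF g] wlen_inv[of "g \<cdot> s"] g s by simp_all
    assume "w \<notin> (\<lambda>w. v \<cdot> w) ` simple_root W S s"
    then have "wlen (g \<cdot> s) < wlen g" using mem[OF w(1)] len wlen_mult_gen[OF g s(1)] by auto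
    then have "x (\<psi> (v \<cdot> s)) = \<psi> (v \<cdot> s)"
      using fixed_chamber_step[OF x w(1) vc s(1) w(2)] v by (simp add: E_def g_def)
    then have "v \<cdot> s \<in> E" using vc s by (simp add: E_def)
    from least[OF this] s vc y(1) show False by (simp add: inv_mult_group m_assoc)
  qed
  moreover have "y \<notin> (\<lambda>w. v \<cdot> w) ` simple_root W S s" using mem[OF y(1)] s(2) by simp
  ultimately show ?thesis using vc s(1) by blast
qed

end

section \<open>Groups of automorphisms\<close>

lemma (in group) conj_aut_auto:
  assumes "g \<in> carrier G" shows "conj_aut G g \<in> auto G"
proof -
  have "conj_aut G g \<in> hom G G"
    using assms by (intro homI) (auto simp: conj_aut_def m_assoc inv_solve_left)
  moreover have "bij_betw (conj_aut G g) (carrier G) (carrier G)"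
  proof (rule bij_betw_byWitness[where f' = "conj_aut G (inv g)"])
    show "\<forall>x\<in>carrier G. conj_aut G (inv g) (conj_aut G g x) = x"
      using assms by (simp add: conj_aut_def m_assoc) (simp add: m_assoc[symmetric])
    show "\<forall>x\<in>carrier G. conj_aut G g (conj_aut G (inv g) x) = x"
      using assms by (simp add: conj_aut_def m_assoc) (simp add: m_assoc[symmetric])
  qed (use assms in \<open>auto simp: conj_aut_def\<close>)
  ultimately show ?thesis by (auto simp: auto_def Bij_def conj_aut_def)
qed

lemma (in group) conj_aut_group_hom: "group_hom G (AutoGroup G) (conj_aut G)"
proof -
  interpret A: group "AutoGroup G" by (rule AutoGroup)
  show ?thesis
  proof (unfold_locales, rule homI)
    show "conj_aut G g \<in> carrier (AutoGroup G)" if "g \<in> carrier G" for g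
      using conj_aut_auto[OF that] by (simp add: AutoGroup_def)
    show "conj_aut G (g \<otimes> h) = conj_aut G g \<otimes>\<^bsub>AutoGroup G\<^esub> conj_aut G h"
      if gh: "g \<in> carrier G" "h \<in> carrier G" for g h
    proof -
      have B: "conj_aut G g \<in> Bij (carrier G)" "conj_aut G h \<in> Bij (carrier G)"
        using conj_aut_auto gh by (auto simp: auto_def)
      then have "conj_aut G g \<otimes>\<^bsub>AutoGroup G\<^esub> conj_aut G h = compose (carrier G) (conj_aut G g) (conj_aut G h)"
        by (simp add: AutoGroup_def BijGroup_def)
      also have "\<dots> = conj_aut G (g \<otimes> h)"
        using gh by (auto simp: compose_def conj_aut_def fun_eq_iff m_assoc inv_mult_group)
      finally show ?thesis by simp
    qed
  qed
qed

lemma (in group) conj_aut_image_subset: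
  "g \<in> carrier G \<Longrightarrow> A \<subseteq> carrier G \<Longrightarrow> conj_aut G g ` A = {x \<in> carrier G. inv g \<otimes> x \<otimes> g \<in> A}"
proof
  assume g: "g \<in> carrier G" and A: "A \<subseteq> carrier G"
  show "conj_aut G g ` A \<subseteq> {x \<in> carrier G. inv g \<otimes> x \<otimes> g \<in> A}"
  proof
    fix y assume "y \<in> conj_aut G g ` A"
    then obtain x where x: "x \<in> A" "x \<in> carrier G" "y = g \<otimes> x \<otimes> inv g" using A by (auto simp: conj_aut_def)
    then have "inv g \<otimes> y \<otimes> g = x" using g by (simp add: m_assoc) (simp add: m_assoc[symmetric])
    then show "y \<in> {x \<in> carrier G. inv g \<otimes> x \<otimes> g \<in> A}" using x g by simp
  qed
  show "{x \<in> carrier G. inv g \<otimes> x \<otimes> g \<in> A} \<subseteq> conj_aut G g ` A"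
  proof
    fix y assume y: "y \<in> {x \<in> carrier G. inv g \<otimes> x \<otimes> g \<in> A}"
    then have "conj_aut G g (inv g \<otimes> y \<otimes> g) = y"
      using g by (simp add: conj_aut_def m_assoc) (simp add: m_assoc[symmetric])
    then show "y \<in> conj_aut G g ` A" using y by force
  qed
qed

context weyl_building
begin

lemma aut_iso: "g \<in> aut \<Delta> \<Longrightarrow> g \<in> Bij C"
  by (simp add: aut_def)

lemma Bij_in: "g \<in> Bij A \<Longrightarrow> x \<in> A \<Longrightarrow> g x \<in> A"
  using Bij_imp_funcset by blast

lemma aut_subgroup: "subgroup (aut \<Delta>) (BijGroup C)"
proof (rule group.subgroupI[OF group_BijGroup])
  show "aut \<Delta> \<subseteq> carrier (BijGroup C)" by (auto simp: BijGroup_def aut_def)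
  have "(\<lambda>x\<in>C. x) \<in> aut \<Delta>"
    unfolding aut_def
    by (intro CollectI conjI id_Bij exI[of _ "\<lambda>w. w"]) (auto simp: iso_def hom_def bij_betw_def)
  then show "aut \<Delta> \<noteq> {}" by blast
next
  fix g assume "g \<in> aut \<Delta>"
  then obtain \<sigma> where g: "g \<in> Bij C" and \<sigma>: "\<sigma> \<in> iso W W" "\<sigma> ` S = S"
    and d: "\<And>x y. x \<in> C \<Longrightarrow> y \<in> C \<Longrightarrow> \<delta> (g x) (g y) = \<sigma> (\<delta> x y)"
    by (auto simp: aut_def)
  define h where "h = (\<lambda>x\<in>C. inv_into C g x)"
  have h: "h \<in> Bij C" unfolding h_def using restrict_inv_into_Bij[OF g] .
  have gh: "g (h x) = x" if "x \<in> C" for x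
    using that g by (simp add: h_def Bij_def bij_betw_def f_inv_into_f)
  define \<tau> where "\<tau> = inv_into (carrier W) \<sigma>"
  have \<tau>: "\<tau> \<in> iso W W" unfolding \<tau>_def using iso_set_sym[OF \<sigma>(1)] .
  have \<tau>\<sigma>: "\<tau> (\<sigma> w) = w" if "w \<in> carrier W" for w
    using that \<sigma>(1) by (simp add: \<tau>_def iso_def bij_betw_def)
  have "\<tau> ` S = S"
  proof -
    have "\<tau> ` S = \<tau> ` \<sigma> ` S" using \<sigma>(2) by simp
    also have "\<dots> = S" unfolding image_image using \<tau>\<sigma> by simp
    finally show ?thesis .
  qed
  moreover have "\<delta> (h x) (h y) = \<tau> (\<delta> x y)" if "x \<in> C" "y \<in> C" for x y
    using d[of "h x" "h y"] Bij_in[OF h] gh that \<tau>\<sigma> by simp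
  ultimately have "h \<in> aut \<Delta>" using h \<tau> by (auto simp: aut_def)
  then show "inv\<^bsub>BijGroup C\<^esub> g \<in> aut \<Delta>" using inv_BijGroup[OF g] by (simp add: h_def)
next
  fix g h assume "g \<in> aut \<Delta>" "h \<in> aut \<Delta>"
  then obtain \<sigma> \<tau> where g: "g \<in> Bij C" and \<sigma>: "\<sigma> \<in> iso W W" "\<sigma> ` S = S"
    and dg: "\<And>x y. x \<in> C \<Longrightarrow> y \<in> C \<Longrightarrow> \<delta> (g x) (g y) = \<sigma> (\<delta> x y)"
    and h: "h \<in> Bij C" and \<tau>: "\<tau> \<in> iso W W" "\<tau> ` S = S"
    and dh: "\<And>x y. x \<in> C \<Longrightarrow> y \<in> C \<Longrightarrow> \<delta> (h x) (h y) = \<tau> (\<delta> x y)"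
    by (auto simp: aut_def)
  have "compose C g h \<in> Bij C" using g h by (rule compose_Bij)
  moreover have "(\<sigma> \<circ> \<tau>) \<in> iso W W" using iso_set_trans[OF \<tau>(1) \<sigma>(1)] .
  moreover have "(\<sigma> \<circ> \<tau>) ` S = S" unfolding image_comp[symmetric] using \<sigma>(2) \<tau>(2) by simp
  moreover have "\<forall>x\<in>C. \<forall>y\<in>C. \<delta> (compose C g h x) (compose C g h y) = (\<sigma> \<circ> \<tau>) (\<delta> x y)"
    using dg dh Bij_in[OF h] by (simp add: compose_def)
  ultimately have "compose C g h \<in> aut \<Delta>"
    unfolding aut_def by (intro CollectI conjI exI[of _ "(\<sigma> \<circ> \<tau>)"])
  then show "g \<otimes>\<^bsub>BijGroup C\<^esub> h \<in> aut \<Delta>" using g h by (simp add: BijGroup_def)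
qed

lemma aut_group_group: "group (aut_group \<Delta>)"
  unfolding aut_group_def by (rule subgroup.subgroup_is_group[OF aut_subgroup group_BijGroup])

end

locale automorphism_subgroup = weyl_building \<Delta> for \<Delta> :: "('w, 'c) w_metric" +
  fixes F :: "('c \<Rightarrow> 'c) set"
  assumes F: "subgroup F (aut_group \<Delta>)"
begin

definition FG :: "('c \<Rightarrow> 'c) monoid" where
  "FG = (aut_group \<Delta>)\<lparr>carrier := F\<rparr>"

definition fixer :: "'c set \<Rightarrow> ('c \<Rightarrow> 'c) set" where
  "fixer D = {x \<in> F \<inter> special_aut \<Delta>. \<forall>y\<in>D. x y = y}"

lemma carrier_FG [simp]: "carrier FG = F"
  by (simp add: FG_def)

lemma group_FG: "group FG"
  unfolding FG_def using group.subgroup_imp_group[OF aut_group_group F] .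

lemma F_aut: "g \<in> F \<Longrightarrow> g \<in> aut \<Delta>"
  using subgroup.subset[OF F] by (auto simp: aut_group_def)

lemma F_Bij: "g \<in> F \<Longrightarrow> g \<in> Bij C"
  by (rule aut_iso[OF F_aut])

lemma F_in [simp]: "g \<in> F \<Longrightarrow> x \<in> C \<Longrightarrow> g x \<in> C"
  by (rule Bij_in[OF F_Bij])

lemma FG_mult: "g \<in> F \<Longrightarrow> h \<in> F \<Longrightarrow> x \<in> C \<Longrightarrow> (g \<otimes>\<^bsub>FG\<^esub> h) x = g (h x)"
  using F_Bij by (simp add: FG_def aut_group_def BijGroup_def compose_def)

lemma FG_one: "x \<in> C \<Longrightarrow> \<one>\<^bsub>FG\<^esub> x = x"
  by (simp add: FG_def aut_group_def BijGroup_def)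

lemma FG_closed [simp]: "g \<in> F \<Longrightarrow> h \<in> F \<Longrightarrow> g \<otimes>\<^bsub>FG\<^esub> h \<in> F"
  "g \<in> F \<Longrightarrow> inv\<^bsub>FG\<^esub> g \<in> F" "\<one>\<^bsub>FG\<^esub> \<in> F"
  using group.is_monoid[OF group_FG] monoid.m_closed[of FG] group.inv_closed[OF group_FG] monoid.one_closed[of FG]
  by auto

lemma FG_inv: "g \<in> F \<Longrightarrow> x \<in> C \<Longrightarrow> g ((inv\<^bsub>FG\<^esub> g) x) = x" "g \<in> F \<Longrightarrow> x \<in> C \<Longrightarrow> (inv\<^bsub>FG\<^esub> g) (g x) = x"
  using FG_mult[of g "inv\<^bsub>FG\<^esub> g" x] FG_mult[of "inv\<^bsub>FG\<^esub> g" g x]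
    group.r_inv[OF group_FG, of g] group.l_inv[OF group_FG, of g] FG_one by auto

lemma special_dist: "g \<in> special_aut \<Delta> \<Longrightarrow> x \<in> C \<Longrightarrow> y \<in> C \<Longrightarrow> \<delta> (g x) (g y) = \<delta> x y"
  by (simp add: special_aut_def)

lemma specialI: "g \<in> F \<Longrightarrow> (\<And>x y. x \<in> C \<Longrightarrow> y \<in> C \<Longrightarrow> \<delta> (g x) (g y) = \<delta> x y) \<Longrightarrow> g \<in> special_aut \<Delta>"
  using F_Bij by (simp add: special_aut_def)

lemma special_mult:
  assumes "g \<in> F" "h \<in> F" "g \<in> special_aut \<Delta>" "h \<in> special_aut \<Delta>"
  shows "g \<otimes>\<^bsub>FG\<^esub> h \<in> special_aut \<Delta>"
  using assms by (intro specialI) (simp_all add: FG_mult special_dist)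

lemma special_inv:
  assumes "g \<in> F" "g \<in> special_aut \<Delta>" shows "inv\<^bsub>FG\<^esub> g \<in> special_aut \<Delta>"
proof (rule specialI)
  fix x y assume "x \<in> C" "y \<in> C"
  then show "\<delta> ((inv\<^bsub>FG\<^esub> g) x) ((inv\<^bsub>FG\<^esub> g) y) = \<delta> x y"
    using special_dist[OF assms(2), of "(inv\<^bsub>FG\<^esub> g) x" "(inv\<^bsub>FG\<^esub> g) y"] assms(1) by (simp add: FG_inv)
qed (use assms in simp)

lemma special_one: "\<one>\<^bsub>FG\<^esub> \<in> special_aut \<Delta>"
  by (rule specialI) (simp_all add: FG_one)

lemma special_normal:
  assumes g: "g \<in> F" and x: "x \<in> F" "x \<in> special_aut \<Delta>"
  shows "inv\<^bsub>FG\<^esub> g \<otimes>\<^bsub>FG\<^esub> x \<otimes>\<^bsub>FG\<^esub> g \<in> special_aut \<Delta>"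
proof (rule specialI)
  fix u v assume uv: "u \<in> C" "v \<in> C"
  obtain \<sigma> where \<sigma>: "\<And>x y. x \<in> C \<Longrightarrow> y \<in> C \<Longrightarrow> \<delta> (g x) (g y) = \<sigma> (\<delta> x y)" "\<sigma> \<in> iso W W"
    using F_aut[OF g] by (auto simp: aut_def)
  have inj: "inj_on \<sigma> (carrier W)" using \<sigma>(2) by (simp add: iso_def bij_betw_def)
  let ?y = "inv\<^bsub>FG\<^esub> g \<otimes>\<^bsub>FG\<^esub> x \<otimes>\<^bsub>FG\<^esub> g"
  have y: "?y w = (inv\<^bsub>FG\<^esub> g) (x (g w))" "?y w \<in> C" if "w \<in> C" for w using that g x by (simp_all add: FG_mult)
  have "\<sigma> (\<delta> (?y u) (?y v)) = \<delta> (g (?y u)) (g (?y v))" using \<sigma>(1) y(2) uv by simp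
  also have "\<dots> = \<delta> (x (g u)) (x (g v))" using g x uv by (simp add: y(1) FG_inv)
  also have "\<dots> = \<sigma> (\<delta> u v)" using special_dist[OF x(2)] g uv \<sigma>(1) by simp
  finally show "\<delta> (?y u) (?y v) = \<delta> u v"
    using inj_onD[OF inj] y(2) uv by simp
qed (use g x in simp)

lemma fixer_antimono: "D \<subseteq> D' \<Longrightarrow> fixer D' \<subseteq> fixer D"
  by (auto simp: fixer_def)

lemma fixer_subgroup:
  assumes "D \<subseteq> C" shows "subgroup (fixer D) FG"
proof (rule group.subgroupI[OF group_FG])
  show "fixer D \<subseteq> carrier FG" by (auto simp: fixer_def)
  have "\<one>\<^bsub>FG\<^esub> \<in> fixer D" using assms special_one FG_one by (auto simp: fixer_def)
  then show "fixer D \<noteq> {}" by blast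
next
  fix x assume x: "x \<in> fixer D"
  have "(inv\<^bsub>FG\<^esub> x) y = y" if "y \<in> D" for y
    using FG_inv(2)[of x y] x that assms by (auto simp: fixer_def)
  then show "inv\<^bsub>FG\<^esub> x \<in> fixer D" using x special_inv by (auto simp: fixer_def)
next
  fix x y assume "x \<in> fixer D" "y \<in> fixer D"
  then show "x \<otimes>\<^bsub>FG\<^esub> y \<in> fixer D" using special_mult assms by (auto simp: fixer_def FG_mult)
qed

lemma conj_fixer:
  assumes g: "g \<in> F" and D: "D \<subseteq> C"
  shows "conj_aut FG g ` fixer D = fixer (g ` D)"
proof -
  interpret FG: group FG by (rule group_FG)
  have img: "conj_aut FG g ` fixer D = {x \<in> F. inv\<^bsub>FG\<^esub> g \<otimes>\<^bsub>FG\<^esub> x \<otimes>\<^bsub>FG\<^esub> g \<in> fixer D}"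
    using FG.conj_aut_image_subset[of g "fixer D"] g by (simp add: fixer_def subset_iff)
  have "inv\<^bsub>FG\<^esub> g \<otimes>\<^bsub>FG\<^esub> x \<otimes>\<^bsub>FG\<^esub> g \<in> fixer D \<longleftrightarrow> x \<in> fixer (g ` D)" if x: "x \<in> F" for x
  proof -
    let ?y = "inv\<^bsub>FG\<^esub> g \<otimes>\<^bsub>FG\<^esub> x \<otimes>\<^bsub>FG\<^esub> g"
    have yF: "?y \<in> F" using g x by simp
    have special: "?y \<in> special_aut \<Delta> \<longleftrightarrow> x \<in> special_aut \<Delta>"
    proof
      assume "?y \<in> special_aut \<Delta>"
      then have "inv\<^bsub>FG\<^esub> (inv\<^bsub>FG\<^esub> g) \<otimes>\<^bsub>FG\<^esub> ?y \<otimes>\<^bsub>FG\<^esub> inv\<^bsub>FG\<^esub> g \<in> special_aut \<Delta>"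
        using special_normal[of "inv\<^bsub>FG\<^esub> g" ?y] g yF by simp
      moreover have "inv\<^bsub>FG\<^esub> (inv\<^bsub>FG\<^esub> g) \<otimes>\<^bsub>FG\<^esub> ?y \<otimes>\<^bsub>FG\<^esub> inv\<^bsub>FG\<^esub> g = x"
        using g x by (simp add: FG.m_assoc) (simp add: FG.m_assoc[symmetric])
      ultimately show "x \<in> special_aut \<Delta>" by simp
    qed (use special_normal g x in blast)
    have "?y w = w \<longleftrightarrow> x (g w) = g w" if "w \<in> C" for w
    proof -
      have "?y w = (inv\<^bsub>FG\<^esub> g) (x (g w))" using that g x by (simp add: FG_mult)
      then show ?thesis using FG_inv(1)[OF g, of "x (g w)"] FG_inv(2)[OF g that] that g x by auto
    qed
    then have "(\<forall>w\<in>D. ?y w = w) \<longleftrightarrow> (\<forall>w\<in>g ` D. x w = w)" using D by blast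
    then show ?thesis using special yF x by (simp add: fixer_def)
  qed
  then show ?thesis using img by (auto simp: fixer_def)
qed

end

section \<open>Translations of an affine apartment\<close>

lemma apartment_translation_comparable:
  "t \<in> apartment_translations \<Delta> \<Sigma> \<Longrightarrow> \<alpha> \<in> roots \<Delta> \<Sigma> \<Longrightarrow> t ` \<alpha> \<subseteq> \<alpha> \<or> \<alpha> \<subseteq> t ` \<alpha>"
  by (simp add: apartment_translations_def)

locale affine_apartment = coordinates \<Delta> \<Sigma> \<psi> + affine_coxeter "weyl \<Delta>" "gens \<Delta>" b a z
  for \<Delta> :: "('w, 'c) w_metric" and \<Sigma> \<psi> b a z
begin

lemma half_subset: "half x \<subseteq> carrier W"
  by (auto simp: half_def)

lemma roots_eq_halves: "roots \<Delta> \<Sigma> = (\<lambda>x. \<psi> ` half x) ` real_roots S"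
proof -
  have "roots \<Delta> \<Sigma> = (`) \<psi> ` {(\<lambda>w. v \<cdot> w) ` simple_root W S s | v s. v \<in> carrier W \<and> s \<in> S}"
    unfolding roots_in_coordinates by blast
  then show ?thesis unfolding roots_as_half by (simp add: image_image)
qed

lemma root_subset_iff: "\<psi> ` half x \<subseteq> \<psi> ` half y \<longleftrightarrow> half x \<subseteq> half y"
proof
  assume sub: "\<psi> ` half x \<subseteq> \<psi> ` half y"
  show "half x \<subseteq> half y"
  proof
    fix w assume w: "w \<in> half x"
    then obtain v where v: "v \<in> half y" "\<psi> w = \<psi> v" using sub by blast
    then have "w = v" using coord_inj half_subset w by blast
    then show "w \<in> half y" using v(1) by simp
  qed
qed blast

lemma root_image:
  assumes "g \<in> carrier W" "\<And>w. w \<in> carrier W \<Longrightarrow> h (\<psi> w) = \<psi> (g \<cdot> w)"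
  shows "h ` \<psi> ` half x = \<psi> ` half (rep g x)"
  unfolding half_rep[OF assms(1)] image_image using assms(2) half_subset
  by (intro image_cong) auto

lemma restrict_root_image:
  assumes "g \<in> carrier W" "\<And>w. w \<in> carrier W \<Longrightarrow> h (\<psi> w) = \<psi> (g \<cdot> w)"
  shows "restrict h \<Sigma> ` \<psi> ` half x = \<psi> ` half (rep g x)"
proof -
  have "\<psi> ` half x \<subseteq> \<Sigma>" using half_subset coord_image by blast
  then have "restrict h \<Sigma> ` \<psi> ` half x = h ` \<psi> ` half x" by (intro image_cong) auto
  then show ?thesis using root_image[of g h x] assms by simp
qed

lemma special_aut_is_left_mult:
  assumes "h \<in> special_aut \<Delta>" "h ` \<Sigma> = \<Sigma>"
  shows "\<exists>g\<in>carrier W. \<forall>w\<in>carrier W. h (\<psi> w) = \<psi> (g \<cdot> w)"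
proof -
  have 1: "h (\<psi> w) \<in> \<Sigma>" if "w \<in> carrier W" for w using assms(2) coord_in[OF that] by blast
  have 2: "\<delta> (h (\<psi> v)) (h (\<psi> w)) = inv\<^bsub>W\<^esub> v \<cdot> w" if "v \<in> carrier W" "w \<in> carrier W" for v w
    using assms(1) that coord_dist by (simp add: special_aut_def)
  obtain g where "g \<in> carrier W" "\<And>w. w \<in> carrier W \<Longrightarrow> h (\<psi> w) = \<psi> (g \<cdot> w)"
    by (rule isometry_is_left_mult[of "\<lambda>w. h (\<psi> w)", OF 1 2]) (assumption+, rule that)
  then show ?thesis by blast
qed

lemma translation_of_apartment_translation:
  assumes h: "restrict h \<Sigma> \<in> apartment_translations \<Delta> \<Sigma>"
    and g: "g \<in> carrier W" "\<And>w. w \<in> carrier W \<Longrightarrow> h (\<psi> w) = \<psi> (g \<cdot> w)"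
  shows "translation g"
proof (rule parallel_preserving_translation[OF g(1)])
  fix x assume x: "x \<in> real_roots S"
  have img: "restrict h \<Sigma> ` \<psi> ` half x = \<psi> ` half (rep g x)"
    by (rule restrict_root_image) (use g in auto)
  have "\<psi> ` half x \<in> roots \<Delta> \<Sigma>" using x roots_eq_halves by blast
  from apartment_translation_comparable[OF h this]
  have "restrict h \<Sigma> ` \<psi> ` half x \<subseteq> \<psi> ` half x \<or> \<psi> ` half x \<subseteq> restrict h \<Sigma> ` \<psi> ` half x" .
  then show "half (rep g x) \<subseteq> half x \<or> half x \<subseteq> half (rep g x)"
    unfolding img root_subset_iff .
qed

lemma left_mult_image:
  assumes "g \<in> carrier W" "\<And>w. w \<in> carrier W \<Longrightarrow> h (\<psi> w) = \<psi> (g \<cdot> w)"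
  shows "h ` \<Sigma> = \<Sigma>"
proof -
  have "h ` \<Sigma> = \<psi> ` (\<lambda>w. g \<cdot> w) ` carrier W"
    unfolding coord_image[symmetric] image_image using assms(2) by (intro image_cong) auto
  also have "(\<lambda>w. g \<cdot> w) ` carrier W = carrier W" using surj_const_mult assms(1) by blast
  finally show ?thesis by (simp add: coord_image)
qed

lemma apartment_translation_of_translation:
  assumes h: "h \<in> special_aut \<Delta>" and g: "translation g"
    and hg: "\<And>w. w \<in> carrier W \<Longrightarrow> h (\<psi> w) = \<psi> (g \<cdot> w)"
  shows "restrict h \<Sigma> \<in> apartment_translations \<Delta> \<Sigma>"
proof -
  have gc: "g \<in> carrier W" using g by simp
  have img: "h ` \<Sigma> = \<Sigma>" by (rule left_mult_image) (use gc hg in auto)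
  have "inj_on h \<Sigma>" using h apt_subset by (auto simp: special_aut_def Bij_def bij_betw_def intro: inj_on_subset)
  then have "restrict h \<Sigma> \<in> Bij \<Sigma>" using img by (simp add: Bij_def bij_betw_def inj_on_def)
  moreover have "(\<lambda>w. w) \<in> iso W W" by (auto simp: iso_def hom_def bij_betw_def)
  moreover have "\<delta> (restrict h \<Sigma> x) (restrict h \<Sigma> y) = \<delta> x y" if "x \<in> \<Sigma>" "y \<in> \<Sigma>" for x y
    using that h apt_subset by (auto simp: special_aut_def)
  ultimately have "restrict h \<Sigma> \<in> aut (on_chambers \<Delta> \<Sigma>)"
    unfolding aut_def on_chambers_def by (auto intro!: exI[of _ "\<lambda>w. w"])
  moreover have "restrict h \<Sigma> ` \<alpha> \<subseteq> \<alpha> \<or> \<alpha> \<subseteq> restrict h \<Sigma> ` \<alpha>" if \<alpha>: "\<alpha> \<in> roots \<Delta> \<Sigma>" for \<alpha>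
  proof -
    obtain x where x: "x \<in> real_roots S" "\<alpha> = \<psi> ` half x" using \<alpha> roots_eq_halves by blast
    have "restrict h \<Sigma> ` \<alpha> = \<psi> ` half (rep g x)"
      unfolding x(2) by (rule restrict_root_image) (use gc hg in auto)
    then show ?thesis using translation_half_mono[OF g x(1)] x(2)
      by (metis le_cases root_subset_iff)
  qed
  ultimately show ?thesis by (simp add: apartment_translations_def)
qed

lemma simple_root_at:
  assumes J: "J \<subseteq> S" and u: "u \<in> generate W J" and s: "s \<in> J"
  shows "\<psi> ` half (rep u (basis s)) \<in> roots_at \<Delta> \<Sigma> (\<psi> ` generate W J) (\<psi> u)"
proof -
  have uc: "u \<in> carrier W" and sS: "s \<in> S" using generate_closed J u s by auto
  have usc: "u \<cdot> s \<in> carrier W" using uc sS by simp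
  have in_half: "u \<in> half (rep u (basis s))" using uc by (simp add: half_def)
  have not_in: "u \<cdot> s \<notin> half (rep u (basis s))"
    using uc sS not_both_signs[OF basis_root[OF sS]]
    by (simp add: half_def inv_mult_group rep_mult srefl_basis_self) (simp add: comb_def)
  have "\<psi> ` half (rep u (basis s)) \<in> roots \<Delta> \<Sigma>"
    using roots_eq_halves rep_root'[OF uc basis_root[OF sS]] by blast
  moreover have "\<psi> u \<in> \<psi> ` half (rep u (basis s))" using in_half by blast
  moreover have "\<psi> (u \<cdot> s) \<in> \<psi> ` generate W J"
    using generate.eng[OF u generate.incl[OF s]] by blast
  moreover have "adjacent \<Delta> (\<psi> u) (\<psi> (u \<cdot> s))"
    using coord_dist[OF uc usc] uc sS by (simp add: adjacent_def m_assoc[symmetric])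
  moreover have "\<psi> (u \<cdot> s) \<notin> \<psi> ` half (rep u (basis s))"
    using not_in coord_inj[OF usc] half_subset by auto
  ultimately show ?thesis unfolding roots_at_def by blast
qed

text \<open>
  By definition only the effect on the roots at \<open>u\<close> is known. The shifts of these roots determine, by
  linearity, those of all roots whose walls cut the gem.
\<close>

lemma basic_translation_shift:
  assumes J: "J \<subseteq> S" and u: "u \<in> generate W J" and s: "s \<in> J"
    and basic: "is_basic_translation \<Delta> \<Sigma> (\<psi> ` generate W J) (\<psi> u) \<alpha> (restrict h \<Sigma>)"
    and g: "g \<in> carrier W" "\<And>w. w \<in> carrier W \<Longrightarrow> h (\<psi> w) = \<psi> (g \<cdot> w)"
  shows "translation g"
    "\<alpha> = \<psi> ` half (rep u (basis s)) \<Longrightarrow> shift g (rep u (basis s)) < 0"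
    "\<alpha> \<noteq> \<psi> ` half (rep u (basis s)) \<Longrightarrow> shift g (rep u (basis s)) = 0"
proof -
  let ?x = "rep u (basis s)"
  have x: "?x \<in> real_roots S"
    using real_rootI[OF u s] real_roots_mono[OF J] by blast
  have tr: "restrict h \<Sigma> \<in> apartment_translations \<Delta> \<Sigma>"
    using basic by (simp add: is_basic_translation_def root_translations_def)
  show t: "translation g" by (rule translation_of_apartment_translation[OF tr]) (use g in auto)
  have img: "restrict h \<Sigma> ` \<psi> ` half ?x = \<psi> ` half (rep g ?x)"
    by (rule restrict_root_image) (use g in auto)
  show "shift g ?x < 0" if "\<alpha> = \<psi> ` half ?x"
  proof (rule shift_neg_of_psubset[OF t x])
    have "\<psi> ` half (rep g ?x) \<subset> \<psi> ` half ?x" using basic that img by (simp add: is_basic_translation_def)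
    then show "half (rep g ?x) \<subset> half ?x" unfolding psubset_eq root_subset_iff by blast
  qed
  show "shift g ?x = 0" if "\<alpha> \<noteq> \<psi> ` half ?x"
  proof (rule shift_zero_of_eq[OF t x])
    have "restrict h \<Sigma> ` \<psi> ` half ?x = \<psi> ` half ?x"
      using basic that simple_root_at[OF J u s]
      by (auto simp: is_basic_translation_def root_translations_def)
    then show "half (rep g ?x) = half ?x" unfolding img using root_subset_iff by (metis order_refl subset_antisym)
  qed
qed

end

locale translated_apartment =
  affine_apartment \<Delta> \<Sigma> \<psi> b a z + automorphism_subgroup \<Delta> F
  for \<Delta> :: "('w, 'c) w_metric" and \<Sigma> \<psi> b a z F
begin

text \<open>
  Special automorphisms that stabilise the apartment act on it by left multiplications.
\<close>

definition acts :: "('c \<Rightarrow> 'c) \<Rightarrow> 'w \<Rightarrow> bool" where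
  "acts h g \<longleftrightarrow> h \<in> F \<and> h \<in> special_aut \<Delta> \<and> g \<in> carrier W \<and>
     (\<forall>w\<in>carrier W. h (\<psi> w) = \<psi> (g \<cdot> w))"

lemma actsD: "acts h g \<Longrightarrow> h \<in> F" "acts h g \<Longrightarrow> h \<in> special_aut \<Delta>" "acts h g \<Longrightarrow> g \<in> carrier W"
  "acts h g \<Longrightarrow> w \<in> carrier W \<Longrightarrow> h (\<psi> w) = \<psi> (g \<cdot> w)"
  by (simp_all add: acts_def)

lemma acts_mult: "acts h g \<Longrightarrow> acts h' g' \<Longrightarrow> acts (h \<otimes>\<^bsub>FG\<^esub> h') (g \<cdot> g')"
  by (simp add: acts_def special_mult FG_mult m_assoc)

lemma acts_one: "acts \<one>\<^bsub>FG\<^esub> \<one>\<^bsub>W\<^esub>"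
  by (simp add: acts_def special_one FG_one)

lemma acts_inv: "acts h g \<Longrightarrow> acts (inv\<^bsub>FG\<^esub> h) (inv\<^bsub>W\<^esub> g)"
proof -
  assume *: "acts h g"
  have "(inv\<^bsub>FG\<^esub> h) (\<psi> w) = \<psi> (inv\<^bsub>W\<^esub> g \<cdot> w)" if w: "w \<in> carrier W" for w
  proof -
    have "h (\<psi> (inv\<^bsub>W\<^esub> g \<cdot> w)) = \<psi> w" using * w by (simp add: acts_def m_assoc[symmetric])
    then show ?thesis using FG_inv(2)[of h "\<psi> (inv\<^bsub>W\<^esub> g \<cdot> w)"] * w by (simp add: acts_def)
  qed
  with * show ?thesis by (simp add: acts_def special_inv)
qed

lemma acts_nat_pow: "acts h g \<Longrightarrow> acts (h [^]\<^bsub>FG\<^esub> (n::nat)) (g [^]\<^bsub>W\<^esub> n)"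
proof (induction n)
  case 0
  then show ?case using acts_one monoid.nat_pow_0 by simp
next
  case (Suc n)
  then show ?case using acts_mult by simp
qed

lemma acts_int_pow:
  assumes "acts h g" shows "acts (h [^]\<^bsub>FG\<^esub> (n::int)) (g [^]\<^bsub>W\<^esub> n)"
proof (cases "n < 0")
  case True
  show ?thesis unfolding int_pow_def2 if_P[OF True] by (rule acts_inv[OF acts_nat_pow[OF assms]])
next
  case False
  show ?thesis unfolding int_pow_def2 if_not_P[OF False] by (rule acts_nat_pow[OF assms])
qed

lemma acts_word_prod:
  assumes "list_all2 acts hs gs" shows "acts (word_prod FG hs) (word_prod W gs)"
  using assms
proof (induction rule: list_all2_induct)
  case Nil
  show ?case unfolding word_prod_Nil by (rule acts_one)
next
  case (Cons h hs g gs)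
  show ?case unfolding word_prod_Cons by (rule acts_mult[OF Cons(1,3)])
qed

lemma acts_image_half: "acts h g \<Longrightarrow> h ` \<psi> ` half x = \<psi> ` half (rep g x)"
  by (rule root_image) (auto simp: acts_def)

lemma acts_image: "acts h g \<Longrightarrow> h ` \<Sigma> = \<Sigma>"
  by (rule left_mult_image[of g]) (auto simp: acts_def)

text \<open>
  The hull of \<open>A\<close> is the intersection of the roots containing it. It is enough to know that \<open>B\<close>
  lies in this intersection and contains \<open>A\<close>.
\<close>

lemma fixer_eq_hull:
  assumes A: "A \<subseteq> carrier W" "A \<noteq> {}" and B: "A \<subseteq> B" "B \<subseteq> carrier W"
    and hull: "\<And>x. x \<in> real_roots S \<Longrightarrow> A \<subseteq> half x \<Longrightarrow> B \<subseteq> half x"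
  shows "fixer (\<psi> ` A) = fixer (\<psi> ` B)"
proof
  show "fixer (\<psi> ` B) \<subseteq> fixer (\<psi> ` A)" using B(1) by (intro fixer_antimono) blast
  show "fixer (\<psi> ` A) \<subseteq> fixer (\<psi> ` B)"
  proof
    fix h assume h: "h \<in> fixer (\<psi> ` A)"
    have "h (\<psi> y) = \<psi> y" if y: "y \<in> B" for y
    proof (rule ccontr)
      assume "h (\<psi> y) \<noteq> \<psi> y"
      moreover have "y \<in> carrier W" using B(2) y by blast
      ultimately obtain v s where vs: "v \<in> carrier W" "s \<in> S"
        "A \<subseteq> (\<lambda>w. v \<cdot> w) ` simple_root W S s" "y \<notin> (\<lambda>w. v \<cdot> w) ` simple_root W S s"
        using fixed_outside_root[of h A y] h A by (auto simp: fixer_def)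
      have "(\<lambda>w. v \<cdot> w) ` simple_root W S s = half (rep v (basis s))"
        using vs by (simp add: half_rep half_basis)
      then have "B \<subseteq> half (rep v (basis s))"
        using hull[OF rep_root'[OF vs(1) basis_root[OF vs(2)]]] vs(3) by simp
      with y vs(4) \<open>_ = half (rep v (basis s))\<close> show False by blast
    qed
    then show "h \<in> fixer (\<psi> ` B)" using h by (auto simp: fixer_def)
  qed
qed

text \<open>
  The inclusion of \<open>E\<close> in the intersection over all \<open>\<alpha>\<close> with \<open>\<alpha> E \<ge> E\<close> follows from \<open>E \<le> U\<close>. For
  the other one, the automorphisms that come from \<open>T\<close> are among these \<open>\<alpha>\<close> and already cut out \<open>E\<close>.
\<close>

theorem eigenfactor_of_hull:
  fixes T :: "('c \<Rightarrow> 'c) set"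
  defines "H \<equiv> translation_stabilizer \<Delta> F \<Sigma>" and "U \<equiv> fixer {\<psi> \<one>\<^bsub>W\<^esub>}"
  assumes T: "T \<subseteq> H" "T \<noteq> {}" and E: "E = (\<Inter>h\<in>T. conj_aut FG h ` U)" and EU: "E \<subseteq> U"
    and EB: "E = fixer (\<psi> ` B)" and B: "B = carrier W \<or> (\<exists>x\<in>real_roots S. B = half x)"
    and shrink: "\<And>h. h \<in> T \<Longrightarrow> h ` \<psi> ` B \<subseteq> \<psi> ` B"
  shows "eigenfactor FG U (conj_aut FG ` H) E"
proof -
  have Bsub: "B \<subseteq> carrier W" using B half_subset by auto
  then have BC: "\<psi> ` B \<subseteq> C" using coord_in_C by blast
  have HF: "h \<in> F" if "h \<in> H" for h
    using that by (simp add: H_def translation_stabilizer_def apartment_stabilizer_def)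
  have conj: "conj_aut FG h ` E = fixer (h ` \<psi> ` B)" if "h \<in> H" for h
    unfolding EB using conj_fixer[OF HF[OF that] BC] .
  have comparable: "h ` \<psi> ` B \<subseteq> \<psi> ` B \<or> \<psi> ` B \<subseteq> h ` \<psi> ` B" if h: "h \<in> H" for h
    using B
  proof
    assume "B = carrier W"
    then show ?thesis
      using h coord_image by (simp add: H_def translation_stabilizer_def apartment_stabilizer_def)
  next
    assume "\<exists>x\<in>real_roots S. B = half x"
    then have "\<psi> ` B \<in> roots \<Delta> \<Sigma>" using roots_eq_halves by blast
    have cmp: "restrict h \<Sigma> ` \<psi> ` B \<subseteq> \<psi> ` B \<or> \<psi> ` B \<subseteq> restrict h \<Sigma> ` \<psi> ` B"
    proof -
      have "restrict h \<Sigma> \<in> apartment_translations \<Delta> \<Sigma>" using h by (simp add: H_def translation_stabilizer_def)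
      from apartment_translation_comparable[OF this \<open>\<psi> ` B \<in> roots \<Delta> \<Sigma>\<close>] show ?thesis .
    qed
    have "\<psi> ` B \<subseteq> \<Sigma>" using Bsub coord_image by blast
    then have eq: "restrict h \<Sigma> ` \<psi> ` B = h ` \<psi> ` B" by (intro image_cong) auto
    show ?thesis using cmp unfolding eq .
  qed
  have up: "E \<subseteq> conj_aut FG h ` E" if "h \<in> H" "h ` \<psi> ` B \<subseteq> \<psi> ` B" for h
    unfolding conj[OF that(1)] using fixer_antimono[OF that(2)] EB by simp
  show ?thesis
    unfolding eigenfactor_def
  proof (intro conjI ballI)
    show "subgroup E FG" unfolding EB by (rule fixer_subgroup[OF BC])
    show "E \<subseteq> U" by (rule EU)
  next
    fix \<alpha> assume "\<alpha> \<in> conj_aut FG ` H"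
    then obtain h where h: "h \<in> H" "\<alpha> = conj_aut FG h" by blast
    from comparable[OF h(1)] show "\<alpha> ` E \<subseteq> E \<or> E \<subseteq> \<alpha> ` E"
    proof
      assume "\<psi> ` B \<subseteq> h ` \<psi> ` B"
      then have "conj_aut FG h ` E \<subseteq> E" unfolding conj[OF h(1)] using fixer_antimono EB by simp
      then show ?thesis by (simp add: h(2))
    qed (use up h in simp)
  next
    let ?I = "\<Inter>\<alpha>\<in>{\<alpha> \<in> conj_aut FG ` H. E \<subseteq> \<alpha> ` E}. \<alpha> ` U"
    have "E \<subseteq> ?I" using EU by blast
    moreover have "?I \<subseteq> E"
    proof
      fix x assume x: "x \<in> ?I"
      have "x \<in> conj_aut FG h ` U" if h: "h \<in> T" for h
      proof (rule INT_D[OF x])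
        have "h \<in> H" using h T(1) by blast
        then show "conj_aut FG h \<in> {\<alpha> \<in> conj_aut FG ` H. E \<subseteq> \<alpha> ` E}"
          using up[OF _ shrink[OF h]] by simp
      qed
      then show "x \<in> E" unfolding E by blast
    qed
    ultimately show "E = ?I" by (rule subset_antisym)
  qed
qed

lemma plus_part_conj:
  assumes G: "G \<in> F" and U: "U \<subseteq> F"
  shows "plus_part FG U (conj_aut FG G [^]\<^bsub>AutoGroup FG\<^esub> (e::int)) =
    (\<Inter>n::nat. conj_aut FG (G [^]\<^bsub>FG\<^esub> (e * int n)) ` U)"
proof -
  interpret FG: group FG by (rule group_FG)
  interpret A: group "AutoGroup FG" by (rule FG.AutoGroup)
  interpret h: group_hom FG "AutoGroup FG" "conj_aut FG" by (rule FG.conj_aut_group_hom)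
  have "(conj_aut FG G [^]\<^bsub>AutoGroup FG\<^esub> e) [^]\<^bsub>AutoGroup FG\<^esub> n = conj_aut FG (G [^]\<^bsub>FG\<^esub> (e * int n))" for n :: nat
  proof -
    have "G [^]\<^bsub>FG\<^esub> e \<in> F" using FG.int_pow_closed[of G e] G by simp
    then have "conj_aut FG (G [^]\<^bsub>FG\<^esub> e) [^]\<^bsub>AutoGroup FG\<^esub> n = conj_aut FG ((G [^]\<^bsub>FG\<^esub> e) [^]\<^bsub>FG\<^esub> n)"
      using h.hom_nat_pow[of "G [^]\<^bsub>FG\<^esub> e" n] by simp
    moreover have "conj_aut FG G [^]\<^bsub>AutoGroup FG\<^esub> e = conj_aut FG (G [^]\<^bsub>FG\<^esub> e)"
      using h.hom_int_pow[of G e] G by simp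
    moreover have "(G [^]\<^bsub>FG\<^esub> e) [^]\<^bsub>FG\<^esub> n = G [^]\<^bsub>FG\<^esub> (e * int n)"
      using FG.int_pow_pow[of G e "int n"] G by (simp add: int_pow_int)
    ultimately show ?thesis by simp
  qed
  then show ?thesis by (simp add: plus_part_def)
qed

end

section \<open>Minimal galleries in a gem\<close>

context coordinates
begin

lemma gem_through_base:
  assumes J: "J \<subseteq> S" and R: "R \<in> residues (on_chambers \<Delta> \<Sigma>) J" and one: "\<psi> \<one>\<^bsub>W\<^esub> \<in> R"
  shows "R = \<psi> ` generate W J"
proof -
  have Jc: "J \<subseteq> carrier W" using J gen_closed by blast
  interpret P: subgroup "generate W J" W by (rule generate_is_subgroup[OF Jc])
  obtain x0 where x0: "x0 \<in> \<Sigma>" "R = {y \<in> \<Sigma>. \<delta> x0 y \<in> generate W J}"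
    using R by (auto simp: residues_def on_chambers_def)
  obtain v where v: "v \<in> carrier W" "x0 = \<psi> v" using x0(1) coord_image by blast
  have "inv\<^bsub>W\<^esub> v \<in> generate W J" using one x0 v coord_dist[of v "\<one>\<^bsub>W\<^esub>"] by simp
  then have vJ: "v \<in> generate W J" using P.m_inv_closed v(1) inv_inv by metis
  have mem: "\<psi> w \<in> R \<longleftrightarrow> w \<in> generate W J" if w: "w \<in> carrier W" for w
  proof -
    have "\<psi> w \<in> R \<longleftrightarrow> inv\<^bsub>W\<^esub> v \<cdot> w \<in> generate W J" using x0 v w coord_dist by simp
    also have "\<dots> \<longleftrightarrow> w \<in> generate W J"
    proof
      assume "inv\<^bsub>W\<^esub> v \<cdot> w \<in> generate W J"
      then have "v \<cdot> (inv\<^bsub>W\<^esub> v \<cdot> w) \<in> generate W J" using vJ by (rule P.m_closed[rotated])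
      then show "w \<in> generate W J" using v w by (simp add: m_assoc[symmetric])
    qed (use vJ in blast)
    finally show ?thesis .
  qed
  show ?thesis
  proof
    show "R \<subseteq> \<psi> ` generate W J"
    proof
      fix y assume y: "y \<in> R"
      then have "y \<in> \<Sigma>" using x0(2) by blast
      then obtain w where w: "w \<in> carrier W" "y = \<psi> w" using coord_image by blast
      then show "y \<in> \<psi> ` generate W J" using mem y by blast
    qed
    show "\<psi> ` generate W J \<subseteq> R" using mem P.subset by blast
  qed
qed

text \<open>
  A convex set contains a minimal gallery between two of its chambers, and in coordinates a gallery is
  the sequence of the partial products of a word.
\<close>

lemma minimal_gallery_word:
  assumes cs: "minimal_gallery \<Delta> cs" and hd: "hd cs = \<psi> \<one>\<^bsub>W\<^esub>" and last: "last cs \<in> \<Sigma>"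
  obtains ws where "reduced ws" "length ws = length cs - 1" "last cs = \<psi> (wp ws)"
    "\<And>i. i \<le> length ws \<Longrightarrow> cs ! i = \<psi> (wp (take i ws))"
proof -
  have g: "gallery \<Delta> cs" using cs by (simp add: minimal_gallery_def)
  have ne: "cs \<noteq> []" using g by (simp add: gallery_def)
  have in\<Sigma>: "set cs \<subseteq> \<Sigma>"
    using apt_convex cs hd last coord_in[OF one_closed] unfolding convex_chambers_def by metis
  have "\<exists>ws\<in>lists S. length ws = length xs - 1 \<and> (\<forall>i<length xs. xs ! i = \<psi> (wp (take i ws)))"
    if "gallery \<Delta> xs" "hd xs = \<psi> \<one>\<^bsub>W\<^esub>" "set xs \<subseteq> \<Sigma>" for xs
    using that
  proof (induction xs rule: rev_induct)
    case (snoc y xs)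
    show ?case
    proof (cases "xs = []")
      case True
      then show ?thesis using snoc.prems by (intro bexI[of _ "[]"]) auto
    next
      case False
      then have xs: "gallery \<Delta> xs" "adjacent \<Delta> (last xs) y" "hd xs = \<psi> \<one>\<^bsub>W\<^esub>" "set xs \<subseteq> \<Sigma>" "y \<in> \<Sigma>"
        using snoc.prems by (auto simp: gallery_def successively_append_iff)
      obtain ws where ws: "ws \<in> lists S" "length ws = length xs - 1"
        "\<forall>i<length xs. xs ! i = \<psi> (wp (take i ws))"
        using snoc.IH[OF xs(1,3,4)] by blast
      define s where "s = \<delta> (last xs) y"
      have s: "s \<in> S" using xs(2) by (simp add: s_def adjacent_def)
      have "last xs = \<psi> (wp ws)" using ws(2,3) False by (simp add: last_conv_nth)
      then have "\<delta> (\<psi> (wp ws)) y = s" by (simp add: s_def)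
      also have "s = inv\<^bsub>W\<^esub> (wp ws) \<cdot> (wp ws \<cdot> s)" using ws(1) s by (simp add: m_assoc[symmetric])
      finally have "y = \<psi> (wp ws \<cdot> s)"
        using coord_eq_of_dist[of "wp ws" "wp ws \<cdot> s" y] ws(1) s xs(5) by simp
      moreover have len: "length xs = Suc (length ws)" using ws(2) False by (cases xs) auto
      ultimately have "(xs @ [y]) ! i = \<psi> (wp (take i (ws @ [s])))" if "i < length (xs @ [y])" for i
        using that ws(1,3) s by (cases "i < length xs") (auto simp: nth_append wp_append less_Suc_eq)
      then show ?thesis using ws s False by (intro bexI[of _ "ws @ [s]"]) auto
    qed
  qed (simp add: gallery_def)
  from this[OF g hd in\<Sigma>] obtain ws where ws: "ws \<in> lists S" "length ws = length cs - 1"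
    and nth: "\<And>i. i < length cs \<Longrightarrow> cs ! i = \<psi> (wp (take i ws))" by blast
  have lastw: "last cs = \<psi> (wp ws)" using nth[of "length cs - 1"] ws ne by (simp add: last_conv_nth)
  have "\<delta> (\<psi> \<one>\<^bsub>W\<^esub>) (last cs) = wp ws" using lastw coord_dist[of "\<one>\<^bsub>W\<^esub>" "wp ws"] ws(1) by simp
  moreover obtain ys where "gallery \<Delta> ys" "hd ys = \<psi> \<one>\<^bsub>W\<^esub>" "last ys = last cs"
    "length ys = wlen (\<delta> (\<psi> \<one>\<^bsub>W\<^esub>) (last cs)) + 1"
    using gallery_ex[of "\<psi> \<one>\<^bsub>W\<^esub>" "last cs"] last apt_subset by auto
  ultimately have "length cs \<le> wlen (wp ws) + 1"
    using cs hd unfolding minimal_gallery_def by metis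
  then have "reduced ws" using wlen_le[OF ws(1)] ws by (simp add: reduced_def)
  moreover have "cs ! i = \<psi> (wp (take i ws))" if "i \<le> length ws" for i
    using nth[of i] that ws(2) ne by (cases cs) auto
  ultimately show ?thesis using that ws(2) lastw by blast
qed

end

text \<open>
  Otherwise the form would be nondegenerate.
\<close>

lemma (in affine_coxeter) rank_gt_one: "S \<noteq> {z}"
proof
  assume "S = {z}"
  then show False using a_null[OF z_in] b_z a_z by simp
qed

theorem theorem4p20:
  fixes \<Delta> :: "('w, 'c) w_metric" and X :: cartan_type and q p :: 'w
    and F :: "('c \<Rightarrow> 'c) set" and \<Sigma> R :: "'c set" and c d :: 'c and cs :: "'c list"
    and f :: "'c \<Rightarrow> 'c set \<Rightarrow> 'c \<Rightarrow> 'c" and enum :: "'c \<Rightarrow> 'c set list" and \<epsilon> :: "nat \<Rightarrow> int"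
  defines "FG \<equiv> (aut_group \<Delta>)\<lparr>carrier := F\<rparr>"
  defines "\<H> \<equiv> conj_aut FG ` translation_stabilizer \<Delta> F \<Sigma>"
  defines "U \<equiv> {g \<in> F. g c = c} \<inter> special_aut \<Delta>"
  defines "k \<equiv> length cs - 1"
  defines "\<gamma> \<equiv> \<lambda>i. conj_aut FG (word_prod FG (map (f (cs ! i)) (enum (cs ! i))))"
  assumes "bruhat_tits X q \<Delta>" and "thick \<Delta>" and "locally_finite \<Delta>"
    and "subgroup F (aut_group \<Delta>)" and "closedin (aut_topology \<Delta>) F" and "G_dagger X q \<Delta> \<subseteq> F"
    and "\<Sigma> \<in> apartments \<Delta>" and "c \<in> \<Sigma>"
    and "special_vertex X \<Delta> p" and "R \<in> gems \<Delta> \<Sigma> p" and "c \<in> R"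
    and "d \<in> R" and "opposite_in \<Delta> (gens \<Delta> - {p}) c d"
    and "minimal_gallery \<Delta> cs" and "hd cs = c" and "last cs = d"
    and "\<And>e \<alpha>. e \<in> R \<Longrightarrow> \<alpha> \<in> roots_at \<Delta> \<Sigma> R e \<Longrightarrow>
           f e \<alpha> \<in> apartment_stabilizer F \<Sigma> \<inter> special_aut \<Delta> \<and>
           is_basic_translation \<Delta> \<Sigma> R e \<alpha> (restrict (f e \<alpha>) \<Sigma>)"
    and "\<And>e. e \<in> R \<Longrightarrow> distinct (enum e) \<and> set (enum e) = roots_at \<Delta> \<Sigma> R e"
    and "\<And>i. i \<in> {1..k} \<Longrightarrow> \<epsilon> i \<in> {1, -1}"
  shows "eigenfactor FG U \<H>
           (plus_parts FG U {\<gamma> i [^]\<^bsub>AutoGroup FG\<^esub> \<epsilon> i | i. i \<in> {1..k}})"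
proof -
  note bt = \<open>bruhat_tits X q \<Delta>\<close> and F = \<open>subgroup F (aut_group \<Delta>)\<close>
    and apt = \<open>\<Sigma> \<in> apartments \<Delta>\<close> and special = \<open>special_vertex X \<Delta> p\<close>
    and f_basic = assms(22) and enum = assms(23) and \<epsilon> = assms(24)
  have X: "valid_cartan_type X" "2 \<le> cartan_rank X" and bldg: "building \<Delta>"
    and diag: "has_diagram (weyl \<Delta>) (gens \<Delta>) {0..cartan_rank X} (affine_edges X)"
    using bt by (auto simp: bruhat_tits_def affine_building_def)
  have cox: "coxeter_system (weyl \<Delta>) (gens \<Delta>)" using bldg by (simp add: building_def)
  define J where "J = gens \<Delta> - {p}"
  have p: "p \<in> gens \<Delta>" "has_diagram (weyl \<Delta>) (gens \<Delta> - {p}) {1..cartan_rank X} (spherical_edges X)"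
    using special by (auto simp: special_vertex_def)
  obtain b a z \<eta> where aff: "affine_coxeter (weyl \<Delta>) (gens \<Delta>) b a z"
    and \<eta>: "bij_betw \<eta> (gens \<Delta> - {z}) J"
    "\<And>s t. \<lbrakk>s \<in> gens \<Delta> - {z}; t \<in> gens \<Delta> - {z}; s \<noteq> t\<rbrakk> \<Longrightarrow>
      group.ord (weyl \<Delta>) (\<eta> s \<otimes>\<^bsub>weyl \<Delta>\<^esub> \<eta> t) = group.ord (weyl \<Delta>) (s \<otimes>\<^bsub>weyl \<Delta>\<^esub> t)"
    using affine_diagram_coxeter[OF cox X diag p] unfolding J_def by metis
  interpret apartment \<Delta> \<Sigma> by unfold_locales (fact bldg, fact apt)
  obtain \<psi> where \<psi>: "\<psi> \<in> special_iso (coxeter_building (weyl \<Delta>) (gens \<Delta>)) (on_chambers \<Delta> \<Sigma>)"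
    and \<psi>c: "\<psi> \<one>\<^bsub>weyl \<Delta>\<^esub> = c"
    using apartment_coordinates[OF \<open>c \<in> \<Sigma>\<close>] by blast
  interpret translated_apartment \<Delta> \<Sigma> \<psi> b a z F
    by (intro translated_apartment.intro affine_apartment.intro coordinates.intro
        coordinates_axioms.intro automorphism_subgroup.intro automorphism_subgroup_axioms.intro
        aff apartment_axioms weyl_building_axioms \<psi> F)
  have FG: "FG = automorphism_subgroup.FG \<Delta> F" by (simp add: FG_def assms(1))
  have JS: "J \<subset> gens \<Delta>" "J \<subseteq> gens \<Delta>" using p(1) by (auto simp: J_def)
  have R: "R = \<psi> ` generate (weyl \<Delta>) J"
    using gem_through_base[OF JS(2)] \<open>R \<in> gems \<Delta> \<Sigma> p\<close> \<open>c \<in> R\<close> \<psi>c by (simp add: gems_def J_def)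
  have "d \<in> \<Sigma>"
    using \<open>d \<in> R\<close> generate_closed[OF JS(2)] coord_in unfolding R by blast
  obtain ws where ws: "reduced ws" "length ws = k" "d = \<psi> (wp ws)"
    and nth: "\<And>i. i \<le> length ws \<Longrightarrow> cs ! i = \<psi> (wp (take i ws))"
    using minimal_gallery_word[OF \<open>minimal_gallery \<Delta> cs\<close>] \<open>hd cs = c\<close> \<open>last cs = d\<close> \<open>d \<in> \<Sigma>\<close> \<psi>c k_def
    by metis
  have wsS: "ws \<in> lists (gens \<Delta>)" using ws(1) by (simp add: reduced_def)
  have "wdist \<Delta> c d = wp ws"
    using coord_dist[of "\<one>\<^bsub>weyl \<Delta>\<^esub>" "wp ws"] wsS by (simp add: \<psi>c ws(3))
  then have wJ: "wp ws \<in> generate (weyl \<Delta>) J"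
    and longest: "\<And>w. w \<in> generate (weyl \<Delta>) J \<Longrightarrow> wlen w \<le> wlen (wp ws)"
    using \<open>opposite_in \<Delta> (gens \<Delta> - {p}) c d\<close> by (simp_all add: opposite_in_def J_def)
  have wsJ: "ws \<in> lists J" using reduced_word_in_parabolic[OF JS(2) ws(1) wJ] .
  obtain s0 where s0: "s0 \<in> J"
  proof -
    have "gens \<Delta> - {z} \<noteq> {}" using rank_gt_one z_in by blast
    then show ?thesis using \<eta>(1) that by (auto simp: bij_betw_def)
  qed
  have "ws \<noteq> []"
  proof
    assume "ws = []"
    then show False using longest[OF generate.incl[OF s0]] s0 JS(2) by auto
  qed
  have ci: "wp (take i ws) \<in> generate (weyl \<Delta>) J" for i
    using wsJ by (intro word_in_generate) (metis append_in_lists_conv append_take_drop_id)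
  have csR: "cs ! i \<in> R" if "i \<in> {1..k}" for i
    using nth[of i] ci[of i] that ws(2) by (simp add: R)
  define G where "G e \<alpha> = (SOME g. acts (f e \<alpha>) g)" for e \<alpha>
  have G: "acts (f e \<alpha>) (G e \<alpha>)" if "e \<in> R" "\<alpha> \<in> roots_at \<Delta> \<Sigma> R e" for e \<alpha>
  proof -
    have "f e \<alpha> \<in> F" "f e \<alpha> ` \<Sigma> = \<Sigma>" "f e \<alpha> \<in> special_aut \<Delta>"
      using f_basic[OF that] by (auto simp: apartment_stabilizer_def)
    then have "\<exists>g. acts (f e \<alpha>) g" using special_aut_is_left_mult[of "f e \<alpha>"] by (auto simp: acts_def)
    then show ?thesis unfolding G_def by (rule someI_ex)
  qed
  have Gshift: "translation (G e \<alpha>)"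
      "\<alpha> = \<psi> ` half (rep u (basis s)) \<Longrightarrow> shift (G e \<alpha>) (rep u (basis s)) < 0"
      "\<alpha> \<noteq> \<psi> ` half (rep u (basis s)) \<Longrightarrow> shift (G e \<alpha>) (rep u (basis s)) = 0"
    if e: "e = \<psi> u" "u \<in> generate (weyl \<Delta>) J" and \<alpha>: "\<alpha> \<in> roots_at \<Delta> \<Sigma> R e" and s: "s \<in> J" for e u \<alpha> s
  proof -
    have eR: "e \<in> R" using e by (simp add: R)
    have basic: "is_basic_translation \<Delta> \<Sigma> (\<psi> ` generate (weyl \<Delta>) J) (\<psi> u) \<alpha> (restrict (f e \<alpha>) \<Sigma>)"
      using f_basic[OF eR \<alpha>] e(1) R by simp
    note basic_translation_shift[OF JS(2) e(2) s basic actsD(3)[OF G[OF eR \<alpha>]] actsD(4)[OF G[OF eR \<alpha>]]]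
    then show "translation (G e \<alpha>)"
      "\<alpha> = \<psi> ` half (rep u (basis s)) \<Longrightarrow> shift (G e \<alpha>) (rep u (basis s)) < 0"
      "\<alpha> \<noteq> \<psi> ` half (rep u (basis s)) \<Longrightarrow> shift (G e \<alpha>) (rep u (basis s)) = 0"
      by auto
  qed
  define h where "h i = word_prod FG (map (f (cs ! i)) (enum (cs ! i)))" for i
  define t where "t i = word_prod (weyl \<Delta>) (map (G (cs ! i)) (enum (cs ! i)))" for i
  have enum_set: "distinct (enum (cs ! i))" "set (enum (cs ! i)) = roots_at \<Delta> \<Sigma> R (cs ! i)"
    if "i \<in> {1..k}" for i
    using enum[OF csR[OF that]] by auto
  have ht: "acts (h i) (t i)" if "i \<in> {1..k}" for i
    unfolding h_def t_def FG
  proof (rule acts_word_prod)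
    show "list_all2 acts (map (f (cs ! i)) (enum (cs ! i))) (map (G (cs ! i)) (enum (cs ! i)))"
      using G[OF csR[OF that]] enum_set(2)[OF that] by (auto simp: list_all2_map1 list_all2_map2 list_all2_same)
  qed
  have t: "translation (t i)"
    and base: "\<And>s. s \<in> J \<Longrightarrow> shift (t i) (rep (wp (take i ws)) (basis s)) < 0" if i: "i \<in> {1..k}" for i
  proof -
    let ?u = "wp (take i ws)"
    have e: "cs ! i = \<psi> ?u" using nth i ws(2) by simp
    have tr: "translation g" if g: "g \<in> set (map (G (cs ! i)) (enum (cs ! i)))" for g
      using g enum_set(2)[OF i] Gshift(1)[OF e ci _ s0] by auto
    note prod = translation_word_prod[of "map (G (cs ! i)) (enum (cs ! i))", OF tr]
    show "translation (t i)" unfolding t_def by (rule conjunct1[OF prod])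
    fix s assume s: "s \<in> J"
    let ?x = "rep ?u (basis s)" and ?A = "set (enum (cs ! i))"
    have x: "?x \<in> real_roots (gens \<Delta>)"
      using real_rootI[OF ci s] real_roots_mono[OF JS(2)] by blast
    have x_in: "\<psi> ` half ?x \<in> ?A"
      using simple_root_at[OF JS(2) ci s, of i] enum_set(2)[OF i] R e by simp
    have "shift (t i) ?x = (\<Sum>g\<leftarrow>map (G (cs ! i)) (enum (cs ! i)). shift g ?x)"
      unfolding t_def by (rule bspec[OF conjunct2[OF prod] x])
    also have "\<dots> = (\<Sum>\<alpha>\<in>?A. shift (G (cs ! i) \<alpha>) ?x)"
      using enum_set(1)[OF i] by (simp add: sum_list_distinct_conv_sum_set o_def)
    also have "\<dots> = shift (G (cs ! i) (\<psi> ` half ?x)) ?x"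
    proof -
      have "(\<Sum>\<alpha>\<in>?A - {\<psi> ` half ?x}. shift (G (cs ! i) \<alpha>) ?x) = 0"
        using Gshift(3)[OF e ci _ s] enum_set(2)[OF i] by (intro sum.neutral) auto
      then show ?thesis using x_in by (simp add: sum.remove)
    qed
    also have "\<dots> < 0" using Gshift(2)[OF e ci _ s HOL.refl] x_in enum_set(2)[OF i] by simp
    finally show "shift (t i) ?x < 0" .
  qed
  define A where "A = {t i [^]\<^bsub>weyl \<Delta>\<^esub> (\<epsilon> i * int n) | i n. i \<in> {1..k}}"
  define \<R> where "\<R> = {x \<in> real_roots (gens \<Delta>). \<forall>i\<in>{1..length ws}. \<forall>n::nat. t i [^]\<^bsub>weyl \<Delta>\<^esub> (\<epsilon> i * int n) \<in> half x}"
  have \<R>A: "x \<in> \<R> \<longleftrightarrow> x \<in> real_roots (gens \<Delta>) \<and> A \<subseteq> half x" for x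
    unfolding \<R>_def A_def ws(2) by blast
  have core: "\<R> = {} \<or> (\<exists>x0\<in>\<R>. (\<forall>x\<in>\<R>. half x0 \<subseteq> half x) \<and>
    (\<forall>i\<in>{1..length ws}. of_int (\<epsilon> i) * shift (t i) x0 \<le> 0))"
    unfolding \<R>_def
  proof (rule roots_containing_translates[OF JS(2) wsJ \<open>ws \<noteq> []\<close> longest])
    show "\<exists>y\<in>real_roots J. \<exists>c>0. \<exists>k. x = comb c y k a" if "x \<in> real_roots (gens \<Delta>)" for x
      using special_vertex_directions[OF JS(1) \<eta> that] .
  qed (use t base \<epsilon> ws(2) in auto)
  have Asub: "A \<subseteq> carrier (weyl \<Delta>)" using t by (auto simp: A_def)
  have one: "1 \<in> {1..k}" using \<open>ws \<noteq> []\<close> ws(2) by (cases k) auto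
  have A_mem: "t i [^]\<^bsub>weyl \<Delta>\<^esub> (\<epsilon> i * int n) \<in> A" if "i \<in> {1..k}" for i n
    using that unfolding A_def by blast
  have oneA: "\<one>\<^bsub>weyl \<Delta>\<^esub> \<in> A" using A_mem[OF one, of 0] by simp
  define T where "T = {h i [^]\<^bsub>FG\<^esub> (\<epsilon> i * int n) | i n. i \<in> {1..k}}"
  have acts_T: "acts (h i [^]\<^bsub>FG\<^esub> m) (t i [^]\<^bsub>weyl \<Delta>\<^esub> m)" if "i \<in> {1..k}" for i and m :: int
    using acts_int_pow[OF ht[OF that]] by (simp add: FG)
  have U: "U = fixer {\<psi> \<one>\<^bsub>weyl \<Delta>\<^esub>}" by (auto simp: U_def fixer_def \<psi>c)
  have UF: "U \<subseteq> F" by (auto simp: U_def)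
  define E where "E = plus_parts FG U {\<gamma> i [^]\<^bsub>AutoGroup FG\<^esub> \<epsilon> i | i. i \<in> {1..k}}"
  have E1: "E = (\<Inter>x\<in>T. conj_aut FG x ` U)"
  proof -
    have plus: "plus_part FG U (\<gamma> i [^]\<^bsub>AutoGroup FG\<^esub> \<epsilon> i) =
        (\<Inter>n::nat. conj_aut FG (h i [^]\<^bsub>FG\<^esub> (\<epsilon> i * int n)) ` U)" if "i \<in> {1..k}" for i
      using plus_part_conj[OF actsD(1)[OF ht[OF that]] UF, of "\<epsilon> i"] by (simp add: FG \<gamma>_def h_def)
    have set: "{\<gamma> i [^]\<^bsub>AutoGroup FG\<^esub> \<epsilon> i | i. i \<in> {1..k}} = (\<lambda>i. \<gamma> i [^]\<^bsub>AutoGroup FG\<^esub> \<epsilon> i) ` {1..k}"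
      by blast
    have "E = (\<Inter>i\<in>{1..k}. plus_part FG U (\<gamma> i [^]\<^bsub>AutoGroup FG\<^esub> \<epsilon> i))"
      unfolding E_def plus_parts_def set by (simp add: image_image)
    also have "\<dots> = (\<Inter>i\<in>{1..k}. \<Inter>n::nat. conj_aut FG (h i [^]\<^bsub>FG\<^esub> (\<epsilon> i * int n)) ` U)"
      by (rule INF_cong[OF HOL.refl plus])
    also have "\<dots> = (\<Inter>x\<in>T. conj_aut FG x ` U)"
      unfolding T_def by blast
    finally show ?thesis .
  qed
  have E2: "E = fixer (\<psi> ` A)"
  proof -
    have conj: "conj_aut FG (h i [^]\<^bsub>FG\<^esub> m) ` U = fixer {\<psi> (t i [^]\<^bsub>weyl \<Delta>\<^esub> m)}"
      if "i \<in> {1..k}" for i and m :: int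
      using conj_fixer[OF actsD(1)[OF acts_T[OF that, of m]], of "{\<psi> \<one>\<^bsub>weyl \<Delta>\<^esub>}"]
        actsD(3,4)[OF acts_T[OF that, of m]] by (simp add: U FG)
    have "E = (\<Inter>i\<in>{1..k}. \<Inter>n::nat. conj_aut FG (h i [^]\<^bsub>FG\<^esub> (\<epsilon> i * int n)) ` U)"
      unfolding E1 T_def by blast
    also have "\<dots> = (\<Inter>i\<in>{1..k}. \<Inter>n::nat. fixer {\<psi> (t i [^]\<^bsub>weyl \<Delta>\<^esub> (\<epsilon> i * int n))})"
      using conj by (intro INF_cong) auto
    also have "\<dots> = fixer (\<psi> ` A)"
      using one unfolding fixer_def A_def by blast
    finally show ?thesis .
  qed
  \<comment> \<open>The hull of \<open>A\<close>.\<close>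
  define B where "B = (if \<R> = {} then carrier (weyl \<Delta>)
    else half (SOME x0. x0 \<in> \<R> \<and> (\<forall>x\<in>\<R>. half x0 \<subseteq> half x) \<and>
      (\<forall>i\<in>{1..length ws}. of_int (\<epsilon> i) * shift (t i) x0 \<le> 0)))"
  have B: "B = carrier (weyl \<Delta>) \<and> \<R> = {} \<or> (\<exists>x0. B = half x0 \<and> x0 \<in> \<R> \<and> (\<forall>x\<in>\<R>. half x0 \<subseteq> half x) \<and>
      (\<forall>i\<in>{1..length ws}. of_int (\<epsilon> i) * shift (t i) x0 \<le> 0))"
  proof (cases "\<R> = {}")
    case False
    then have "\<exists>x0. x0 \<in> \<R> \<and> (\<forall>x\<in>\<R>. half x0 \<subseteq> half x) \<and>
      (\<forall>i\<in>{1..length ws}. of_int (\<epsilon> i) * shift (t i) x0 \<le> 0)" using core by blast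
    from someI_ex[OF this] show ?thesis unfolding B_def if_not_P[OF False] by blast
  qed (simp add: B_def)
  have E3: "E = fixer (\<psi> ` B)"
    unfolding E2
  proof (rule fixer_eq_hull[OF Asub])
    show "A \<noteq> {}" using oneA by blast
    show "A \<subseteq> B" using B Asub \<R>A by blast
    show "B \<subseteq> carrier (weyl \<Delta>)" using B half_subset by auto
    show "B \<subseteq> half x" if "x \<in> real_roots (gens \<Delta>)" "A \<subseteq> half x" for x
      using B \<R>A[of x] that by blast
  qed
  have shrink: "g ` \<psi> ` B \<subseteq> \<psi> ` B" if "g \<in> T" for g
  proof -
    obtain i n where i: "i \<in> {1..k}" and g: "g = h i [^]\<^bsub>FG\<^esub> (\<epsilon> i * int n)" using \<open>g \<in> T\<close> by (auto simp: T_def)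
    have act: "acts g (t i [^]\<^bsub>weyl \<Delta>\<^esub> (\<epsilon> i * int n))" unfolding g by (rule acts_T[OF i])
    from B show ?thesis
    proof
      assume "B = carrier (weyl \<Delta>) \<and> \<R> = {}"
      then show ?thesis using acts_image[OF act] coord_image by simp
    next
      assume "\<exists>x0. B = half x0 \<and> x0 \<in> \<R> \<and> (\<forall>x\<in>\<R>. half x0 \<subseteq> half x) \<and>
        (\<forall>i\<in>{1..length ws}. of_int (\<epsilon> i) * shift (t i) x0 \<le> 0)"
      then obtain x0 where x0: "B = half x0" "x0 \<in> real_roots (gens \<Delta>)" "of_int (\<epsilon> i) * shift (t i) x0 \<le> 0"
        using i ws(2) \<R>A by blast
      have "shift (t i [^]\<^bsub>weyl \<Delta>\<^esub> (\<epsilon> i * int n)) x0 = real n * (of_int (\<epsilon> i) * shift (t i) x0)"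
        using translation_int_pow(2)[OF t[OF i] x0(2)] by simp
      also have "\<dots> \<le> 0" by (rule mult_nonneg_nonpos[OF of_nat_0_le_iff x0(3)])
      finally have "half (rep (t i [^]\<^bsub>weyl \<Delta>\<^esub> (\<epsilon> i * int n)) x0) \<subseteq> half x0"
        by (rule translation_half_mono(2)[OF translation_int_pow(1)[OF t[OF i]] x0(2)])
      then show ?thesis unfolding x0(1) acts_image_half[OF act] root_subset_iff .
    qed
  qed
  have TH: "T \<subseteq> translation_stabilizer \<Delta> F \<Sigma>"
  proof
    fix g assume "g \<in> T"
    then obtain i n where i: "i \<in> {1..k}" and g: "g = h i [^]\<^bsub>FG\<^esub> (\<epsilon> i * int n)" by (auto simp: T_def)
    have act: "acts g (t i [^]\<^bsub>weyl \<Delta>\<^esub> (\<epsilon> i * int n))" unfolding g by (rule acts_T[OF i])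
    have "restrict g \<Sigma> \<in> apartment_translations \<Delta> \<Sigma>"
      by (rule apartment_translation_of_translation[OF actsD(2)[OF act] translation_int_pow(1)[OF t[OF i]]])
        (rule actsD(4)[OF act])
    then show "g \<in> translation_stabilizer \<Delta> F \<Sigma>"
      using actsD(1)[OF act] acts_image[OF act]
      by (simp add: translation_stabilizer_def apartment_stabilizer_def)
  qed
  have "T \<noteq> {}" using one unfolding T_def by blast
  have EU: "E \<subseteq> U" unfolding E2 U using oneA by (intro fixer_antimono) blast
  have B': "B = carrier (weyl \<Delta>) \<or> (\<exists>x\<in>real_roots (gens \<Delta>). B = half x)" using B \<R>A by blast
  show ?thesis
    unfolding E_def[symmetric] \<H>_def
    using eigenfactor_of_hull[OF TH \<open>T \<noteq> {}\<close> E1[unfolded FG U] EU[unfolded U] E3 B' shrink]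
    by (simp add: FG U)
qed

end
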